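(* For all $\kappa,\lambda,\mu,\nu\in\mathcal P$ one has $$ \langle s_{\lambda/\kappa},s_{\nu/\mu}\rangle=\sum_{M\in\mathcal M}\varepsilon(\kappa+\operatorname{row}(M),\lambda)\;\varepsilon(\mu+\operatorname{col}(M),\nu) $$ and $$ \langle s_{\lambda/\kappa},s_{\nu/\mu}\rangle=\sum_{M\in\mathcal M^{[2]}}\varepsilon(\kappa^t+\operatorname{col}(M),\lambda^t)\;\varepsilon(\mu+\operatorname{row}(M),\nu). $$
   Context: $\mathbf N=\{0,1,2,\ldots\}$. A composition is a finitely supported sequence $\alpha=(\alpha_i)_{i\in\mathbf N}$ of natural numbers; $\mathcal C$ is the set of all compositions, added entrywise. $\mathcal P\subset\mathcal C$ is the set of partitions, i.e. weakly decreasing compositions; $\lambda^t$ is the transpose partition, $\lambda^t_j=\#\{i: j<\lambda_i\}$. Finite vectors are extended by zeros, so $\mathbf N^n\subset\mathcal C$. Matrices: $\mathcal M$ is the set of matrices $M=(M_{i,j})_{i,j\in\mathbf N}$ with entries in $\mathbf N$, only finitely many nonzero; $\mathcal M^{[2]}\subset\mathcal M$ is the subset of those with all entries in $\{0,1\}$. $\operatorname{row}(M)=(\sum_jM_{i,j})_i\in\mathcal C$ and $\operatorname{col}(M)=(\sum_iM_{i,j})_j\in\mathcal C$. $\Lambda$ is the ring of symmetric functions over $\mathbf Z$ (symmetric power series of bounded degree in indeterminates $X_i$, $i\in\mathbf N$). Schur functions: for $\alpha\in\mathbf N^n$ put $a_\alpha[X_{[n]}]=\sum_{\sigma\in\mathbf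 S_n}\operatorname{sgn}(\sigma)\prod_{i=0}^{n-1}X_{\sigma(i)}^{\alpha_i}$, let $\delta_n=(n-1,\ldots,1,0)$, and set $s_\alpha[X_{[n]}]=a_{\delta_n+\alpha}[X_{[n]}]/a_{\delta_n}[X_{[n]}]$ for $\alpha\in\mathbf N^n$ and $s_\alpha[X_{[n]}]=0$ for $\alpha\in\mathcal C\setminus\mathbf N^n$. Then, for every composition $\alpha$, $s_\alpha\in\Lambda$ is the unique symmetric function which for every $n$ becomes $s_\alpha[X_{[n]}]$ upon setting $X_i=0$ for all $i\ge n$. The set $\{s_\lambda:\lambda\in\mathcal P\}$ is a $\mathbf Z$-basis of $\Lambda$; $\langle\cdot,\cdot\rangle$ is the scalar product on $\Lambda$ for which this basis is orthonormal. For $\lambda,\mu\in\mathcal P$ the skew Schur function $s_{\lambda/\mu}$ is characterised by $\langle s_{\lambda/\mu},f\rangle=\langle s_\lambda,s_\mu f\rangle$ for all $f\in\Lambda$. For $\alpha\in\mathcal C$ and $\lambda\in\mathcal P$ one defines $\varepsilon(\alpha,\lambda)=\langle s_\alpha,s_\lambda\rangle\in\{-1,0,1\}$. An infinite sum is understood as a sum with only finitely many nonzero terms. *)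

theory Defs
  imports "HOL-Library.Poly_Mapping" "HOL-Combinatorics.Permutations"
begin

section \<open>Compositions, partitions and matrices\<close>

text \<open>The finite vectors of length \<open>n\<close> are the compositions \<open>\<alpha>\<close> with \<open>keys \<alpha> \<subseteq> {..<n}\<close>.\<close>

type_synonym composition = "nat \<Rightarrow>\<^sub>0 nat"

abbreviation "lookup \<equiv> Poly_Mapping.lookup"
abbreviation "keys \<equiv> Poly_Mapping.keys"

definition weight :: "composition \<Rightarrow> nat"
  where "weight \<alpha> = Sum_any (lookup \<alpha>)"

definition partitions :: "composition set"
  where "partitions = {\<alpha>. antimono (lookup \<alpha>)}"

lift_definition conjugate :: "composition \<Rightarrow> composition"
  is "\<lambda>\<alpha> j. card {i. j < \<alpha> i}"
proof -
  fix \<alpha> :: "nat \<Rightarrow> nat"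
  assume fin: "finite {i. \<alpha> i \<noteq> 0}"
  have "{j. card {i. j < \<alpha> i} \<noteq> 0} \<subseteq> (\<Union>i\<in>{i. \<alpha> i \<noteq> 0}. {..<\<alpha> i})"
  proof
    fix j assume "j \<in> {j. card {i. j < \<alpha> i} \<noteq> 0}"
    then have "{i. j < \<alpha> i} \<noteq> {}" by (metis (mono_tags) card.empty mem_Collect_eq)
    then obtain i where "j < \<alpha> i" by auto
    then show "j \<in> (\<Union>i\<in>{i. \<alpha> i \<noteq> 0}. {..<\<alpha> i})" by force
  qed
  moreover have "finite (\<Union>i\<in>{i. \<alpha> i \<noteq> 0}. {..<\<alpha> i})" using fin by auto
  ultimately show "finite {j. card {i. j < \<alpha> i} \<noteq> 0}" by (rule finite_subset)
qed

type_synonym matrix = "(nat \<times> nat) \<Rightarrow>\<^sub>0 nat"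

definition binary_matrices :: "matrix set"
  where "binary_matrices = {M. \<forall>i j. lookup M (i, j) \<in> {0, 1}}"

lift_definition row :: "matrix \<Rightarrow> composition"
  is "\<lambda>M i. Sum_any (\<lambda>j. M (i, j))"
proof -
  fix M :: "nat \<times> nat \<Rightarrow> nat"
  assume fin: "finite {p. M p \<noteq> 0}"
  have "{i. Sum_any (\<lambda>j. M (i, j)) \<noteq> 0} \<subseteq> fst ` {p. M p \<noteq> 0}"
    by (force elim!: Sum_any.not_neutral_obtains_not_neutral)
  then show "finite {i. Sum_any (\<lambda>j. M (i, j)) \<noteq> 0}"
    using fin finite_subset by blast
qed

lift_definition col :: "matrix \<Rightarrow> composition"
  is "\<lambda>M j. Sum_any (\<lambda>i. M (i, j))"
proof -
  fix M :: "nat \<times> nat \<Rightarrow> nat"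
  assume fin: "finite {p. M p \<noteq> 0}"
  have "{j. Sum_any (\<lambda>i. M (i, j)) \<noteq> 0} \<subseteq> snd ` {p. M p \<noteq> 0}"
    by (force elim!: Sum_any.not_neutral_obtains_not_neutral)
  then show "finite {j. Sum_any (\<lambda>i. M (i, j)) \<noteq> 0}"
    using fin finite_subset by blast
qed

lemma weight_add: "weight (\<alpha> + \<beta>) = weight \<alpha> + weight \<beta>"
  unfolding weight_def lookup_add
  by (rule Sum_any.distrib) simp_all

lemma weight_zero [simp]: "weight 0 = 0"
  by (simp add: weight_def)

lemma lookup_le_weight: "lookup \<alpha> i \<le> weight \<alpha>"
proof (cases "i \<in> keys \<alpha>")
  case True
  have "lookup \<alpha> i \<le> sum (lookup \<alpha>) (keys \<alpha>)"
    by (rule member_le_sum) (use True in auto)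
  also have "\<dots> = weight \<alpha>"
    unfolding weight_def
    by (rule Sum_any.expand_superset [symmetric]) (auto simp: in_keys_iff)
  finally show ?thesis .
qed (simp add: in_keys_iff)

lemma finite_bounded_compositions:
  assumes "finite A"
  shows "finite {\<alpha> :: composition. keys \<alpha> \<subseteq> A \<and> (\<forall>i. lookup \<alpha> i \<le> d)}"
proof -
  let ?S = "{\<alpha> :: composition. keys \<alpha> \<subseteq> A \<and> (\<forall>i. lookup \<alpha> i \<le> d)}"
  let ?F = "{f. \<forall>x. (x \<in> A \<longrightarrow> f x \<in> {..d}) \<and> (x \<notin> A \<longrightarrow> f x = 0)}"
  have "finite ?F"
    using assms by (intro finite_set_of_finite_funs) auto
  moreover have "lookup ` ?S \<subseteq> ?F"
    by (auto simp: in_keys_iff)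
  ultimately have "finite (lookup ` ?S)"
    by (rule finite_subset [rotated])
  then show ?thesis
    by (rule finite_imageD) (auto intro!: inj_onI poly_mapping_eqI)
qed

definition splittings :: "composition \<Rightarrow> (composition \<times> composition) set"
  where "splittings \<alpha> = {(\<beta>, \<gamma>). \<beta> + \<gamma> = \<alpha>}"

lemma finite_splittings [simp]: "finite (splittings \<alpha>)"
proof -
  let ?S = "{\<beta> :: composition. keys \<beta> \<subseteq> keys \<alpha> \<and> (\<forall>i. lookup \<beta> i \<le> weight \<alpha>)}"
  have "lookup \<beta> i \<le> weight (\<beta> + \<gamma>)" "lookup \<gamma> i \<le> weight (\<beta> + \<gamma>)" for \<beta> \<gamma> i
    using lookup_le_weight [of \<beta> i] lookup_le_weight [of \<gamma> i] by (simp_all add: weight_add)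
  then have "splittings \<alpha> \<subseteq> ?S \<times> ?S"
    by (auto simp: splittings_def in_keys_iff lookup_add)
  then show ?thesis
    by (rule finite_subset) (intro finite_SigmaI finite_bounded_compositions finite_keys)
qed

section \<open>The ring of symmetric functions\<close>

text \<open>A power series in the indeterminates \<open>X\<^sub>i\<close> is given by its coefficients on the monomials,
  which are indexed by compositions.\<close>

definition is_symfun :: "(composition \<Rightarrow> int) \<Rightarrow> bool"
  where "is_symfun f \<longleftrightarrow>
    (\<exists>d. \<forall>\<alpha>. f \<alpha> \<noteq> 0 \<longrightarrow> weight \<alpha> \<le> d) \<and>
    (\<forall>\<pi>. bij \<pi> \<longrightarrow> (\<forall>\<alpha>. f (Poly_Mapping.map_key \<pi> \<alpha>) = f \<alpha>))"

typedef symfun = "{f. is_symfun f}"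
  morphisms coeff_of Abs_symfun
  by (rule exI [of _ "\<lambda>_. 0"]) (simp add: is_symfun_def)

setup_lifting type_definition_symfun

definition series_mult :: "(composition \<Rightarrow> int) \<Rightarrow> (composition \<Rightarrow> int) \<Rightarrow> composition \<Rightarrow> int"
  where "series_mult f g \<alpha> = (\<Sum>(\<beta>, \<gamma>)\<in>splittings \<alpha>. f \<beta> * g \<gamma>)"

lemma is_symfun_mult:
  assumes "is_symfun f" "is_symfun g"
  shows "is_symfun (series_mult f g)"
  unfolding is_symfun_def
proof (intro conjI allI impI)
  obtain d where d: "\<And>\<alpha>. f \<alpha> \<noteq> 0 \<Longrightarrow> weight \<alpha> \<le> d"
    using assms(1) unfolding is_symfun_def by blast
  obtain e where e: "\<And>\<alpha>. g \<alpha> \<noteq> 0 \<Longrightarrow> weight \<alpha> \<le> e"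
    using assms(2) unfolding is_symfun_def by blast
  show "\<exists>d. \<forall>\<alpha>. series_mult f g \<alpha> \<noteq> 0 \<longrightarrow> weight \<alpha> \<le> d"
  proof (intro exI allI impI)
    fix \<alpha> assume "series_mult f g \<alpha> \<noteq> 0"
    then obtain p where "p \<in> splittings \<alpha>" "(case p of (\<beta>, \<gamma>) \<Rightarrow> f \<beta> * g \<gamma>) \<noteq> 0"
      unfolding series_mult_def by (rule sum.not_neutral_contains_not_neutral)
    then obtain \<beta> \<gamma> where "\<alpha> = \<beta> + \<gamma>" "f \<beta> \<noteq> 0" "g \<gamma> \<noteq> 0"
      unfolding splittings_def by auto
    then show "weight \<alpha> \<le> d + e"
      using d e by (simp add: weight_add add_mono)
  qed
next
  fix \<pi> :: "nat \<Rightarrow> nat" and \<alpha>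
  assume bij: "bij \<pi>"
  let ?k = "Poly_Mapping.map_key \<pi> :: composition \<Rightarrow> composition"
  let ?l = "Poly_Mapping.map_key (inv \<pi>) :: composition \<Rightarrow> composition"
  have inj: "inj \<pi>" "inj (inv \<pi>)" using bij by (auto simp: bij_is_inj bij_imp_bij_inv)
  have kl: "?k (?l \<beta>) = \<beta>" for \<beta>
    using inj bij
    by (intro poly_mapping_eqI) (simp add: map_key.rep_eq bij_is_inj)
  have lk: "?l (?k \<beta>) = \<beta>" for \<beta>
    using inj bij
    by (intro poly_mapping_eqI) (simp add: map_key.rep_eq bij_is_surj surj_f_inv_f)
  have fk: "f (?k \<beta>) = f \<beta>" and gk: "g (?k \<beta>) = g \<beta>" for \<beta>
    using assms bij unfolding is_symfun_def by blast+
  show "series_mult f g (?k \<alpha>) = series_mult f g \<alpha>"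
    unfolding series_mult_def splittings_def
  proof (rule sum.reindex_bij_witness [where i = "map_prod ?k ?k" and j = "map_prod ?l ?l"])
    fix p assume p: "p \<in> {(\<beta>, \<gamma>). \<beta> + \<gamma> = ?k \<alpha>}"
    show "map_prod ?k ?k (map_prod ?l ?l p) = p"
      by (simp add: kl prod_eq_iff)
    show "map_prod ?l ?l p \<in> {(\<beta>, \<gamma>). \<beta> + \<gamma> = \<alpha>}"
      using p by (auto simp: lk map_key_plus [OF inj(2), symmetric])
    show "(case map_prod ?l ?l p of (\<beta>, \<gamma>) \<Rightarrow> f \<beta> * g \<gamma>) = (case p of (\<beta>, \<gamma>) \<Rightarrow> f \<beta> * g \<gamma>)"
      using fk [of "?l (fst p)"] gk [of "?l (snd p)"] by (simp add: case_prod_unfold kl)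
  next
    fix p assume p: "p \<in> {(\<beta>, \<gamma>). \<beta> + \<gamma> = \<alpha>}"
    show "map_prod ?l ?l (map_prod ?k ?k p) = p"
      by (simp add: lk prod_eq_iff)
    show "map_prod ?k ?k p \<in> {(\<beta>, \<gamma>). \<beta> + \<gamma> = ?k \<alpha>}"
      using p by (auto simp: map_key_plus [OF inj(1), symmetric])
  qed
qed

lemma series_mult_assoc: "series_mult (series_mult f g) h = series_mult f (series_mult g h)"
proof
  fix \<alpha>
  have "series_mult (series_mult f g) h \<alpha> =
      (\<Sum>p\<in>splittings \<alpha>. \<Sum>q\<in>splittings (fst p). f (fst q) * g (snd q) * h (snd p))"
    by (simp add: series_mult_def case_prod_unfold sum_distrib_right)
  also have "\<dots> =
      (\<Sum>(p, q)\<in>Sigma (splittings \<alpha>) (\<lambda>p. splittings (fst p)). f (fst q) * g (snd q) * h (snd p))"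
    by (rule sum.Sigma) simp_all
  also have "\<dots> =
      (\<Sum>(p, q)\<in>Sigma (splittings \<alpha>) (\<lambda>p. splittings (snd p)). f (fst p) * (g (fst q) * h (snd q)))"
  proof (rule sum.reindex_bij_witness
      [where i = "\<lambda>r. ((fst (fst r) + fst (snd r), snd (snd r)), (fst (fst r), fst (snd r)))"
        and j = "\<lambda>r. ((fst (snd r), snd (snd r) + snd (fst r)), (snd (snd r), snd (fst r)))"])
    fix r assume "r \<in> Sigma (splittings \<alpha>) (\<lambda>p. splittings (fst p))"
    then obtain a b c d where [simp]: "r = ((a, b), (c, d))" and "a + b = \<alpha>" "c + d = a"
      unfolding splittings_def by (cases r) force
    then have eq: "c + d = a" "c + (d + b) = \<alpha>" by (metis add.assoc)+
    let ?j = "((fst (snd r), snd (snd r) + snd (fst r)), (snd (snd r), snd (fst r)))"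
    show "((fst (fst ?j) + fst (snd ?j), snd (snd ?j)), (fst (fst ?j), fst (snd ?j))) = r"
      using eq by simp
    show "?j \<in> Sigma (splittings \<alpha>) (\<lambda>p. splittings (snd p))"
      using eq by (simp add: splittings_def)
    show "(case ?j of (p, q) \<Rightarrow> f (fst p) * (g (fst q) * h (snd q))) =
        (case r of (p, q) \<Rightarrow> f (fst q) * g (snd q) * h (snd p))"
      by (simp add: mult.assoc)
  next
    fix r assume "r \<in> Sigma (splittings \<alpha>) (\<lambda>p. splittings (snd p))"
    then obtain a b c d where [simp]: "r = ((a, b), (c, d))" and "a + b = \<alpha>" "c + d = b"
      unfolding splittings_def by (cases r) force
    then have eq: "c + d = b" "(a + c) + d = \<alpha>" by (metis add.assoc)+
    let ?i = "((fst (fst r) + fst (snd r), snd (snd r)), (fst (fst r), fst (snd r)))"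
    show "((fst (snd ?i), snd (snd ?i) + snd (fst ?i)), (snd (snd ?i), snd (fst ?i))) = r"
      using eq by simp
    show "?i \<in> Sigma (splittings \<alpha>) (\<lambda>p. splittings (fst p))"
      using eq by (simp add: splittings_def)
  qed
  also have "\<dots> =
      (\<Sum>p\<in>splittings \<alpha>. \<Sum>q\<in>splittings (snd p). f (fst p) * (g (fst q) * h (snd q)))"
    by (rule sum.Sigma [symmetric]) simp_all
  also have "\<dots> = series_mult f (series_mult g h) \<alpha>"
    by (simp add: series_mult_def case_prod_unfold sum_distrib_left)
  finally show "series_mult (series_mult f g) h \<alpha> = series_mult f (series_mult g h) \<alpha>" .
qed

lemma series_mult_commute: "series_mult f g = series_mult g f"
proof
  fix \<alpha>
  show "series_mult f g \<alpha> = series_mult g f \<alpha>"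
    unfolding series_mult_def splittings_def
    by (rule sum.reindex_bij_witness [where i = prod.swap and j = prod.swap])
      (auto simp: ac_simps)
qed

lemma series_mult_one: "series_mult (\<lambda>\<alpha>. if \<alpha> = 0 then 1 else 0) f = f"
proof
  fix \<alpha>
  have "series_mult (\<lambda>\<alpha>. if \<alpha> = 0 then 1 else 0) f \<alpha>
      = (\<Sum>p\<in>{(0 :: composition, \<alpha>)}. (if fst p = 0 then 1 else 0) * f (snd p))"
    unfolding series_mult_def case_prod_unfold
    using finite_splittings [of \<alpha>]
    by (intro sum.mono_neutral_right) (auto simp: splittings_def)
  then show "series_mult (\<lambda>\<alpha>. if \<alpha> = 0 then 1 else 0) f \<alpha> = f \<alpha>" by simp
qed

lemma map_key_eq_0_iff:
  fixes \<alpha> :: composition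
  assumes "bij \<pi>"
  shows "Poly_Mapping.map_key \<pi> \<alpha> = 0 \<longleftrightarrow> \<alpha> = 0"
proof
  assume "Poly_Mapping.map_key \<pi> \<alpha> = 0"
  then have *: "lookup \<alpha> (\<pi> i) = 0" for i
    using assms by (metis bij_is_inj comp_apply lookup_zero map_key.rep_eq)
  show "\<alpha> = 0"
    by (intro poly_mapping_eqI) (metis * assms bij_is_surj surj_def lookup_zero)
qed (use assms in \<open>simp add: bij_is_inj\<close>)

instantiation symfun :: comm_ring_1
begin

lift_definition zero_symfun :: symfun is "\<lambda>_. 0"
  by (simp add: is_symfun_def)

lift_definition one_symfun :: symfun is "\<lambda>\<alpha>. if \<alpha> = 0 then 1 else 0"
  by (auto simp: is_symfun_def map_key_eq_0_iff)

lift_definition plus_symfun :: "symfun \<Rightarrow> symfun \<Rightarrow> symfun" is "\<lambda>f g \<alpha>. f \<alpha> + g \<alpha>"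
proof -
  fix f g assume *: "is_symfun f" "is_symfun g"
  obtain d where d: "\<And>\<alpha>. f \<alpha> \<noteq> 0 \<Longrightarrow> weight \<alpha> \<le> d"
    using *(1) unfolding is_symfun_def by blast
  obtain e where e: "\<And>\<alpha>. g \<alpha> \<noteq> 0 \<Longrightarrow> weight \<alpha> \<le> e"
    using *(2) unfolding is_symfun_def by blast
  have "weight \<alpha> \<le> max d e" if "f \<alpha> + g \<alpha> \<noteq> 0" for \<alpha>
    using d [of \<alpha>] e [of \<alpha>] that by (cases "f \<alpha> = 0") auto
  moreover have "f (Poly_Mapping.map_key \<pi> \<alpha>) + g (Poly_Mapping.map_key \<pi> \<alpha>) = f \<alpha> + g \<alpha>"
    if "bij \<pi>" for \<pi> \<alpha>
    using * that unfolding is_symfun_def by simp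
  ultimately show "is_symfun (\<lambda>\<alpha>. f \<alpha> + g \<alpha>)"
    unfolding is_symfun_def by blast
qed

lift_definition uminus_symfun :: "symfun \<Rightarrow> symfun" is "\<lambda>f \<alpha>. - f \<alpha>"
  by (simp add: is_symfun_def)

definition minus_symfun :: "symfun \<Rightarrow> symfun \<Rightarrow> symfun"
  where "minus_symfun f g = f + - g"

lift_definition times_symfun :: "symfun \<Rightarrow> symfun \<Rightarrow> symfun" is series_mult
  by (rule is_symfun_mult)

instance
proof
  fix f g h :: symfun
  show "f * g * h = f * (g * h)" by transfer (rule series_mult_assoc)
  show "f * g = g * f" by transfer (rule series_mult_commute)
  show "1 * f = f" by transfer (rule series_mult_one)
  show "f + g + h = f + (g + h)" by transfer (simp add: fun_eq_iff)
  show "f + g = g + f" by transfer (simp add: fun_eq_iff)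
  show "0 + f = f" by transfer simp
  show "- f + f = 0" by transfer simp
  show "f - g = f + - g" by (rule minus_symfun_def)
  show "(f + g) * h = f * h + g * h"
    by transfer (simp add: fun_eq_iff series_mult_def case_prod_unfold algebra_simps sum.distrib)
  show "(0 :: symfun) \<noteq> 1" by transfer (auto dest: fun_cong [of _ _ 0])
qed

end

text \<open>The polynomial in \<open>X\<^sub>0, \<dots>, X\<^bsub>n-1\<^esub>\<close> obtained by setting \<open>X\<^sub>i = 0\<close> for all \<open>i \<ge> n\<close>.\<close>

lift_definition restrict_vars :: "nat \<Rightarrow> symfun \<Rightarrow> composition \<Rightarrow>\<^sub>0 int"
  is "\<lambda>n f \<alpha>. if keys \<alpha> \<subseteq> {..<n} then f \<alpha> else 0"
proof -
  fix n f assume "is_symfun f"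
  then obtain d where d: "\<And>\<alpha>. f \<alpha> \<noteq> 0 \<Longrightarrow> weight \<alpha> \<le> d"
    unfolding is_symfun_def by blast
  have "{\<alpha>. (if keys \<alpha> \<subseteq> {..<n} then f \<alpha> else 0) \<noteq> 0} \<subseteq>
      {\<alpha>. keys \<alpha> \<subseteq> {..<n} \<and> (\<forall>i. lookup \<alpha> i \<le> d)}"
    using le_trans [OF lookup_le_weight d] by auto
  then show "finite {\<alpha>. (if keys \<alpha> \<subseteq> {..<n} then f \<alpha> else 0) \<noteq> 0}"
    by (rule finite_subset) (intro finite_bounded_compositions finite_lessThan)
qed

section \<open>Schur functions\<close>

text \<open>Polynomials in the \<open>X\<^sub>i\<close> over the integers form the integral domain
  \<open>composition \<Rightarrow>\<^sub>0 int\<close>.\<close>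

definition indet :: "nat \<Rightarrow> composition \<Rightarrow>\<^sub>0 int"
  where "indet i = Poly_Mapping.single (Poly_Mapping.single i 1) 1"

definition alternant :: "nat \<Rightarrow> composition \<Rightarrow> composition \<Rightarrow>\<^sub>0 int"
  where "alternant n \<alpha> =
    (\<Sum>\<sigma> | \<sigma> permutes {..<n}. of_int (sign \<sigma>) * (\<Prod>i<n. indet (\<sigma> i) ^ lookup \<alpha> i))"

definition staircase :: "nat \<Rightarrow> composition"
  where "staircase n = (\<Sum>i<n. Poly_Mapping.single i (n - 1 - i))"

definition schur_poly :: "nat \<Rightarrow> composition \<Rightarrow> composition \<Rightarrow>\<^sub>0 int"
  where "schur_poly n \<alpha> =
    (if keys \<alpha> \<subseteq> {..<n}
     then THE p. p * alternant n (staircase n) = alternant n (staircase n + \<alpha>)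
     else 0)"

definition schur :: "composition \<Rightarrow> symfun"
  where "schur \<alpha> = (THE f. \<forall>n. restrict_vars n f = schur_poly n \<alpha>)"

text \<open>Bilinearity over the integers is additivity in both arguments.\<close>

definition scalar :: "symfun \<Rightarrow> symfun \<Rightarrow> int"  (\<open>\<langle>_, _\<rangle>\<close>)
  where "scalar = (THE b.
    (\<forall>f g h. b (f + g) h = b f h + b g h) \<and>
    (\<forall>f g h. b f (g + h) = b f g + b f h) \<and>
    (\<forall>\<kappa>\<in>partitions. \<forall>\<mu>\<in>partitions. b (schur \<kappa>) (schur \<mu>) = (if \<kappa> = \<mu> then 1 else 0)))"

definition skew_schur :: "composition \<Rightarrow> composition \<Rightarrow> symfun"
  where "skew_schur \<nu> \<mu> = (THE g. \<forall>f. \<langle>g, f\<rangle> = \<langle>schur \<nu>, schur \<mu> * f\<rangle>)"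

definition eps :: "composition \<Rightarrow> composition \<Rightarrow> int"  (\<open>\<epsilon>\<close>)
  where "\<epsilon> \<alpha> \<nu> = \<langle>schur \<alpha>, schur \<nu>\<rangle>"

end

theory Submission
  imports Defs "HOL-Library.FuncSet"
begin

text \<open>Write \<open>a\<^bsub>\<delta>\<^esub>\<close> for the Vandermonde alternant. Since \<open>a\<^bsub>\<delta>+\<alpha>\<^esub> f = \<Sum>\<^bsub>\<gamma>\<^esub> f\<^bsub>\<gamma>\<^esub> a\<^bsub>\<delta>+\<alpha>+\<gamma>\<^esub>\<close> for a symmetric polynomial
  \<open>f = \<Sum>\<^bsub>\<gamma>\<^esub> f\<^bsub>\<gamma>\<^esub> X\<^sup>\<gamma>\<close>, one has \<open>\<langle>s\<^bsub>\<lambda>\<^esub>, s\<^bsub>\<kappa>\<^esub> f\<rangle> = \<Sum>\<^bsub>\<gamma>\<^esub> f\<^bsub>\<gamma>\<^esub> \<epsilon>(\<kappa> + \<gamma>, \<lambda>)\<close>. Expanding the scalar product over the basis of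
  Schur functions \<open>s\<^bsub>\<rho>\<^esub>\<close> and applying this to \<open>\<langle>s\<^bsub>\<lambda>\<^esub>, s\<^bsub>\<kappa>\<^esub> s\<^bsub>\<rho>\<^esub>\<rangle>\<close> and \<open>\<langle>s\<^bsub>\<nu>\<^esub>, s\<^bsub>\<mu>\<^esub> s\<^bsub>\<rho>\<^esub>\<rangle>\<close>, the first identity
  becomes the Cauchy identity: the number of matrices with row sums \<open>\<gamma>\<close> and column sums \<open>\<delta>\<close> is the sum
  over \<open>\<rho>\<close> of the products of the coefficients of \<open>X\<^sup>\<gamma>\<close> and \<open>X\<^sup>\<delta>\<close> in \<open>s\<^bsub>\<rho>\<^esub>\<close>. It follows from the
  Jacobi-Trudi formula and the symmetry of that number in \<open>\<gamma>\<close> and \<open>\<delta>\<close>. For the second identity the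
  involution \<open>s\<^bsub>\<rho>\<^esub> \<mapsto> s\<^bsub>\<rho>\<^sup>t\<^esub>\<close>, whose multiplicativity follows from the Pieri rules, is applied to
  one of the two factors, and the dual Cauchy identity is used in the same way.\<close>

section \<open>Additive functions and sums over permutations\<close>

text \<open>\<open>schur_poly\<close>, \<open>schur\<close>, \<open>scalar\<close> and
  \<open>skew_schur\<close> are definite descriptions, so nothing can be computed from them before
  existence and uniqueness are proved, and each rests on the one before. Two devices break the
  chain. The Jacobi-Trudi determinant is a symmetric function from the start, does not depend on the
  number of variables and restricts to the quotient of alternants, so it is the witness for
  \<open>schur\<close>. The coordinate at s_lam is read off as one coefficient of an alternant
  multiple of f, without any scalar product; the scalar product and the skew Schur functions are
  then written down in coordinates. Finitely many variables suffice, since a partition has at most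
  as many parts as its weight and a symmetric function of degree at most n is determined by its
  restriction to n variables. A Boolean switches between h_k and e_k, and between all matrices and
  binary ones, so that the counting is done once; in the binary case it produces a determinant in
  the e_k, which is recognised as a Schur function only after the Pieri rules.\<close>

lemma additive_of_int_mult:
  fixes F :: "'a :: ring_1 \<Rightarrow> 'b :: ring_1"
  assumes add: "\<And>x y. F (x + y) = F x + F y"
  shows "F (of_int c * x) = of_int c * F x"
proof -
  have zero: "F 0 = 0" using add [of 0 0] by simp
  have minus: "F (- y) = - F y" for y
    using add [of y "- y"] zero by (simp add: eq_neg_iff_add_eq_0 add.commute)
  have nat: "F (of_nat k * x) = of_nat k * F x" for k
    by (induction k) (simp_all add: zero add algebra_simps)
  show ?thesis
    by (cases c rule: int_cases2) (simp_all add: nat minus)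
qed

lemma additive_sum:
  fixes F :: "'a :: ring_1 \<Rightarrow> 'b :: ring_1"
  assumes add: "\<And>x y. F (x + y) = F x + F y"
  shows "F (\<Sum>i\<in>A. g i) = (\<Sum>i\<in>A. F (g i))"
proof -
  have zero: "F 0 = 0" using add [of 0 0] by simp
  show ?thesis
    by (induction A rule: infinite_finite_induct) (simp_all add: zero add)
qed

text \<open>Additivity alone amounts to linearity over the integers; in this form it is applied to
  restrictions, to coordinates and to the forms described in the definition of
  \<open>scalar\<close>.\<close>

lemma additive_linear_combination:
  fixes F :: "'a :: ring_1 \<Rightarrow> 'b :: ring_1"
  assumes "\<And>x y. F (x + y) = F x + F y"
  shows "F (\<Sum>i\<in>A. of_int (c i) * g i) = (\<Sum>i\<in>A. of_int (c i) * F (g i))"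
  by (simp add: additive_sum [of F, OF assms] additive_of_int_mult [of F, OF assms])

lemma sign_compose_permutes:
  "finite A \<Longrightarrow> p permutes A \<Longrightarrow> q permutes A \<Longrightarrow> sign (p \<circ> q) = sign p * sign q"
  by (rule sign_compose) (auto intro: permutes_imp_permutation)

lemma sign_inv_permutes: "finite A \<Longrightarrow> p permutes A \<Longrightarrow> sign (inv p) = sign p"
  by (rule sign_inverse) (auto intro: permutes_imp_permutation)

text \<open>\<open>det (A B) = det A det B\<close>, with the determinants written out by the Leibniz formula.\<close>

lemma sum_permutations_mult:
  fixes A B :: "nat \<Rightarrow> nat \<Rightarrow> 'a :: {idom, ring_char_0}"
  shows "(\<Sum>\<sigma> | \<sigma> permutes {..<n}. of_int (sign \<sigma>) * (\<Prod>i<n. \<Sum>k<n. A i k * B k (\<sigma> i))) =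
    (\<Sum>\<sigma> | \<sigma> permutes {..<n}. of_int (sign \<sigma>) * (\<Prod>i<n. A i (\<sigma> i))) *
    (\<Sum>\<sigma> | \<sigma> permutes {..<n}. of_int (sign \<sigma>) * (\<Prod>i<n. B i (\<sigma> i)))"
proof -
  let ?P = "{\<sigma>. \<sigma> permutes {..<n}}"
  let ?F = "{..<n} \<rightarrow>\<^sub>E {..<n}"
  \<comment> \<open>\<open>D f\<close> is the determinant of the matrix whose row i is row f i of B.
    Expanding the products of sums gives one such term for every function f from the index set to
    itself.\<close>
  define D where "D f = (\<Sum>\<sigma>\<in>?P. of_int (sign \<sigma>) * (\<Prod>i<n. B (f i) (\<sigma> i)))" for f
  have finP: "finite ?P" by (rule finite_permutations) simp
  have finF: "finite ?F" by (rule finite_PiE) simp_all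
  have "(\<Sum>\<sigma>\<in>?P. of_int (sign \<sigma>) * (\<Prod>i<n. \<Sum>k<n. A i k * B k (\<sigma> i))) =
      (\<Sum>\<sigma>\<in>?P. \<Sum>f\<in>?F. of_int (sign \<sigma>) * (\<Prod>i<n. A i (f i) * B (f i) (\<sigma> i)))"
    by (subst prod_sum_PiE) (simp_all add: sum_distrib_left)
  also have "\<dots> = (\<Sum>f\<in>?F. (\<Prod>i<n. A i (f i)) * D f)"
    unfolding D_def
    by (subst sum.swap) (simp add: sum_distrib_left prod.distrib mult_ac)
  also have "\<dots> = (\<Sum>f\<in>(\<lambda>\<tau>. restrict \<tau> {..<n}) ` ?P. (\<Prod>i<n. A i (f i)) * D f)"
  proof (rule sum.mono_neutral_right [OF finF])
    show "(\<lambda>\<tau>. restrict \<tau> {..<n}) ` ?P \<subseteq> ?F"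
    proof (intro image_subsetI restrict_PiE_iff [THEN iffD2] ballI)
      fix \<tau> i assume "\<tau> \<in> ?P" "i \<in> {..<n}"
      then show "\<tau> i \<in> {..<n}" using permutes_in_image [of \<tau> "{..<n}" i] by simp
    qed
    show "\<forall>f\<in>?F - (\<lambda>\<tau>. restrict \<tau> {..<n}) ` ?P. (\<Prod>i<n. A i (f i)) * D f = 0"
    proof
      fix f assume f: "f \<in> ?F - (\<lambda>\<tau>. restrict \<tau> {..<n}) ` ?P"
      \<comment> \<open>A function that is not the restriction of a permutation repeats a value;
        swapping the two equal rows shows \<open>D f = - D f\<close>, and the factor 2 is
        cancelled.\<close>
      have "\<not> inj_on f {..<n}"
      proof
        assume inj: "inj_on f {..<n}"
        let ?t = "\<lambda>i. if i < n then f i else i"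
        have "f ` {..<n} = {..<n}"
          using f inj by (intro endo_inj_surj) auto
        then have "bij_betw ?t {..<n} {..<n}"
          using inj by (auto simp: bij_betw_def inj_on_def image_def)
        then have "?t permutes {..<n}" by (rule bij_imp_permutes) auto
        moreover have "f = restrict ?t {..<n}" using f by (auto simp: PiE_def extensional_def)
        ultimately show False using f by blast
      qed
      then obtain i j where ij: "i < n" "j < n" "i \<noteq> j" "f i = f j"
        by (auto simp: inj_on_def)
      let ?t = "transpose i j"
      have t: "?t permutes {..<n}" using ij by (intro permutes_swap_id) auto
      have ft: "f (?t k) = f k" for k using ij by (auto simp: transpose_def)
      have D_t: "D f = (\<Sum>\<sigma>\<in>?P. of_int (sign (\<sigma> \<circ> ?t)) * (\<Prod>k<n. B (f k) ((\<sigma> \<circ> ?t) k)))"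
        unfolding D_def by (rule sum_permutations_compose_right [OF t])
      have "(\<Sum>\<sigma>\<in>?P. of_int (sign (\<sigma> \<circ> ?t)) * (\<Prod>k<n. B (f k) ((\<sigma> \<circ> ?t) k))) =
          (\<Sum>\<sigma>\<in>?P. - (of_int (sign \<sigma>) * (\<Prod>k<n. B (f k) (\<sigma> k))))"
      proof (rule sum.cong [OF refl])
        fix \<sigma> assume "\<sigma> \<in> ?P"
        then have "sign (\<sigma> \<circ> ?t) = - sign \<sigma>"
          using t ij by (simp add: sign_compose_permutes [of "{..<n}"] sign_swap_id)
        moreover have "(\<Prod>k<n. B (f k) ((\<sigma> \<circ> ?t) k)) = (\<Prod>k<n. B (f k) (\<sigma> k))"
          using prod.permute [OF t, of "\<lambda>k. B (f k) (\<sigma> k)"] by (simp add: o_def ft)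
        ultimately show "of_int (sign (\<sigma> \<circ> ?t)) * (\<Prod>k<n. B (f k) ((\<sigma> \<circ> ?t) k)) =
            - (of_int (sign \<sigma>) * (\<Prod>k<n. B (f k) (\<sigma> k)))" by simp
      qed
      then have "D f = - D f" unfolding D_t [symmetric] by (simp only: D_def sum_negf)
      then have "2 * D f = 0" by (simp only: eq_neg_iff_add_eq_0 mult_2)
      then show "(\<Prod>i<n. A i (f i)) * D f = 0" by simp
    qed
  qed
  also have "\<dots> = (\<Sum>\<tau>\<in>?P. (\<Prod>i<n. A i (restrict \<tau> {..<n} i)) * D (restrict \<tau> {..<n}))"
  proof (rule sum.reindex [unfolded o_def])
    show "inj_on (\<lambda>\<tau>. restrict \<tau> {..<n}) ?P"
    proof (rule inj_onI)
      fix \<sigma> \<tau> assume "\<sigma> \<in> ?P" "\<tau> \<in> ?P" and eq: "restrict \<sigma> {..<n} = restrict \<tau> {..<n}"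
      show "\<sigma> = \<tau>"
      proof
        fix i show "\<sigma> i = \<tau> i"
          using \<open>\<sigma> \<in> ?P\<close> \<open>\<tau> \<in> ?P\<close> fun_cong [OF eq, of i]
          by (cases "i < n") (auto simp: permutes_not_in)
      qed
    qed
  qed
  also have "\<dots> = (\<Sum>\<tau>\<in>?P. (of_int (sign \<tau>) * (\<Prod>i<n. A i (\<tau> i))) * D id)"
  proof (rule sum.cong [OF refl])
    fix \<tau> assume "\<tau> \<in> ?P"
    then have \<tau>: "\<tau> permutes {..<n}" by simp
    have "D \<tau> = (\<Sum>\<sigma>\<in>?P. of_int (sign (\<sigma> \<circ> \<tau>)) * (\<Prod>k<n. B (\<tau> k) ((\<sigma> \<circ> \<tau>) k)))"
      unfolding D_def by (rule sum_permutations_compose_right [OF \<tau>])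
    also have "\<dots> = of_int (sign \<tau>) * D id"
      unfolding D_def sum_distrib_left
    proof (rule sum.cong [OF refl])
      fix \<sigma> assume "\<sigma> \<in> ?P"
      then have "sign (\<sigma> \<circ> \<tau>) = sign \<sigma> * sign \<tau>"
        using \<tau> by (simp add: sign_compose_permutes [of "{..<n}"])
      moreover have "(\<Prod>k<n. B (\<tau> k) ((\<sigma> \<circ> \<tau>) k)) = (\<Prod>k<n. B k (\<sigma> k))"
        using prod.permute [OF \<tau>, of "\<lambda>k. B k (\<sigma> k)"] by (simp add: o_def)
      ultimately show "of_int (sign (\<sigma> \<circ> \<tau>)) * (\<Prod>k<n. B (\<tau> k) ((\<sigma> \<circ> \<tau>) k)) =
          of_int (sign \<tau>) * (of_int (sign \<sigma>) * (\<Prod>k<n. B (id k) (\<sigma> k)))" by simp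
    qed
    finally have "D \<tau> = of_int (sign \<tau>) * D id" .
    moreover have "D (restrict \<tau> {..<n}) = D \<tau>" by (simp add: D_def)
    ultimately show "(\<Prod>i<n. A i (restrict \<tau> {..<n} i)) * D (restrict \<tau> {..<n}) =
        (of_int (sign \<tau>) * (\<Prod>i<n. A i (\<tau> i))) * D id" by simp
  qed
  finally show ?thesis by (simp add: D_def sum_distrib_right)
qed

section \<open>Compositions and polynomials\<close>

lemma lookup_permute:
  fixes \<alpha> :: composition
  shows "inj \<pi> \<Longrightarrow> lookup (Poly_Mapping.map_key \<pi> \<alpha>) i = lookup \<alpha> (\<pi> i)"
  by (simp add: map_key.rep_eq)

lemma weight_eq_sum:
  assumes "finite A" "keys \<alpha> \<subseteq> A"
  shows "weight \<alpha> = sum (lookup \<alpha>) A"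
  unfolding weight_def using assms
  by (intro Sum_any.expand_superset) (auto simp: in_keys_iff)

lemma weight_permute:
  assumes "bij \<pi>"
  shows "weight (Poly_Mapping.map_key \<pi> \<alpha>) = weight \<alpha>"
proof -
  have "weight (Poly_Mapping.map_key \<pi> \<alpha>) = (\<Sum>i\<in>\<pi> -` keys \<alpha>. lookup \<alpha> (\<pi> i))"
    using assms
    by (subst weight_eq_sum [of "\<pi> -` keys \<alpha>"])
      (auto simp: bij_is_inj keys_map_key lookup_permute finite_vimageI)
  also have "\<dots> = sum (lookup \<alpha>) (keys \<alpha>)"
    using assms
    by (metis (no_types, lifting) bij_is_inj bij_is_surj inj_on_subset subset_UNIV
        sum.reindex_cong surj_image_vimage_eq)
  also have "\<dots> = weight \<alpha>" by (rule weight_eq_sum [symmetric]) simp_all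
  finally show ?thesis .
qed

lemma keys_plus_composition: "keys (\<alpha> + \<beta> :: composition) = keys \<alpha> \<union> keys \<beta>"
  by (auto simp: in_keys_iff lookup_add)

lemma keys_permute:
  assumes "\<sigma> permutes A"
  shows "keys (Poly_Mapping.map_key \<sigma> \<alpha> :: composition) \<subseteq> A \<longleftrightarrow> keys \<alpha> \<subseteq> A"
proof -
  have "keys (Poly_Mapping.map_key \<sigma> \<alpha>) = \<sigma> -` keys \<alpha>"
    by (rule keys_map_key [OF permutes_inj [OF assms]])
  moreover have "\<sigma> -` keys \<alpha> \<subseteq> A \<longleftrightarrow> keys \<alpha> \<subseteq> A"
    unfolding subset_iff vimage_eq
    using permutes_in_image [OF assms] permutes_surj [OF assms] by (metis surjD)
  ultimately show ?thesis by simp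
qed

lemma lookup_mult_splittings:
  fixes p q :: "composition \<Rightarrow>\<^sub>0 int"
  shows "lookup (p * q) \<alpha> = (\<Sum>(\<beta>, \<gamma>)\<in>splittings \<alpha>. lookup p \<beta> * lookup q \<gamma>)"
proof -
  have "lookup (p * q) \<alpha> = (\<Sum>(\<beta>, \<gamma>). lookup p \<beta> * lookup q \<gamma> when \<alpha> = \<beta> + \<gamma>)"
    by (simp add: times_poly_mapping.rep_eq prod_fun_unfold_prod)
  also have "\<dots> = (\<Sum>(\<beta>, \<gamma>)\<in>splittings \<alpha>. lookup p \<beta> * lookup q \<gamma> when \<alpha> = \<beta> + \<gamma>)"
    by (rule Sum_any.expand_superset [OF finite_splittings]) (auto simp: splittings_def when_def split: if_splits)
  also have "\<dots> = (\<Sum>(\<beta>, \<gamma>)\<in>splittings \<alpha>. lookup p \<beta> * lookup q \<gamma>)"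
    by (rule sum.cong) (auto simp: splittings_def)
  finally show ?thesis .
qed

lemma lookup_monomial_mult:
  fixes q :: "composition \<Rightarrow>\<^sub>0 int"
  shows "lookup (Poly_Mapping.single \<beta> 1 * q) (\<beta> + \<gamma>) = lookup q \<gamma>"
proof -
  have "lookup (Poly_Mapping.single \<beta> 1 * q) (\<beta> + \<gamma>) =
      (\<Sum>(\<beta>', \<gamma>')\<in>{(\<beta>, \<gamma>)}. lookup (Poly_Mapping.single \<beta> 1) \<beta>' * lookup q \<gamma>')"
    unfolding lookup_mult_splittings
    by (rule sum.mono_neutral_right [OF finite_splittings]) (auto simp: splittings_def lookup_single when_def split: if_splits)
  then show ?thesis by simp
qed

lemma lookup_monomial_mult_eq_0:
  fixes q :: "composition \<Rightarrow>\<^sub>0 int"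
  assumes "\<And>\<gamma>. \<alpha> \<noteq> \<beta> + \<gamma>"
  shows "lookup (Poly_Mapping.single \<beta> 1 * q) \<alpha> = 0"
  unfolding lookup_mult_splittings using assms
  by (intro sum.neutral) (auto simp: splittings_def lookup_single when_def)

lemma lookup_of_int_mult: "lookup (of_int c * p :: composition \<Rightarrow>\<^sub>0 int) \<alpha> = c * lookup p \<alpha>"
  using additive_of_int_mult [of "\<lambda>p. lookup p \<alpha>" c p] by (simp add: lookup_add)

lemma poly_eq_sum_monomials:
  fixes p :: "composition \<Rightarrow>\<^sub>0 int"
  assumes "finite A" "keys p \<subseteq> A"
  shows "p = (\<Sum>\<gamma>\<in>A. of_int (lookup p \<gamma>) * Poly_Mapping.single \<gamma> 1)"
proof (rule poly_mapping_eqI)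
  fix \<beta>
  have "lookup (\<Sum>\<gamma>\<in>A. of_int (lookup p \<gamma>) * Poly_Mapping.single \<gamma> 1) \<beta> =
      (\<Sum>\<gamma>\<in>A. if \<beta> = \<gamma> then lookup p \<gamma> else 0)"
    by (auto simp: lookup_sum lookup_of_int_mult lookup_single when_def intro!: sum.cong)
  then show "lookup p \<beta> = lookup (\<Sum>\<gamma>\<in>A. of_int (lookup p \<gamma>) * Poly_Mapping.single \<gamma> 1) \<beta>"
    using assms by (auto simp: in_keys_iff)
qed

section \<open>Restriction to finitely many variables\<close>

lemma coeff_of_add: "coeff_of (f + g) \<alpha> = coeff_of f \<alpha> + coeff_of g \<alpha>"
  by (simp add: plus_symfun.rep_eq)

lemma coeff_of_of_int_mult: "coeff_of (of_int c * f) \<alpha> = c * coeff_of f \<alpha>"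
  using additive_of_int_mult [of "\<lambda>f. coeff_of f \<alpha>" c f] by (simp add: coeff_of_add)

lemma coeff_of_sum: "coeff_of (\<Sum>i\<in>A. g i) \<alpha> = (\<Sum>i\<in>A. coeff_of (g i) \<alpha>)"
  using additive_sum [of "\<lambda>f. coeff_of f \<alpha>" g A] by (simp add: coeff_of_add)

lemma coeff_of_permute: "bij \<pi> \<Longrightarrow> coeff_of f (Poly_Mapping.map_key \<pi> \<alpha>) = coeff_of f \<alpha>"
  using coeff_of [of f] by (auto simp: is_symfun_def)

lemma symfun_eqI: "(\<And>\<alpha>. coeff_of f \<alpha> = coeff_of g \<alpha>) \<Longrightarrow> f = g"
  by (metis coeff_of_inject ext)

lemma lookup_restrict_vars:
  "lookup (restrict_vars n f) \<alpha> = (if keys \<alpha> \<subseteq> {..<n} then coeff_of f \<alpha> else 0)"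
  by (simp add: restrict_vars.rep_eq)

lemma restrict_vars_add: "restrict_vars n (f + g) = restrict_vars n f + restrict_vars n g"
  by (rule poly_mapping_eqI) (simp add: lookup_restrict_vars lookup_add coeff_of_add)

lemma restrict_vars_mult: "restrict_vars n (f * g) = restrict_vars n f * restrict_vars n g"
proof (rule poly_mapping_eqI)
  fix \<alpha>
  have *: "keys \<beta> \<union> keys \<gamma> = keys \<alpha>" if "(\<beta>, \<gamma>) \<in> splittings \<alpha>" for \<beta> \<gamma>
    using that by (auto simp: splittings_def keys_plus_composition)
  show "lookup (restrict_vars n (f * g)) \<alpha> = lookup (restrict_vars n f * restrict_vars n g) \<alpha>"
  proof (cases "keys \<alpha> \<subseteq> {..<n}")
    case True
    have "keys \<beta> \<subseteq> {..<n} \<and> keys \<gamma> \<subseteq> {..<n}" if "(\<beta>, \<gamma>) \<in> splittings \<alpha>" for \<beta> \<gamma>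
      using * [OF that] True by auto
    then show ?thesis
      using True by (auto simp: lookup_restrict_vars lookup_mult_splittings times_symfun.rep_eq
          series_mult_def intro!: sum.cong)
  next
    case False
    then have "\<not> keys \<beta> \<subseteq> {..<n} \<or> \<not> keys \<gamma> \<subseteq> {..<n}" if "(\<beta>, \<gamma>) \<in> splittings \<alpha>" for \<beta> \<gamma>
      using * [OF that] by auto
    then have "lookup (restrict_vars n f * restrict_vars n g) \<alpha> = 0"
      unfolding lookup_mult_splittings
      by (intro sum.neutral) (auto simp: lookup_restrict_vars)
    then show ?thesis using False by (simp add: lookup_restrict_vars)
  qed
qed

lemma restrict_vars_one: "restrict_vars n 1 = 1"
  by (rule poly_mapping_eqI) (simp add: lookup_restrict_vars one_symfun.rep_eq lookup_one when_def)

lemma restrict_vars_linear_combination: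
  "restrict_vars n (\<Sum>i\<in>A. of_int (c i) * g i) = (\<Sum>i\<in>A. of_int (c i) * restrict_vars n (g i))"
  by (rule additive_linear_combination) (rule restrict_vars_add)

lemma restrict_vars_prod: "restrict_vars n (\<Prod>i\<in>A. g i) = (\<Prod>i\<in>A. restrict_vars n (g i))"
  by (induction A rule: infinite_finite_induct) (simp_all add: restrict_vars_one restrict_vars_mult)

text \<open>A monomial in at most n variables can thus be moved into the first n variables. K is
  mapped onto an initial segment, the rest of the finite union of K and that segment onto the
  remaining elements, and everything else is fixed.\<close>

lemma exists_permutation_into_initial_segment:
  assumes "finite K" "card K \<le> n"
  shows "\<exists>\<pi> :: nat \<Rightarrow> nat. bij \<pi> \<and> \<pi> ` K \<subseteq> {..<n}"
proof -
  let ?J = "{..<card K}" and ?S = "K \<union> {..<card K}"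
  obtain g where g: "bij_betw g K ?J"
    using finite_same_card_bij [of K ?J] assms by auto
  have "card (?S - K) = card (?S - ?J)"
    using assms by (simp add: card_Diff_subset)
  then obtain h where h: "bij_betw h (?S - K) (?S - ?J)"
    using finite_same_card_bij [of "?S - K" "?S - ?J"] assms by auto
  define \<pi> where "\<pi> i = (if i \<in> K then g i else if i \<in> ?S then h i else i)" for i
  have "bij_betw \<pi> K ?J"
    using g by (rule bij_betw_cong [THEN iffD1, rotated]) (simp add: \<pi>_def)
  moreover have "bij_betw \<pi> (?S - K) (?S - ?J)"
    using h by (rule bij_betw_cong [THEN iffD1, rotated]) (auto simp: \<pi>_def)
  ultimately have "bij_betw \<pi> (K \<union> (?S - K)) (?J \<union> (?S - ?J))"
    by (rule bij_betw_combine) auto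
  moreover have "K \<union> (?S - K) = ?S" "?J \<union> (?S - ?J) = ?S" by auto
  ultimately have "bij_betw \<pi> ?S ?S" by simp
  then have "\<pi> permutes ?S" by (rule bij_imp_permutes) (simp add: \<pi>_def)
  then have "bij \<pi>" by (rule permutes_bij)
  moreover have "\<pi> ` K \<subseteq> {..<n}"
    using \<open>bij_betw \<pi> K ?J\<close> assms by (auto simp: bij_betw_def)
  ultimately show ?thesis by blast
qed

section \<open>Degrees, and recovery of a symmetric function from finitely many variables\<close>

definition degree_le :: "symfun \<Rightarrow> nat \<Rightarrow> bool"
  where "degree_le f d \<longleftrightarrow> (\<forall>\<alpha>. coeff_of f \<alpha> \<noteq> 0 \<longrightarrow> weight \<alpha> \<le> d)"

lemma degree_le_exists: "\<exists>d. degree_le f d"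
  using coeff_of [of f] by (auto simp: is_symfun_def degree_le_def)

lemma card_keys_le_weight: "card (keys \<alpha>) \<le> weight (\<alpha> :: composition)"
proof -
  have "card (keys \<alpha>) = (\<Sum>i\<in>keys \<alpha>. 1)" by simp
  also have "\<dots> \<le> sum (lookup \<alpha>) (keys \<alpha>)"
    by (rule sum_mono) (simp add: in_keys_iff Suc_le_eq)
  also have "\<dots> = weight \<alpha>" by (rule weight_eq_sum [symmetric]) simp_all
  finally show ?thesis .
qed

text \<open>A monomial of weight at most n involves at most n variables, so by symmetry its
  coefficient is that of a monomial in the first n variables; all heavier monomials have coefficient
  zero on both sides.\<close>

lemma restrict_vars_inject:
  assumes "degree_le f n" "degree_le g n" "restrict_vars n f = restrict_vars n g"
  shows "f = g"
proof (rule symfun_eqI)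
  fix \<alpha>
  show "coeff_of f \<alpha> = coeff_of g \<alpha>"
  proof (cases "weight \<alpha> \<le> n")
    case True
    then have "card (keys \<alpha>) \<le> n" using card_keys_le_weight le_trans by blast
    then obtain \<pi> where \<pi>: "bij \<pi>" "\<pi> ` keys \<alpha> \<subseteq> {..<n}"
      using exists_permutation_into_initial_segment [of "keys \<alpha>" n] by auto
    \<comment> \<open>\<open>map_key\<close> pulls back along its argument, so it is the inverse
      that moves the support of \<alpha> to its image under \<pi>.\<close>
    let ?\<beta> = "Poly_Mapping.map_key (inv \<pi>) \<alpha>"
    have "bij (inv \<pi>)" using \<pi>(1) by (rule bij_imp_bij_inv)
    moreover have "keys ?\<beta> \<subseteq> {..<n}"
      using \<pi> bij_vimage_eq_inv_image [of "inv \<pi>" "keys \<alpha>"] \<open>bij (inv \<pi>)\<close>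
      by (simp add: keys_map_key bij_is_inj inv_inv_eq)
    moreover have "lookup (restrict_vars n f) ?\<beta> = lookup (restrict_vars n g) ?\<beta>"
      using assms(3) by simp
    ultimately show ?thesis
      by (simp add: lookup_restrict_vars coeff_of_permute)
  next
    case False
    then show ?thesis using assms(1,2) unfolding degree_le_def by metis
  qed
qed

section \<open>Alternants\<close>

lemma indet_power: "indet i ^ k = Poly_Mapping.single (Poly_Mapping.single i k) 1"
  by (induction k) (simp_all add: indet_def mult_single single_add [symmetric])

lemma prod_monomials:
  "(\<Prod>i\<in>A. Poly_Mapping.single (m i) 1) =
    (Poly_Mapping.single (\<Sum>i\<in>A. m i) 1 :: composition \<Rightarrow>\<^sub>0 int)"
  by (induction A rule: infinite_finite_induct) (simp_all add: mult_single)

lemma alternant_eq: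
  assumes "keys \<alpha> \<subseteq> {..<n}"
  shows "alternant n \<alpha> = (\<Sum>\<sigma> | \<sigma> permutes {..<n}.
    of_int (sign \<sigma>) * Poly_Mapping.single (Poly_Mapping.map_key \<sigma> \<alpha>) 1)"
proof -
  have *: "(\<Sum>i<n. Poly_Mapping.single (\<sigma> i) (lookup \<alpha> i)) = Poly_Mapping.map_key (inv \<sigma>) \<alpha>"
    if "\<sigma> permutes {..<n}" for \<sigma>
  proof (rule poly_mapping_eqI)
    fix j
    have "lookup (\<Sum>i<n. Poly_Mapping.single (\<sigma> i) (lookup \<alpha> i)) j =
        (\<Sum>i<n. if i = inv \<sigma> j then lookup \<alpha> i else 0)"
      unfolding lookup_sum lookup_single when_def
      by (rule sum.cong) (use permutes_inverses [OF that] in auto)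
    also have "\<dots> = lookup \<alpha> (inv \<sigma> j)"
      using assms by (auto simp: in_keys_iff)
    also have "\<dots> = lookup (Poly_Mapping.map_key (inv \<sigma>) \<alpha>) j"
      using permutes_inj [OF permutes_inv [OF that]] by (simp add: lookup_permute)
    finally show "lookup (\<Sum>i<n. Poly_Mapping.single (\<sigma> i) (lookup \<alpha> i)) j =
        lookup (Poly_Mapping.map_key (inv \<sigma>) \<alpha>) j" .
  qed
  have "alternant n \<alpha> = (\<Sum>\<sigma> | \<sigma> permutes {..<n}.
      of_int (sign \<sigma>) * Poly_Mapping.single (Poly_Mapping.map_key (inv \<sigma>) \<alpha>) 1)"
    unfolding alternant_def by (rule sum.cong) (simp_all add: indet_power prod_monomials *)
  \<comment> \<open>The definition puts the exponent \<alpha>_i on X_{\<sigma> i}, which is the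
    pullback along the inverse; as inversion preserves signs, the sum may run over pullbacks along
    \<sigma> itself.\<close>
  also have "\<dots> = (\<Sum>\<sigma> | \<sigma> permutes {..<n}.
      of_int (sign \<sigma>) * Poly_Mapping.single (Poly_Mapping.map_key \<sigma> \<alpha>) 1)"
    by (subst sum_permutations_inverse)
      (auto intro!: sum.cong simp: sign_inv_permutes [of "{..<n}"] permutes_inv_inv)
  finally show ?thesis .
qed

lemma lookup_alternant:
  assumes "keys \<alpha> \<subseteq> {..<n}"
  shows "lookup (alternant n \<alpha>) \<beta> =
    (\<Sum>\<sigma> | \<sigma> permutes {..<n}. if Poly_Mapping.map_key \<sigma> \<alpha> = \<beta> then sign \<sigma> else 0)"
  by (auto simp: alternant_eq [OF assms] lookup_sum lookup_of_int_mult lookup_single when_def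
      intro!: sum.cong)

lemma alternant_permute:
  assumes \<tau>: "\<tau> permutes {..<n}" and \<alpha>: "keys \<alpha> \<subseteq> {..<n}"
  shows "alternant n (Poly_Mapping.map_key \<tau> \<alpha>) = of_int (sign \<tau>) * alternant n \<alpha>"
proof -
  have "alternant n (Poly_Mapping.map_key \<tau> \<alpha>) = (\<Sum>\<sigma> | \<sigma> permutes {..<n}.
      of_int (sign \<sigma>) * Poly_Mapping.single (Poly_Mapping.map_key (\<tau> \<circ> \<sigma>) \<alpha>) 1)"
    using \<tau> \<alpha>
    by (subst alternant_eq)
      (auto simp: keys_permute permutes_inj map_key_compose intro!: sum.cong)
  also have "\<dots> = (\<Sum>\<sigma> | \<sigma> permutes {..<n}. of_int (sign \<tau>) *
      (of_int (sign (\<tau> \<circ> \<sigma>)) * Poly_Mapping.single (Poly_Mapping.map_key (\<tau> \<circ> \<sigma>) \<alpha>) 1))"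
  proof (rule sum.cong [OF refl])
    fix \<sigma> assume "\<sigma> \<in> {\<sigma>. \<sigma> permutes {..<n}}"
    then have "sign \<sigma> = sign \<tau> * sign (\<tau> \<circ> \<sigma>)"
      using \<tau> by (simp add: sign_compose_permutes [of "{..<n}"] mult.assoc [symmetric])
    then show "of_int (sign \<sigma>) * Poly_Mapping.single (Poly_Mapping.map_key (\<tau> \<circ> \<sigma>) \<alpha>) 1 =
        of_int (sign \<tau>) * (of_int (sign (\<tau> \<circ> \<sigma>)) *
          Poly_Mapping.single (Poly_Mapping.map_key (\<tau> \<circ> \<sigma>) \<alpha>) (1 :: int))"
      by (simp add: mult.assoc)
  qed
  also have "\<dots> = of_int (sign \<tau>) * alternant n \<alpha>"
    unfolding alternant_eq [OF \<alpha>] sum_distrib_left [symmetric]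
    by (subst setum_permutations_compose_left [OF \<tau>]) simp
  finally show ?thesis .
qed

lemma alternant_swap:
  assumes "keys \<alpha> \<subseteq> {..<n}" "i < n" "j < n" "i \<noteq> j"
  shows "alternant n (Poly_Mapping.map_key (transpose i j) \<alpha>) = - alternant n \<alpha>"
  using alternant_permute [of "transpose i j" n \<alpha>] assms
  by (simp add: permutes_swap_id sign_swap_id)

lemma alternant_eq_0:
  assumes "keys \<alpha> \<subseteq> {..<n}" "i < n" "j < n" "i \<noteq> j" "lookup \<alpha> i = lookup \<alpha> j"
  shows "alternant n \<alpha> = 0"
proof -
  have "Poly_Mapping.map_key (transpose i j) \<alpha> = \<alpha>"
    using assms(5) by (intro poly_mapping_eqI) (simp add: lookup_permute transpose_def)
  then have "2 * alternant n \<alpha> = 0"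
    using alternant_swap [OF assms(1-4)] by (simp add: eq_neg_iff_add_eq_0 mult_2)
  then show ?thesis by simp
qed

text \<open>Permuting the exponents of f by \<sigma> leaves its coefficients unchanged, so for each
  \<sigma> separately X^{\<sigma>\<alpha>} f is the sum of the f_\<gamma>
  X^{\<sigma>(\<alpha>+\<gamma>)}. Collecting the signed sum over \<sigma> for fixed \<gamma> yields
  an alternant.\<close>

lemma alternant_mult_restrict_vars:
  assumes \<alpha>: "keys \<alpha> \<subseteq> {..<n}" and A: "finite A" "keys (restrict_vars n f) = A"
  shows "alternant n \<alpha> * restrict_vars n f = (\<Sum>\<gamma>\<in>A. of_int (coeff_of f \<gamma>) * alternant n (\<alpha> + \<gamma>))"
proof -
  let ?F = "restrict_vars n f" and ?P = "{\<sigma>. \<sigma> permutes {..<n}}"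
  have monomial_mult: "Poly_Mapping.single \<beta> 1 * (of_int c * Poly_Mapping.single \<gamma> 1) =
      of_int c * (Poly_Mapping.single (\<beta> + \<gamma>) 1 :: composition \<Rightarrow>\<^sub>0 int)" for \<beta> \<gamma> c
    by (simp add: mult.left_commute mult_single)
  have A_iff: "\<gamma> \<in> A \<longleftrightarrow> keys \<gamma> \<subseteq> {..<n} \<and> coeff_of f \<gamma> \<noteq> 0" for \<gamma>
    unfolding A(2) [symmetric] in_keys_iff [of \<gamma>] lookup_restrict_vars by simp
  then have A_keys: "keys \<gamma> \<subseteq> {..<n}" if "\<gamma> \<in> A" for \<gamma>
    using that by simp
  have inv_A: "Poly_Mapping.map_key \<sigma> \<gamma> \<in> A" if "\<gamma> \<in> A" "\<sigma> permutes {..<n}" for \<gamma> \<sigma>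
    using that permutes_bij [OF that(2)] by (simp add: A_iff keys_permute coeff_of_permute)
  have "alternant n \<alpha> * ?F = (\<Sum>\<sigma>\<in>?P. of_int (sign \<sigma>) *
      (\<Sum>\<gamma>\<in>A. of_int (lookup ?F \<gamma>) * Poly_Mapping.single (Poly_Mapping.map_key \<sigma> \<alpha> + \<gamma>) 1))"
    using A
    by (subst poly_eq_sum_monomials [of A ?F])
      (simp_all add: alternant_eq [OF \<alpha>] sum_distrib_left sum_distrib_right mult.assoc monomial_mult,
        rule sum.swap)
  also have "\<dots> = (\<Sum>\<sigma>\<in>?P. of_int (sign \<sigma>) *
      (\<Sum>\<gamma>\<in>A. of_int (coeff_of f \<gamma>) * Poly_Mapping.single (Poly_Mapping.map_key \<sigma> (\<alpha> + \<gamma>)) 1))"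
  proof (rule sum.cong [OF refl])
    fix \<sigma> assume "\<sigma> \<in> ?P"
    then have \<sigma>: "\<sigma> permutes {..<n}" "inv \<sigma> permutes {..<n}" by (simp_all add: permutes_inv)
    have inj: "inj \<sigma>" "inj (inv \<sigma>)" using \<sigma> by (simp_all add: permutes_inj)
    have *: "Poly_Mapping.map_key \<sigma> (Poly_Mapping.map_key (inv \<sigma>) \<gamma>) = \<gamma>"
        "Poly_Mapping.map_key (inv \<sigma>) (Poly_Mapping.map_key \<sigma> \<gamma>) = \<gamma>" for \<gamma> :: composition
      using inj permutes_inverses [OF \<sigma>(1)] by (auto intro!: poly_mapping_eqI simp: lookup_permute)
    have "(\<Sum>\<gamma>\<in>A. of_int (lookup ?F \<gamma>) *
          Poly_Mapping.single (Poly_Mapping.map_key \<sigma> \<alpha> + \<gamma>) (1 :: int)) =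
        (\<Sum>\<gamma>\<in>A. of_int (coeff_of f \<gamma>) * Poly_Mapping.single (Poly_Mapping.map_key \<sigma> (\<alpha> + \<gamma>)) 1)"
    proof (rule sum.reindex_bij_witness
        [where i = "Poly_Mapping.map_key \<sigma>" and j = "Poly_Mapping.map_key (inv \<sigma>)"])
      fix \<gamma> assume "\<gamma> \<in> A"
      then show "of_int (coeff_of f (Poly_Mapping.map_key (inv \<sigma>) \<gamma>)) *
            Poly_Mapping.single (Poly_Mapping.map_key \<sigma> (\<alpha> + Poly_Mapping.map_key (inv \<sigma>) \<gamma>)) 1 =
          of_int (lookup ?F \<gamma>) * Poly_Mapping.single (Poly_Mapping.map_key \<sigma> \<alpha> + \<gamma>) (1 :: int)"
        using A_keys permutes_bij [OF \<sigma>(2)] inj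
        by (simp add: map_key_plus * coeff_of_permute lookup_restrict_vars)
    qed (use inv_A \<sigma> * in auto)
    then show "of_int (sign \<sigma>) * (\<Sum>\<gamma>\<in>A. of_int (lookup ?F \<gamma>) *
          Poly_Mapping.single (Poly_Mapping.map_key \<sigma> \<alpha> + \<gamma>) (1 :: int)) =
        of_int (sign \<sigma>) * (\<Sum>\<gamma>\<in>A. of_int (coeff_of f \<gamma>) *
          Poly_Mapping.single (Poly_Mapping.map_key \<sigma> (\<alpha> + \<gamma>)) 1)"
      by simp
  qed
  also have "\<dots> = (\<Sum>\<gamma>\<in>A. of_int (coeff_of f \<gamma>) * (\<Sum>\<sigma>\<in>?P. of_int (sign \<sigma>) *
      Poly_Mapping.single (Poly_Mapping.map_key \<sigma> (\<alpha> + \<gamma>)) 1))"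
    unfolding sum_distrib_left by (subst sum.swap) (simp add: mult_ac)
  also have "\<dots> = (\<Sum>\<gamma>\<in>A. of_int (coeff_of f \<gamma>) * alternant n (\<alpha> + \<gamma>))"
    using A_keys \<alpha> by (intro sum.cong refl) (simp add: alternant_eq keys_plus_composition)
  finally show ?thesis .
qed

lemma lookup_staircase: "lookup (staircase n) i = n - 1 - i"
proof -
  have "lookup (staircase n) i = (\<Sum>j<n. if j = i then n - 1 - j else 0)"
    by (simp add: staircase_def lookup_sum lookup_single when_def)
  also have "\<dots> = n - 1 - i" by simp
  finally show ?thesis .
qed

lemma keys_staircase: "keys (staircase n) \<subseteq> {..<n}"
  by (auto simp: in_keys_iff lookup_staircase)

definition decreasing_below :: "nat \<Rightarrow> composition \<Rightarrow> bool"
  where "decreasing_below n \<alpha> \<longleftrightarrow> (\<forall>i j. i < j \<longrightarrow> j < n \<longrightarrow> lookup \<alpha> j < lookup \<alpha> i)"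

text \<open>A permutation carrying one strictly decreasing sequence to another must be increasing,
  hence the identity. All coordinates rest on this triangularity.\<close>

lemma lookup_alternant_decreasing:
  assumes "keys \<alpha> \<subseteq> {..<n}" "decreasing_below n \<alpha>" "decreasing_below n \<beta>"
  shows "lookup (alternant n \<alpha>) \<beta> = (if \<alpha> = \<beta> then 1 else 0)"
proof -
  have id: "\<sigma> = id" if \<sigma>: "\<sigma> permutes {..<n}" and eq: "Poly_Mapping.map_key \<sigma> \<alpha> = \<beta>" for \<sigma>
  proof -
    have mono: "\<sigma> i < \<sigma> j" if "i < j" "j < n" for i j
    proof (rule ccontr)
      assume "\<not> \<sigma> i < \<sigma> j"
      moreover have "\<sigma> i \<noteq> \<sigma> j" using permutes_inj [OF \<sigma>] \<open>i < j\<close> by (metis injD less_irrefl)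
      ultimately have "\<sigma> j < \<sigma> i" by simp
      moreover have "\<sigma> i < n" using permutes_in_image [OF \<sigma>, of i] that by simp
      ultimately have "lookup \<alpha> (\<sigma> i) < lookup \<alpha> (\<sigma> j)"
        using assms(2) by (simp add: decreasing_below_def)
      moreover have "lookup \<beta> j < lookup \<beta> i" using assms(3) that by (simp add: decreasing_below_def)
      ultimately show False
        using permutes_inj [OF \<sigma>] by (simp add: eq [symmetric] lookup_permute)
    qed
    have "i \<le> \<sigma> i" if "i < n" for i
      using that
    proof (induction i)
      case (Suc i)
      then show ?case using mono [of i "Suc i"] by simp
    qed simp
    then show ?thesis using permutes_natset_ge [OF \<sigma>] by simp
  qed
  have "lookup (alternant n \<alpha>) \<beta> = (\<Sum>\<sigma>\<in>{id}. if Poly_Mapping.map_key \<sigma> \<alpha> = \<beta> then sign \<sigma> else 0)"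
    unfolding lookup_alternant [OF assms(1)]
    using id by (intro sum.mono_neutral_right) (auto simp: finite_permutations)
  then show ?thesis by (simp add: map_key_id id_def)
qed

lemma weight_eq_if_lookup_alternant_nonzero:
  assumes "keys \<alpha> \<subseteq> {..<n}" "lookup (alternant n \<alpha>) \<beta> \<noteq> 0"
  shows "weight \<beta> = weight \<alpha>"
proof -
  obtain \<sigma> where "\<sigma> permutes {..<n}" "Poly_Mapping.map_key \<sigma> \<alpha> = \<beta>"
    using assms(2) unfolding lookup_alternant [OF assms(1)]
    by (elim sum.not_neutral_contains_not_neutral) (auto split: if_splits)
  then show ?thesis using weight_permute permutes_bij by metis
qed

lemma decreasing_below_staircase_add:
  assumes "\<alpha> \<in> partitions"
  shows "decreasing_below n (staircase n + \<alpha>)"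
  unfolding decreasing_below_def
proof (intro allI impI)
  fix i j assume "i < j" "j < n"
  moreover have "lookup \<alpha> j \<le> lookup \<alpha> i"
    using assms \<open>i < j\<close> by (simp add: partitions_def monotone_def)
  ultimately show "lookup (staircase n + \<alpha>) j < lookup (staircase n + \<alpha>) i"
    by (simp add: lookup_add lookup_staircase)
qed

lemma zero_in_partitions: "0 \<in> partitions"
  by (simp add: partitions_def antimono_def)

text \<open>As the polynomial ring has no zero divisors, the Vandermonde alternant may be cancelled,
  which makes the quotient in \<open>schur_poly\<close> unique.\<close>

lemma alternant_staircase_nonzero: "alternant n (staircase n) \<noteq> 0"
proof
  assume "alternant n (staircase n) = 0"
  moreover have "lookup (alternant n (staircase n)) (staircase n) = 1"
    using lookup_alternant_decreasing [OF keys_staircase, of n "staircase n"]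
      decreasing_below_staircase_add [OF zero_in_partitions, of n] by simp
  ultimately show False by simp
qed

section \<open>Complete and elementary symmetric functions\<close>

text \<open>\<open>monomial_sum False k\<close> is \<open>h\<^sub>k\<close> and \<open>monomial_sum True k\<close> is \<open>e\<^sub>k\<close>; both vanish for
  negative \<open>k\<close>, as needed for the entries of Jacobi-Trudi determinants.\<close>

lemma is_symfun_monomial_sum:
  "is_symfun (\<lambda>\<alpha>. of_bool (int (weight \<alpha>) = k \<and> (\<forall>i. b \<longrightarrow> lookup \<alpha> i \<le> 1)))"
    (is "is_symfun ?f")
  unfolding is_symfun_def
proof (intro conjI allI impI exI)
  fix \<alpha> :: composition assume "?f \<alpha> \<noteq> 0"
  then show "weight \<alpha> \<le> nat k" by auto
next
  fix \<pi> :: "nat \<Rightarrow> nat" and \<alpha> :: composition assume "bij \<pi>"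
  then have "(\<forall>i. b \<longrightarrow> lookup (Poly_Mapping.map_key \<pi> \<alpha>) i \<le> 1) \<longleftrightarrow> (\<forall>i. b \<longrightarrow> lookup \<alpha> i \<le> 1)"
    unfolding lookup_permute [OF bij_is_inj [OF \<open>bij \<pi>\<close>]] by (metis bij_is_surj surjD)
  then show "?f (Poly_Mapping.map_key \<pi> \<alpha>) = ?f \<alpha>"
    using \<open>bij \<pi>\<close> by (simp add: weight_permute)
qed

lift_definition monomial_sum :: "bool \<Rightarrow> int \<Rightarrow> symfun"
  is "\<lambda>b k \<alpha>. of_bool (int (weight \<alpha>) = k \<and> (\<forall>i. b \<longrightarrow> lookup \<alpha> i \<le> 1))"
  by (rule is_symfun_monomial_sum)

lemma coeff_of_monomial_sum:
  "coeff_of (monomial_sum b k) \<alpha> =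
    of_bool (int (weight \<alpha>) = k \<and> (\<forall>i. b \<longrightarrow> lookup \<alpha> i \<le> 1))"
  by (simp add: monomial_sum.rep_eq)

lemma monomial_sum_neg: "k < 0 \<Longrightarrow> monomial_sum b k = 0"
  by (rule symfun_eqI) (simp add: coeff_of_monomial_sum zero_symfun.rep_eq)

lemma weight_eq_0_iff: "weight \<alpha> = 0 \<longleftrightarrow> \<alpha> = 0"
proof
  assume "weight \<alpha> = 0"
  then show "\<alpha> = 0" using lookup_le_weight [of \<alpha>] by (intro poly_mapping_eqI) simp
qed simp

lemma monomial_sum_0: "monomial_sum b 0 = 1"
  by (rule symfun_eqI)
    (auto simp: coeff_of_monomial_sum one_symfun.rep_eq weight_eq_0_iff)

text \<open>The determinant with entries h_{\<alpha>_i - i + j}, or e_{\<alpha>_i - i + j}, for an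
  arbitrary composition. For \<open>b = True\<close> and a partition it turns out to be the Schur
  function of the conjugate, because the indices come from \<alpha> itself.\<close>

definition jacobi_trudi :: "bool \<Rightarrow> nat \<Rightarrow> composition \<Rightarrow> symfun"
  where "jacobi_trudi b n \<alpha> = (\<Sum>\<sigma> | \<sigma> permutes {..<n}. of_int (sign \<sigma>) *
    (\<Prod>i<n. monomial_sum b (int (lookup \<alpha> i) - int i + int (\<sigma> i))))"

section \<open>Jacobi-Trudi determinants as quotients of alternants\<close>

definition complete_poly :: "nat set \<Rightarrow> int \<Rightarrow> composition \<Rightarrow>\<^sub>0 int"
  where "complete_poly S k =
    (\<Sum>\<alpha> | keys \<alpha> \<subseteq> S \<and> int (weight \<alpha>) = k. Poly_Mapping.single \<alpha> 1)"

lemma lookup_complete_poly: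
  assumes "finite S"
  shows "lookup (complete_poly S k) \<alpha> = of_bool (keys \<alpha> \<subseteq> S \<and> int (weight \<alpha>) = k)"
proof -
  let ?A = "{\<alpha>. keys \<alpha> \<subseteq> S \<and> int (weight \<alpha>) = k}"
  have "?A \<subseteq> {\<alpha>. keys \<alpha> \<subseteq> S \<and> (\<forall>i. lookup \<alpha> i \<le> nat k)}"
    using lookup_le_weight by auto
  then have "finite ?A"
    by (rule finite_subset) (rule finite_bounded_compositions [OF assms])
  then show ?thesis
    by (simp add: complete_poly_def lookup_sum lookup_single when_def)
qed

lemma restrict_vars_complete: "restrict_vars n (monomial_sum False k) = complete_poly {..<n} k"
  by (rule poly_mapping_eqI) (simp add: lookup_restrict_vars coeff_of_monomial_sum lookup_complete_poly)

lemma weight_single: "weight (Poly_Mapping.single i k) = k"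
proof -
  have "weight (Poly_Mapping.single i k) = sum (lookup (Poly_Mapping.single i k)) {i}"
    by (rule weight_eq_sum) auto
  then show ?thesis by simp
qed

text \<open>Monomials are split by divisibility by X_a. In terms of generating series, the factor 1
  - X_a t removes the variable X_a.\<close>

lemma complete_poly_insert:
  assumes "finite S" "a \<notin> S"
  shows "complete_poly (insert a S) k = complete_poly S k + indet a * complete_poly (insert a S) (k - 1)"
proof (rule poly_mapping_eqI)
  fix \<alpha> :: composition
  show "lookup (complete_poly (insert a S) k) \<alpha> =
      lookup (complete_poly S k + indet a * complete_poly (insert a S) (k - 1)) \<alpha>"
  proof (cases "lookup \<alpha> a = 0")
    case True
    then have "\<alpha> \<noteq> Poly_Mapping.single a 1 + \<gamma>" for \<gamma>
      by (metis add_is_0 lookup_add lookup_single_eq zero_neq_one)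
    then have "lookup (indet a * complete_poly (insert a S) (k - 1)) \<alpha> = 0"
      unfolding indet_def by (rule lookup_monomial_mult_eq_0)
    moreover have "a \<notin> keys \<alpha>" using True by (simp add: in_keys_iff)
    then have "keys \<alpha> \<subseteq> insert a S \<longleftrightarrow> keys \<alpha> \<subseteq> S" by auto
    ultimately show ?thesis using assms by (simp add: lookup_add lookup_complete_poly)
  next
    case False
    define \<gamma> where "\<gamma> = \<alpha> - Poly_Mapping.single a 1"
    have \<alpha>: "\<alpha> = Poly_Mapping.single a 1 + \<gamma>"
      using False unfolding \<gamma>_def
      by (intro poly_mapping_eqI) (auto simp: lookup_add lookup_minus lookup_single when_def)
    have "\<not> keys \<alpha> \<subseteq> S" using False assms(2) in_keys_iff [of a \<alpha>] by auto
    moreover have "keys \<alpha> = insert a (keys \<gamma>)"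
      unfolding \<alpha> keys_plus_composition by simp
    moreover have "weight \<alpha> = Suc (weight \<gamma>)"
      unfolding \<alpha> weight_add weight_single by simp
    moreover have "lookup (indet a * complete_poly (insert a S) (k - 1)) \<alpha> =
        lookup (complete_poly (insert a S) (k - 1)) \<gamma>"
      unfolding \<alpha> indet_def by (rule lookup_monomial_mult)
    ultimately show ?thesis using assms by (auto simp: lookup_add lookup_complete_poly)
  qed
qed

lemma complete_poly_singleton: "complete_poly {j} (int m) = indet j ^ m"
proof (rule poly_mapping_eqI)
  fix \<alpha> :: composition
  have "keys \<alpha> \<subseteq> {j} \<and> weight \<alpha> = m \<longleftrightarrow> Poly_Mapping.single j m = \<alpha>"
  proof
    assume *: "keys \<alpha> \<subseteq> {j} \<and> weight \<alpha> = m"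
    then have "lookup \<alpha> j = m" using weight_eq_sum [of "{j}" \<alpha>] by simp
    with * show "Poly_Mapping.single j m = \<alpha>"
      by (intro poly_mapping_eqI) (auto simp: lookup_single when_def in_keys_iff)
  next
    assume "Poly_Mapping.single j m = \<alpha>"
    then show "keys \<alpha> \<subseteq> {j} \<and> weight \<alpha> = m" using weight_single [of j m] by (cases "m = 0") auto
  qed
  then show "lookup (complete_poly {j} (int m)) \<alpha> = lookup (indet j ^ m) \<alpha>"
    by (auto simp: lookup_complete_poly indet_power lookup_single)
qed

text \<open>Multiplying the generating series \<open>\<Prod>\<^bsub>i\<in>T\<union>S\<^esub> (1 - X\<^sub>i t)\<^sup>-\<^sup>1\<close> by \<open>\<Prod>\<^bsub>i\<in>T\<^esub> (1 - X\<^sub>i t)\<close>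
  removes the variables in \<open>T\<close>.\<close>

lemma complete_poly_eliminate:
  assumes "finite T" "finite S" "T \<inter> S = {}"
  shows "\<exists>c. \<forall>m. (\<Sum>k\<le>card T. c k * complete_poly (T \<union> S) (m - int k)) = complete_poly S m"
  using assms
proof (induction T arbitrary: S rule: finite_induct)
  case empty
  show ?case by (intro exI [of _ "\<lambda>_. 1"]) simp
next
  case (insert a T)
  let ?h = "complete_poly (T \<union> insert a S)"
  obtain c where c: "\<And>m. (\<Sum>k\<le>card T. c k * ?h (m - int k)) = complete_poly (insert a S) m"
    using insert.IH [of "insert a S"] insert.prems insert.hyps(2) by auto
  \<comment> \<open>These are the coefficients of (1 - X_a t) c(t). Only the c_k with k \<le>
    \<open>card T\<close> are controlled, so the first summand is cut off at the new top
    index.\<close>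
  define c' where "c' k = (if k \<le> card T then c k else 0) - (case k of 0 \<Rightarrow> 0 | Suc k \<Rightarrow> indet a * c k)"
    for k
  have "(\<Sum>k\<le>Suc (card T). c' k * ?h (m - int k)) = complete_poly S m" for m
  proof -
    have "(\<Sum>k\<le>Suc (card T). c' k * ?h (m - int k)) =
        (\<Sum>k\<le>Suc (card T). (if k \<le> card T then c k else 0) * ?h (m - int k)) -
        (\<Sum>k\<le>Suc (card T). (case k of 0 \<Rightarrow> 0 | Suc k \<Rightarrow> indet a * c k) * ?h (m - int k))"
      unfolding c'_def by (simp only: left_diff_distrib sum_subtractf)
    also have "(\<Sum>k\<le>Suc (card T). (if k \<le> card T then c k else 0) * ?h (m - int k)) =
        complete_poly (insert a S) m"
      using c by simp
    also have "(\<Sum>k\<le>Suc (card T). (case k of 0 \<Rightarrow> 0 | Suc k \<Rightarrow> indet a * c k) * ?h (m - int k)) =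
        indet a * (\<Sum>k\<le>card T. c k * ?h (m - 1 - int k))"
      by (simp add: sum.atMost_Suc_shift sum_distrib_left mult.assoc algebra_simps del: sum.atMost_Suc)
    also have "\<dots> = indet a * complete_poly (insert a S) (m - 1)" by (simp only: c)
    also have "complete_poly (insert a S) m - \<dots> = complete_poly S m"
      using complete_poly_insert [of S a m] insert.prems by simp
    finally show ?thesis .
  qed
  then show ?case using insert.hyps by (intro exI [of _ c']) simp
qed

text \<open>Every alternant a_\<beta> factors as det A_\<beta> times det B, where A_\<beta> has
  complete polynomials as entries and B does not depend on \<beta>. For \<beta> = \<delta> the first
  factor is 1, so det B is the Vandermonde alternant; for \<beta> = \<delta> + \<alpha> it is the
  Jacobi-Trudi determinant.\<close>

lemma restrict_vars_jacobi_trudi: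
  "restrict_vars n (jacobi_trudi False n \<alpha>) * alternant n (staircase n) =
    alternant n (staircase n + \<alpha>)"
proof -
  let ?h = "complete_poly {..<n}"
  define A where "A \<beta> i k = ?h (int (lookup \<beta> i) - int (n - Suc k))" for \<beta> :: composition and i k :: nat
  \<comment> \<open>Removing all variables except X_j from the complete polynomials leaves the
    powers of X_j. The n - 1 removed variables give n coefficients, which in reversed order form
    column j of B.\<close>
  have "\<exists>c. \<forall>m. (\<Sum>k<n. c k * ?h (m - int k)) = complete_poly {j} m" if "j < n" for j
  proof -
    have "{..card ({..<n} - {j})} = {..<n}" "{..<n} - {j} \<union> {j} = {..<n}"
      using that by auto
    then show ?thesis
      using complete_poly_eliminate [of "{..<n} - {j}" "{j}"] by auto
  qed
  then obtain c where c: "\<And>j m. j < n \<Longrightarrow> (\<Sum>k<n. c j k * ?h (m - int k)) = complete_poly {j} m"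
    by metis
  define B where "B k j = c j (n - Suc k)" for k j
  have AB: "(\<Sum>k<n. A \<beta> i k * B k j) = indet j ^ lookup \<beta> i" if "j < n" for \<beta> i j
  proof -
    have "(\<Sum>k<n. A \<beta> i k * B k j) = (\<Sum>k<n. c j k * ?h (int (lookup \<beta> i) - int k))"
      unfolding A_def B_def
      by (subst sum.nat_diff_reindex [of "\<lambda>k. c j k * ?h (int (lookup \<beta> i) - int k)", symmetric])
        (simp add: mult.commute)
    then show ?thesis using c [OF that] by (simp add: complete_poly_singleton)
  qed
  define detA where "detA \<beta> = (\<Sum>\<sigma> | \<sigma> permutes {..<n}. of_int (sign \<sigma>) * (\<Prod>i<n. A \<beta> i (\<sigma> i)))" for \<beta>
  define detB where "detB = (\<Sum>\<sigma> | \<sigma> permutes {..<n}. of_int (sign \<sigma>) * (\<Prod>i<n. B i (\<sigma> i)))"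
  have alternant: "alternant n \<beta> = detA \<beta> * detB" for \<beta>
  proof -
    have "alternant n \<beta> = (\<Sum>\<sigma> | \<sigma> permutes {..<n}.
        of_int (sign \<sigma>) * (\<Prod>i<n. \<Sum>k<n. A \<beta> i k * B k (\<sigma> i)))"
      unfolding alternant_def
    proof (intro sum.cong refl arg_cong2 [where f = "(*)"] prod.cong)
      fix \<sigma> i assume "\<sigma> \<in> {\<sigma>. \<sigma> permutes {..<n}}" "i \<in> {..<n}"
      then have "\<sigma> i < n" using permutes_in_image [of \<sigma> "{..<n}" i] by simp
      then show "indet (\<sigma> i) ^ lookup \<beta> i = (\<Sum>k<n. A \<beta> i k * B k (\<sigma> i))"
        by (simp add: AB)
    qed
    then show ?thesis unfolding detA_def detB_def by (simp only: sum_permutations_mult)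
  qed
  have h0: "?h 0 = 1"
    using arg_cong [OF monomial_sum_0 [of False], of "restrict_vars n"]
    by (simp add: restrict_vars_complete restrict_vars_one)
  have h_neg: "?h k = 0" if "k < 0" for k
    using that by (intro poly_mapping_eqI) (simp add: lookup_complete_poly)
  \<comment> \<open>The entry at (i, k) is h_{k - i}, so the matrix is unitriangular: a permutation
    other than the identity has \<sigma> i < i somewhere and meets a zero entry.\<close>
  have "detA (staircase n) = (\<Sum>\<sigma>\<in>{id}. of_int (sign \<sigma>) * (\<Prod>i<n. A (staircase n) i (\<sigma> i)))"
    unfolding detA_def
  proof (rule sum.mono_neutral_right)
    show "\<forall>\<sigma>\<in>{\<sigma>. \<sigma> permutes {..<n}} - {id}.
        of_int (sign \<sigma>) * (\<Prod>i<n. A (staircase n) i (\<sigma> i)) = 0"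
    proof
      fix \<sigma> assume "\<sigma> \<in> {\<sigma>. \<sigma> permutes {..<n}} - {id}"
      then have \<sigma>: "\<sigma> permutes {..<n}" "\<sigma> \<noteq> id" by auto
      then obtain i where i: "i < n" "\<sigma> i < i"
        using permutes_natset_ge [OF \<sigma>(1)] by (metis lessThan_iff not_le)
      then have "A (staircase n) i (\<sigma> i) = 0"
        unfolding A_def by (intro h_neg) (simp add: lookup_staircase)
      then have "(\<Prod>i<n. A (staircase n) i (\<sigma> i)) = 0"
        using i by (intro prod_zero) auto
      then show "of_int (sign \<sigma>) * (\<Prod>i<n. A (staircase n) i (\<sigma> i)) = 0" by simp
    qed
  qed (auto simp: finite_permutations)
  also have "\<dots> = 1" by (simp add: A_def lookup_staircase h0)
  finally have "alternant n (staircase n) = detB" by (simp add: alternant)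
  moreover have "restrict_vars n (jacobi_trudi False n \<alpha>) = detA (staircase n + \<alpha>)"
    unfolding jacobi_trudi_def restrict_vars_linear_combination restrict_vars_prod
      restrict_vars_complete detA_def A_def
  proof (intro sum.cong refl arg_cong2 [where f = "(*)"] prod.cong arg_cong [where f = ?h])
    fix \<sigma> i assume "\<sigma> \<in> {\<sigma>. \<sigma> permutes {..<n}}" "i \<in> {..<n}"
    then have "\<sigma> i < n" "i < n" using permutes_in_image [of \<sigma> "{..<n}" i] by auto
    then show "int (lookup \<alpha> i) - int i + int (\<sigma> i) =
        int (lookup (staircase n + \<alpha>) i) - int (n - Suc (\<sigma> i))"
      by (simp add: lookup_add lookup_staircase of_nat_diff)
  qed
  ultimately show ?thesis by (simp add: alternant)
qed

text \<open>The new last row has entries h_{j - n} or e_{j - n}, which vanish for j < n and equal 1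
  for j = n. Hence one symmetric function serves every number of variables that covers the
  support.\<close>

lemma jacobi_trudi_Suc:
  assumes "keys \<alpha> \<subseteq> {..<n}"
  shows "jacobi_trudi b (Suc n) \<alpha> = jacobi_trudi b n \<alpha>"
proof -
  let ?t = "\<lambda>\<sigma> m. of_int (sign \<sigma>) * (\<Prod>i<m. monomial_sum b (int (lookup \<alpha> i) - int i + int (\<sigma> i)))"
  have [simp]: "lookup \<alpha> n = 0" using assms by (auto simp: in_keys_iff)
  have "jacobi_trudi b (Suc n) \<alpha> = (\<Sum>\<sigma> | \<sigma> permutes {..<n}. ?t \<sigma> (Suc n))"
    unfolding jacobi_trudi_def
  proof (rule sum.mono_neutral_right)
    show "finite {\<sigma>. \<sigma> permutes {..<Suc n}}" by (rule finite_permutations) (rule finite_lessThan)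
    show "{\<sigma>. \<sigma> permutes {..<n}} \<subseteq> {\<sigma>. \<sigma> permutes {..<Suc n}}"
      by (intro Collect_mono impI) (erule permutes_subset, simp)
    show "\<forall>\<sigma>\<in>{\<sigma>. \<sigma> permutes {..<Suc n}} - {\<sigma>. \<sigma> permutes {..<n}}. ?t \<sigma> (Suc n) = 0"
    proof
      fix \<sigma> assume *: "\<sigma> \<in> {\<sigma>. \<sigma> permutes {..<Suc n}} - {\<sigma>. \<sigma> permutes {..<n}}"
      have "\<sigma> n \<noteq> n"
      proof
        assume "\<sigma> n = n"
        then have "\<sigma> permutes {..<n}"
          using * permutes_superset [of \<sigma> "{..<Suc n}" "{..<n}"] by (auto simp: less_Suc_eq)
        then show False using * by blast
      qed
      moreover have "\<sigma> n < Suc n" using * permutes_in_image [of \<sigma> "{..<Suc n}" n] by simp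
      ultimately have "\<sigma> n < n" by simp
      then show "?t \<sigma> (Suc n) = 0" by (simp add: monomial_sum_neg)
    qed
  qed
  also have "\<dots> = jacobi_trudi b n \<alpha>"
    unfolding jacobi_trudi_def
    by (rule sum.cong) (auto simp: permutes_not_in monomial_sum_0)
  finally show ?thesis .
qed

lemma jacobi_trudi_le:
  assumes "keys \<alpha> \<subseteq> {..<n}" "n \<le> m"
  shows "jacobi_trudi b m \<alpha> = jacobi_trudi b n \<alpha>"
  using assms(2)
proof (induction rule: dec_induct)
  case (step m)
  have "keys \<alpha> \<subseteq> {..<m}" using assms(1) step.hyps by force
  then show ?case using step.IH by (simp add: jacobi_trudi_Suc)
qed simp

section \<open>Homogeneity of Jacobi-Trudi determinants\<close>

definition homogeneous :: "symfun \<Rightarrow> int \<Rightarrow> bool"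
  where "homogeneous f k \<longleftrightarrow> (\<forall>\<alpha>. coeff_of f \<alpha> \<noteq> 0 \<longrightarrow> int (weight \<alpha>) = k)"

lemma homogeneous_mult:
  assumes "homogeneous f k" "homogeneous g l"
  shows "homogeneous (f * g) (k + l)"
  unfolding homogeneous_def
proof (intro allI impI)
  fix \<alpha> assume "coeff_of (f * g) \<alpha> \<noteq> 0"
  then obtain p where "p \<in> splittings \<alpha>" "(case p of (\<beta>, \<gamma>) \<Rightarrow> coeff_of f \<beta> * coeff_of g \<gamma>) \<noteq> 0"
    unfolding times_symfun.rep_eq series_mult_def by (rule sum.not_neutral_contains_not_neutral)
  then obtain \<beta> \<gamma> where "\<alpha> = \<beta> + \<gamma>" "coeff_of f \<beta> \<noteq> 0" "coeff_of g \<gamma> \<noteq> 0"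
    unfolding splittings_def by auto
  then show "int (weight \<alpha>) = k + l"
    using assms by (simp add: homogeneous_def weight_add)
qed

lemma homogeneous_sum:
  assumes "\<And>i. i \<in> A \<Longrightarrow> homogeneous (g i) k"
  shows "homogeneous (\<Sum>i\<in>A. of_int (c i) * g i) k"
  unfolding homogeneous_def
proof (intro allI impI)
  fix \<alpha> assume "coeff_of (\<Sum>i\<in>A. of_int (c i) * g i) \<alpha> \<noteq> 0"
  then obtain i where "i \<in> A" "c i * coeff_of (g i) \<alpha> \<noteq> 0"
    unfolding coeff_of_sum coeff_of_of_int_mult by (rule sum.not_neutral_contains_not_neutral)
  then show "int (weight \<alpha>) = k" using assms by (auto simp: homogeneous_def)
qed

lemma homogeneous_prod:
  assumes "\<And>i. i \<in> A \<Longrightarrow> homogeneous (g i) (k i)" "finite A"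
  shows "homogeneous (\<Prod>i\<in>A. g i) (\<Sum>i\<in>A. k i)"
  using assms(2,1)
proof (induction A rule: finite_induct)
  case empty
  show ?case by (simp add: homogeneous_def one_symfun.rep_eq)
qed (simp add: homogeneous_mult)

text \<open>In each term the index shifts - i + \<sigma> i add up to zero, since \<sigma> permutes
  the indices.\<close>

lemma homogeneous_jacobi_trudi:
  assumes "keys \<alpha> \<subseteq> {..<n}"
  shows "homogeneous (jacobi_trudi b n \<alpha>) (int (weight \<alpha>))"
  unfolding jacobi_trudi_def
proof (rule homogeneous_sum)
  fix \<sigma> assume "\<sigma> \<in> {\<sigma>. \<sigma> permutes {..<n}}"
  then have "(\<Sum>i<n. int (\<sigma> i)) = (\<Sum>i<n. int i)"
    using sum.permute [of \<sigma> "{..<n}" int] by (simp add: o_def)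
  then have "(\<Sum>i<n. int (lookup \<alpha> i) - int i + int (\<sigma> i)) = int (weight \<alpha>)"
    using assms by (simp add: weight_eq_sum [of "{..<n}"] sum.distrib sum_subtractf)
  moreover have "homogeneous (\<Prod>i<n. monomial_sum b (int (lookup \<alpha> i) - int i + int (\<sigma> i)))
      (\<Sum>i<n. int (lookup \<alpha> i) - int i + int (\<sigma> i))"
    by (rule homogeneous_prod) (auto simp: homogeneous_def coeff_of_monomial_sum)
  ultimately show "homogeneous (\<Prod>i<n. monomial_sum b (int (lookup \<alpha> i) - int i + int (\<sigma> i)))
      (int (weight \<alpha>))" by simp
qed

section \<open>Schur functions\<close>

text \<open>Sets the variables from X_n on to zero in an arbitrary polynomial. It is applied to
  alternants, which are not symmetric and hence out of reach of
  \<open>restrict_vars\<close>.\<close>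

lift_definition truncate_poly :: "nat \<Rightarrow> (composition \<Rightarrow>\<^sub>0 int) \<Rightarrow> composition \<Rightarrow>\<^sub>0 int"
  is "\<lambda>n p \<alpha>. if keys \<alpha> \<subseteq> {..<n} then p \<alpha> else 0"
  by (rule finite_subset [rotated]) auto

lemma truncate_poly_mult: "truncate_poly n (p * q) = truncate_poly n p * truncate_poly n q"
proof (rule poly_mapping_eqI)
  fix \<alpha>
  have *: "keys \<beta> \<union> keys \<gamma> = keys \<alpha>" if "(\<beta>, \<gamma>) \<in> splittings \<alpha>" for \<beta> \<gamma>
    using that by (auto simp: splittings_def keys_plus_composition)
  show "lookup (truncate_poly n (p * q)) \<alpha> = lookup (truncate_poly n p * truncate_poly n q) \<alpha>"
  proof (cases "keys \<alpha> \<subseteq> {..<n}")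
    case True
    have "keys \<beta> \<subseteq> {..<n} \<and> keys \<gamma> \<subseteq> {..<n}" if "(\<beta>, \<gamma>) \<in> splittings \<alpha>" for \<beta> \<gamma>
      using * [OF that] True by auto
    then show ?thesis
      using True by (auto simp: truncate_poly.rep_eq lookup_mult_splittings intro!: sum.cong)
  next
    case False
    then have "\<not> keys \<beta> \<subseteq> {..<n} \<or> \<not> keys \<gamma> \<subseteq> {..<n}" if "(\<beta>, \<gamma>) \<in> splittings \<alpha>" for \<beta> \<gamma>
      using * [OF that] by auto
    then have "lookup (truncate_poly n p * truncate_poly n q) \<alpha> = 0"
      unfolding lookup_mult_splittings
      by (intro sum.neutral) (auto simp: truncate_poly.rep_eq)
    then show ?thesis using False by (simp add: truncate_poly.rep_eq)
  qed
qed

text \<open>Let l be the last index in the support, so m \<le> l. In l + 1 variables every exponent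
  of \<delta> + \<alpha> is positive, so a_{\<delta>+\<alpha>} is killed by X_l = 0, while
  a_\<delta> keeps the monomial X^\<delta>, whose last exponent is 0. Hence the quotient is killed,
  in accordance with the convention that s_\<alpha> is zero in too few variables.\<close>

lemma restrict_vars_jacobi_trudi_eq_0:
  assumes "keys \<alpha> \<subseteq> {..<n}" "\<not> keys \<alpha> \<subseteq> {..<m}"
  shows "restrict_vars m (jacobi_trudi False n \<alpha>) = 0"
proof -
  define l where "l = Max (keys \<alpha>)"
  have ne: "keys \<alpha> \<noteq> {}" using assms(2) by auto
  have l: "l \<in> keys \<alpha>" unfolding l_def using ne by (intro Max_in) auto
  have "m \<le> l"
  proof (rule ccontr)
    assume "\<not> m \<le> l"
    then have "keys \<alpha> \<subseteq> {..<m}" unfolding l_def by (auto simp: not_le dest: le_less_trans [OF Max_ge, rotated])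
    with assms(2) show False by simp
  qed
  have sub: "keys \<alpha> \<subseteq> {..<Suc l}" unfolding l_def by (auto simp: less_Suc_eq_le)
  have "Suc l \<le> n" using l assms(1) by auto
  let ?f = "jacobi_trudi False (Suc l) \<alpha>" and ?\<delta> = "staircase (Suc l)"
  let ?T = "truncate_poly l"
  have eq: "restrict_vars (Suc l) ?f * alternant (Suc l) ?\<delta> = alternant (Suc l) (?\<delta> + \<alpha>)"
    by (rule restrict_vars_jacobi_trudi)
  have pos: "lookup (?\<delta> + \<alpha>) i \<noteq> 0" if "i < Suc l" for i
    using that l by (cases "i = l") (auto simp: lookup_add lookup_staircase in_keys_iff)
  have sub': "keys (?\<delta> + \<alpha>) \<subseteq> {..<Suc l}"
    using keys_staircase sub by (simp add: keys_plus_composition)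
  have "?T (alternant (Suc l) (?\<delta> + \<alpha>)) = 0"
  proof (rule poly_mapping_eqI)
    fix \<beta>
    have "Poly_Mapping.map_key \<sigma> (?\<delta> + \<alpha>) \<noteq> \<beta>"
      if "keys \<beta> \<subseteq> {..<l}" "\<sigma> permutes {..<Suc l}" for \<sigma>
    proof
      assume "Poly_Mapping.map_key \<sigma> (?\<delta> + \<alpha>) = \<beta>"
      moreover have "\<sigma> l < Suc l" using that(2) permutes_in_image [of \<sigma> "{..<Suc l}" l] by simp
      ultimately have "lookup \<beta> l \<noteq> 0"
        using pos permutes_inj [OF that(2)] by (metis lookup_permute)
      then have "l \<in> keys \<beta>" by (simp add: in_keys_iff)
      then show False using that(1) by auto
    qed
    then show "lookup (?T (alternant (Suc l) (?\<delta> + \<alpha>))) \<beta> = lookup 0 \<beta>"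
      by (auto simp: truncate_poly.rep_eq lookup_alternant [OF sub'] intro!: sum.neutral)
  qed
  moreover have "?T (alternant (Suc l) ?\<delta>) \<noteq> 0"
  proof -
    have "keys ?\<delta> \<subseteq> {..<l}" by (auto simp: in_keys_iff lookup_staircase)
    then have "lookup (?T (alternant (Suc l) ?\<delta>)) ?\<delta> = 1"
      using lookup_alternant_decreasing [OF keys_staircase, of "Suc l" ?\<delta>]
        decreasing_below_staircase_add [OF zero_in_partitions, of "Suc l"]
      by (simp add: truncate_poly.rep_eq)
    then show ?thesis by auto
  qed
  ultimately have "?T (restrict_vars (Suc l) ?f) = 0"
    using arg_cong [OF eq, of ?T] by (simp add: truncate_poly_mult)
  then have 0: "lookup (?T (restrict_vars (Suc l) ?f)) \<beta> = 0" for \<beta> by simp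
  have "coeff_of ?f \<beta> = 0" if "keys \<beta> \<subseteq> {..<m}" for \<beta>
  proof -
    have "keys \<beta> \<subseteq> {..<l}" using that \<open>m \<le> l\<close> by force
    moreover from this have "keys \<beta> \<subseteq> {..<Suc l}" by force
    ultimately show ?thesis using 0 [of \<beta>] by (simp add: truncate_poly.rep_eq lookup_restrict_vars)
  qed
  then have "restrict_vars m ?f = 0"
    by (intro poly_mapping_eqI) (simp add: lookup_restrict_vars)
  then show ?thesis using jacobi_trudi_le [OF sub \<open>Suc l \<le> n\<close>] by simp
qed

lemma schur_poly_eqI:
  assumes "keys \<alpha> \<subseteq> {..<n}" "p * alternant n (staircase n) = alternant n (staircase n + \<alpha>)"
  shows "schur_poly n \<alpha> = p"
proof -
  have "(THE p. p * alternant n (staircase n) = alternant n (staircase n + \<alpha>)) = p"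
    using assms(2) alternant_staircase_nonzero [of n]
    by (intro the_equality) (auto simp flip: assms(2))
  then show ?thesis using assms(1) by (simp add: schur_poly_def)
qed

lemma schur_poly_eq_restrict_jacobi_trudi:
  assumes "keys \<alpha> \<subseteq> {..<N}"
  shows "schur_poly n \<alpha> = restrict_vars n (jacobi_trudi False N \<alpha>)"
proof (cases "keys \<alpha> \<subseteq> {..<n}")
  case True
  have "jacobi_trudi False N \<alpha> = jacobi_trudi False n \<alpha>"
    using jacobi_trudi_le [OF assms, of n False] jacobi_trudi_le [OF True, of N False]
    by (cases n N rule: le_cases) auto
  then show ?thesis
    using True restrict_vars_jacobi_trudi by (auto intro: schur_poly_eqI)
next
  case False
  then show ?thesis
    by (simp add: schur_poly_def restrict_vars_jacobi_trudi_eq_0 [OF assms])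
qed

lemma restrict_vars_all_eqD:
  assumes "\<And>n. restrict_vars n f = restrict_vars n g"
  shows "f = g"
proof -
  obtain d e where "degree_le f d" "degree_le g e" using degree_le_exists by metis
  then have "degree_le f (max d e)" "degree_le g (max d e)"
    by (auto simp: degree_le_def le_max_iff_disj)
  then show ?thesis using assms by (rule restrict_vars_inject)
qed

text \<open>The determinant witnesses the existence that the definition of \<open>schur\<close> asks
  for; uniqueness follows by comparing two candidates in as many variables as the larger of their
  degrees.\<close>

theorem schur_eq_jacobi_trudi:
  assumes "keys \<alpha> \<subseteq> {..<N}"
  shows "schur \<alpha> = jacobi_trudi False N \<alpha>"
  unfolding schur_def
  using schur_poly_eq_restrict_jacobi_trudi [OF assms]
  by (intro the_equality) (auto intro: restrict_vars_all_eqD)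

lemma exists_keys_bound: "\<exists>n. keys (\<alpha> :: composition) \<subseteq> {..<n}"
proof -
  obtain m where "\<forall>i\<in>keys \<alpha>. i < m" using finite_keys finite_nat_set_iff_bounded by blast
  then show ?thesis by auto
qed

lemma restrict_vars_schur: "restrict_vars n (schur \<alpha>) = schur_poly n \<alpha>"
  using exists_keys_bound [of \<alpha>] schur_eq_jacobi_trudi schur_poly_eq_restrict_jacobi_trudi by metis

lemma schur_poly_mult_alternant:
  assumes "keys \<alpha> \<subseteq> {..<n}"
  shows "schur_poly n \<alpha> * alternant n (staircase n) = alternant n (staircase n + \<alpha>)"
  by (simp add: schur_poly_eq_restrict_jacobi_trudi [OF assms] restrict_vars_jacobi_trudi)

lemma homogeneous_schur: "homogeneous (schur \<alpha>) (int (weight \<alpha>))"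
  using exists_keys_bound [of \<alpha>] schur_eq_jacobi_trudi homogeneous_jacobi_trudi by metis

lemma schur_zero: "schur 0 = 1"
  using schur_eq_jacobi_trudi [of 0 0] by (simp add: jacobi_trudi_def)

section \<open>Coordinates with respect to the Schur functions\<close>

text \<open>Since a_\<delta> s_\<mu> = a_{\<delta>+\<mu>} and alternants are triangular on strictly
  decreasing exponents, this coefficient isolates s_lam in an expansion over partitions, and it is
  visibly additive in f.\<close>

definition schur_coord :: "composition \<Rightarrow> symfun \<Rightarrow> int"
  where "schur_coord lam f =
    lookup (alternant (weight lam) (staircase (weight lam)) * restrict_vars (weight lam) f)
      (staircase (weight lam) + lam)"

lemma schur_coord_add: "schur_coord lam (f + g) = schur_coord lam f + schur_coord lam g"
  by (simp add: schur_coord_def restrict_vars_add distrib_left lookup_add)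

lemma schur_coord_linear_combination:
  "schur_coord lam (\<Sum>i\<in>A. of_int (c i) * g i) = (\<Sum>i\<in>A. c i * schur_coord lam (g i))"
  using additive_linear_combination [of "schur_coord lam" c g A] by (simp add: schur_coord_add)

lemma schur_coord_of_int_mult: "schur_coord lam (of_int c * f) = c * schur_coord lam f"
  using additive_of_int_mult [of "schur_coord lam" c f] by (simp add: schur_coord_add)

text \<open>The support of a partition is an initial segment, and each of its indices contributes at
  least 1 to the weight.\<close>

lemma keys_partition:
  assumes "lam \<in> partitions"
  shows "keys lam \<subseteq> {..<weight lam}"
proof
  fix i assume "i \<in> keys lam"
  have "{..i} \<subseteq> keys lam"
  proof
    fix j assume "j \<in> {..i}"
    then have "lookup lam i \<le> lookup lam j" using assms by (simp add: partitions_def monotone_def)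
    then show "j \<in> keys lam" using \<open>i \<in> keys lam\<close> by (simp add: in_keys_iff)
  qed
  then have "card {..i} \<le> card (keys lam)" by (intro card_mono) simp_all
  then show "i \<in> {..<weight lam}" using card_keys_le_weight [of lam] by simp
qed

lemma schur_coord_schur:
  "schur_coord lam (schur \<alpha>) = (if keys \<alpha> \<subseteq> {..<weight lam}
    then lookup (alternant (weight lam) (staircase (weight lam) + \<alpha>)) (staircase (weight lam) + lam)
    else 0)"
  using schur_poly_mult_alternant [of \<alpha> "weight lam"]
  by (auto simp: schur_coord_def restrict_vars_schur mult.commute schur_poly_def)

lemma keys_staircase_add: "keys \<alpha> \<subseteq> {..<n} \<Longrightarrow> keys (staircase n + \<alpha>) \<subseteq> {..<n}"
  using keys_staircase by (simp add: keys_plus_composition)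

lemma schur_coord_schur_nonzeroD:
  assumes "schur_coord lam (schur \<alpha>) \<noteq> 0"
  shows "keys \<alpha> \<subseteq> {..<weight lam}" "weight \<alpha> = weight lam"
proof -
  show keys: "keys \<alpha> \<subseteq> {..<weight lam}"
    using assms by (simp add: schur_coord_schur split: if_splits)
  have "weight (staircase (weight lam) + lam) = weight (staircase (weight lam) + \<alpha>)"
    using assms keys
    by (intro weight_eq_if_lookup_alternant_nonzero [of _ "weight lam"] keys_staircase_add)
      (simp_all add: schur_coord_schur)
  then show "weight \<alpha> = weight lam" by (simp add: weight_add)
qed

lemma schur_coord_schur_partition:
  assumes "lam \<in> partitions" "\<mu> \<in> partitions"
  shows "schur_coord lam (schur \<mu>) = of_bool (lam = \<mu>)"
proof (cases "keys \<mu> \<subseteq> {..<weight lam}")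
  case True
  then show ?thesis
    using lookup_alternant_decreasing [OF keys_staircase_add [OF True]
        decreasing_below_staircase_add [OF assms(2)] decreasing_below_staircase_add [OF assms(1)]]
    by (auto simp: schur_coord_schur)
next
  case False
  then have "lam \<noteq> \<mu>" using keys_partition [OF assms(2)] by auto
  then show ?thesis using False by (simp add: schur_coord_schur)
qed

definition bounded_compositions :: "nat \<Rightarrow> composition set"
  where "bounded_compositions n = {\<gamma>. keys \<gamma> \<subseteq> {..<n} \<and> weight \<gamma> \<le> n}"

lemma finite_bounded: "finite (bounded_compositions n)"
proof (rule finite_subset)
  show "bounded_compositions n \<subseteq> {\<gamma>. keys \<gamma> \<subseteq> {..<n} \<and> (\<forall>i. lookup \<gamma> i \<le> n)}"
    using le_trans [OF lookup_le_weight] by (auto simp: bounded_compositions_def)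
qed (rule finite_bounded_compositions, simp)

text \<open>The alternant a_{\<delta>+\<alpha>} is multiplied by f and coefficients at \<delta> +
  lam are compared. Terms outside \<open>bounded_compositions (weight lam)\<close> vanish for
  reasons of weight and support, so any finite A containing that set may be used.\<close>

lemma schur_coord_mult:
  assumes "finite A" "bounded_compositions (weight lam) \<subseteq> A"
  shows "schur_coord lam (schur \<alpha> * f) = (\<Sum>\<gamma>\<in>A. coeff_of f \<gamma> * schur_coord lam (schur (\<alpha> + \<gamma>)))"
proof (cases "keys \<alpha> \<subseteq> {..<weight lam}")
  case True
  let ?n = "weight lam"
  let ?F = "restrict_vars ?n f" and ?\<delta> = "staircase ?n"
  have in_F: "\<gamma> \<in> keys ?F \<longleftrightarrow> keys \<gamma> \<subseteq> {..<?n} \<and> coeff_of f \<gamma> \<noteq> 0" for \<gamma>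
    unfolding in_keys_iff [of \<gamma>] lookup_restrict_vars by simp
  have "alternant ?n ?\<delta> * restrict_vars ?n (schur \<alpha> * f) =
      schur_poly ?n \<alpha> * alternant ?n ?\<delta> * ?F"
    by (simp add: restrict_vars_mult restrict_vars_schur)
  also have "\<dots> = alternant ?n (?\<delta> + \<alpha>) * ?F"
    by (simp only: schur_poly_mult_alternant [OF True])
  also have "\<dots> = (\<Sum>\<gamma>\<in>keys ?F. of_int (coeff_of f \<gamma>) * alternant ?n (?\<delta> + \<alpha> + \<gamma>))"
    using keys_staircase_add [OF True] by (intro alternant_mult_restrict_vars) simp_all
  finally have "schur_coord lam (schur \<alpha> * f) =
      (\<Sum>\<gamma>\<in>keys ?F. coeff_of f \<gamma> * lookup (alternant ?n (?\<delta> + \<alpha> + \<gamma>)) (?\<delta> + lam))"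
    by (simp add: schur_coord_def lookup_sum lookup_of_int_mult)
  also have "\<dots> = (\<Sum>\<gamma>\<in>keys ?F. coeff_of f \<gamma> * schur_coord lam (schur (\<alpha> + \<gamma>)))"
    using True by (intro sum.cong refl) (simp add: in_F schur_coord_schur keys_plus_composition add.assoc)
  also have "\<dots> = (\<Sum>\<gamma>\<in>A. coeff_of f \<gamma> * schur_coord lam (schur (\<alpha> + \<gamma>)))"
  proof (rule sum.mono_neutral_cong)
    fix \<gamma> assume \<gamma>: "\<gamma> \<in> keys ?F - A"
    show "coeff_of f \<gamma> * schur_coord lam (schur (\<alpha> + \<gamma>)) = 0"
    proof (rule ccontr)
      assume "coeff_of f \<gamma> * schur_coord lam (schur (\<alpha> + \<gamma>)) \<noteq> 0"
      then have "weight (\<alpha> + \<gamma>) = ?n" by (intro schur_coord_schur_nonzeroD) simp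
      then have "\<gamma> \<in> bounded_compositions ?n"
        using \<gamma> in_F by (simp add: bounded_compositions_def weight_add)
      then show False using \<gamma> assms(2) by auto
    qed
  next
    fix \<gamma> assume \<gamma>: "\<gamma> \<in> A - keys ?F"
    show "coeff_of f \<gamma> * schur_coord lam (schur (\<alpha> + \<gamma>)) = 0"
    proof (rule ccontr)
      assume *: "coeff_of f \<gamma> * schur_coord lam (schur (\<alpha> + \<gamma>)) \<noteq> 0"
      then have "keys (\<alpha> + \<gamma>) \<subseteq> {..<?n}" by (intro schur_coord_schur_nonzeroD) simp
      then show False using \<gamma> * in_F by (simp add: keys_plus_composition)
    qed
  qed (use assms(1) in simp_all)
  finally show ?thesis .
next
  case False
  then have "schur_coord lam (schur (\<alpha> + \<gamma>)) = 0" for \<gamma>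
    by (simp add: schur_coord_schur keys_plus_composition)
  moreover have "schur_coord lam (schur \<alpha> * f) = 0"
    using False by (simp add: schur_coord_def restrict_vars_mult restrict_vars_schur schur_poly_def)
  ultimately show ?thesis by simp
qed

section \<open>Straightening, and the expansion in Schur functions of partitions\<close>

lemma exists_permutation_sorting:
  fixes f :: "nat \<Rightarrow> nat"
  assumes "inj_on f {..<n}"
  shows "\<exists>\<sigma>. \<sigma> permutes {..<n} \<and> (\<forall>i j. i < j \<longrightarrow> j < n \<longrightarrow> f (\<sigma> j) < f (\<sigma> i))"
proof -
  define ys where "ys = map f [0..<n]"
  define xs where "xs = rev (sort ys)"
  have [simp]: "length xs = n" "length ys = n" by (simp_all add: xs_def ys_def)
  have "mset xs = mset ys" by (simp add: xs_def)
  then obtain \<sigma> where \<sigma>: "\<sigma> permutes {..<length ys}" "permute_list \<sigma> ys = xs"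
    by (rule mset_eq_permutation)
  have "distinct ys" using assms by (simp add: ys_def distinct_map lessThan_atLeast0)
  then have dist: "distinct xs" by (simp add: xs_def)
  have nth: "f (\<sigma> i) = xs ! i" if "i < n" for i
  proof -
    have "\<sigma> i < n" using \<sigma>(1) that permutes_in_image [of \<sigma> "{..<n}" i] by simp
    then show ?thesis using permute_list_nth [OF \<sigma>(1), of i, unfolded \<sigma>(2)] that by (simp add: ys_def)
  qed
  have "f (\<sigma> j) < f (\<sigma> i)" if "i < j" "j < n" for i j
  proof -
    have "sorted (rev xs)" by (simp add: xs_def)
    then have "xs ! j \<le> xs ! i" using that by (intro sorted_rev_nth_mono) simp_all
    moreover have "xs ! j \<noteq> xs ! i" using dist that by (simp add: nth_eq_iff_index_eq)
    ultimately show ?thesis using that by (simp add: nth)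
  qed
  then show ?thesis using \<sigma>(1) by auto
qed

lemma partition_of_decreasing:
  assumes "keys \<beta> \<subseteq> {..<n}" "decreasing_below n \<beta>"
  shows "\<exists>lam\<in>partitions. keys lam \<subseteq> {..<n} \<and> staircase n + lam = \<beta>"
proof -
  \<comment> \<open>Counted from its last entry, a strictly decreasing sequence dominates the
    staircase, so the truncated subtraction that defines \<open>lam\<close> loses nothing.\<close>
  have ge: "k \<le> lookup \<beta> (n - Suc k)" if "k < n" for k
    using that
  proof (induction k)
    case (Suc k)
    then have "lookup \<beta> (n - Suc k) < lookup \<beta> (n - Suc (Suc k))"
      using assms(2) by (simp add: decreasing_below_def)
    then show ?case using Suc by simp
  qed simp
  have ge': "n - Suc i \<le> lookup \<beta> i" for i
    using ge [of "n - Suc i"] by (cases "i < n") simp_all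
  define lam where "lam = \<beta> - staircase n"
  have lookup_lam: "lookup lam i = lookup \<beta> i - (n - Suc i)" for i
    by (simp add: lam_def lookup_minus lookup_staircase)
  have eq: "staircase n + lam = \<beta>"
    using ge' by (intro poly_mapping_eqI) (simp add: lookup_add lookup_lam lookup_staircase)
  have "lookup lam (Suc i) \<le> lookup lam i" for i
  proof (cases "Suc i < n")
    case True
    then have "lookup \<beta> (Suc i) < lookup \<beta> i" using assms(2) by (simp add: decreasing_below_def)
    then show ?thesis using True by (simp add: lookup_lam)
  next
    case False
    then have "lookup \<beta> (Suc i) = 0" using assms(1) by (auto simp: in_keys_iff subset_iff)
    then show ?thesis by (simp add: lookup_lam)
  qed
  then have "lam \<in> partitions" by (simp add: partitions_def antimono_iff_le_Suc)
  moreover have "keys lam \<subseteq> {..<n}"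
    using assms(1) eq keys_plus_composition [of "staircase n" lam] by auto
  ultimately show ?thesis using eq by auto
qed

lemma degree_le_if_homogeneous: "homogeneous f k \<Longrightarrow> k \<le> int d \<Longrightarrow> degree_le f d"
  unfolding homogeneous_def degree_le_def by force

lemma degree_le_schur: "weight \<alpha> \<le> d \<Longrightarrow> degree_le (schur \<alpha>) d"
  by (rule degree_le_if_homogeneous [OF homogeneous_schur]) simp

lemma degree_le_linear_combination:
  assumes "\<And>i. i \<in> A \<Longrightarrow> degree_le (g i) d"
  shows "degree_le (\<Sum>i\<in>A. of_int (c i) * g i) d"
  unfolding degree_le_def
proof (intro allI impI)
  fix \<alpha> assume "coeff_of (\<Sum>i\<in>A. of_int (c i) * g i) \<alpha> \<noteq> 0"
  then obtain i where "i \<in> A" "c i * coeff_of (g i) \<alpha> \<noteq> 0"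
    unfolding coeff_of_sum coeff_of_of_int_mult by (rule sum.not_neutral_contains_not_neutral)
  then show "weight \<alpha> \<le> d" using assms by (auto simp: degree_le_def)
qed

text \<open>If two entries of \<delta> + \<gamma> coincide, the alternant and with it s_\<gamma>
  vanish. Otherwise the entries can be sorted into some \<delta> + lam, at the cost of the sign of
  the sorting permutation.\<close>

lemma schur_straighten:
  "\<exists>lam\<in>partitions. \<exists>c. weight lam = weight \<gamma> \<and> schur \<gamma> = of_int c * schur lam" if "schur \<gamma> \<noteq> 0"
proof -
  obtain m where m: "keys \<gamma> \<subseteq> {..<m}" using exists_keys_bound by blast
  \<comment> \<open>Enough variables for \<gamma> to fit and for restriction to be injective in the
    degree of s_\<gamma>.\<close>
  define n where "n = max m (weight \<gamma>)"
  have n: "keys \<gamma> \<subseteq> {..<n}" "weight \<gamma> \<le> n" using m by (auto simp: n_def)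
  let ?\<delta> = "staircase n"
  let ?\<beta> = "?\<delta> + \<gamma>"
  have \<beta>: "keys ?\<beta> \<subseteq> {..<n}" by (rule keys_staircase_add [OF n(1)])
  have "inj_on (lookup ?\<beta>) {..<n}"
  proof (rule ccontr)
    assume "\<not> inj_on (lookup ?\<beta>) {..<n}"
    then obtain i j where "i < n" "j < n" "i \<noteq> j" "lookup ?\<beta> i = lookup ?\<beta> j"
      unfolding inj_on_def by auto
    then have "alternant n ?\<beta> = 0" by (rule alternant_eq_0 [OF \<beta>])
    then have "schur_poly n \<gamma> = 0" by (intro schur_poly_eqI [OF n(1)]) simp
    then have "restrict_vars n (schur \<gamma>) = restrict_vars n 0"
      by (simp add: restrict_vars_schur poly_mapping_eq_iff fun_eq_iff lookup_restrict_vars zero_symfun.rep_eq)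
    then have "schur \<gamma> = 0"
      using degree_le_schur [OF n(2)]
      by (intro restrict_vars_inject [of _ n]) (simp_all add: degree_le_def zero_symfun.rep_eq)
    then show False using that by simp
  qed
  then obtain \<sigma> where \<sigma>: "\<sigma> permutes {..<n}"
      and dec: "\<forall>i j. i < j \<longrightarrow> j < n \<longrightarrow> lookup ?\<beta> (\<sigma> j) < lookup ?\<beta> (\<sigma> i)"
    using exists_permutation_sorting by blast
  let ?\<beta>' = "Poly_Mapping.map_key \<sigma> ?\<beta>"
  have "decreasing_below n ?\<beta>'"
    unfolding decreasing_below_def lookup_permute [OF permutes_inj [OF \<sigma>]] by (rule dec)
  moreover have "keys ?\<beta>' \<subseteq> {..<n}" using \<beta> keys_permute [OF \<sigma>] by blast
  ultimately obtain lam where lam: "lam \<in> partitions" "keys lam \<subseteq> {..<n}" "?\<delta> + lam = ?\<beta>'"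
    using partition_of_decreasing by blast
  have "weight (?\<delta> + lam) = weight ?\<beta>"
    unfolding lam(3) by (rule weight_permute [OF permutes_bij [OF \<sigma>]])
  then have weight: "weight lam = weight \<gamma>" by (simp add: weight_add)
  have "of_int (sign \<sigma>) * of_int (sign \<sigma>) = (1 :: composition \<Rightarrow>\<^sub>0 int)"
    by (simp flip: of_int_mult)
  then have "of_int (sign \<sigma>) * schur_poly n lam * alternant n ?\<delta> = alternant n ?\<beta>"
    using schur_poly_mult_alternant [OF lam(2)] alternant_permute [OF \<sigma> \<beta>]
    by (simp add: lam(3) mult.assoc)
  then have "schur_poly n \<gamma> = of_int (sign \<sigma>) * schur_poly n lam"
    by (rule schur_poly_eqI [OF n(1)])
  moreover have "restrict_vars n (of_int (sign \<sigma>) * schur lam) = of_int (sign \<sigma>) * schur_poly n lam"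
    using restrict_vars_linear_combination [of n "\<lambda>_. sign \<sigma>" "\<lambda>_. schur lam" "{0 :: nat}"]
    by (simp add: restrict_vars_schur)
  moreover have "degree_le (of_int (sign \<sigma>) * schur lam) n"
    using degree_le_schur [of lam n] weight n(2)
    by (simp add: degree_le_def coeff_of_of_int_mult)
  ultimately have "schur \<gamma> = of_int (sign \<sigma>) * schur lam"
    using degree_le_schur [OF n(2)] restrict_vars_schur
    by (intro restrict_vars_inject [of _ n]) simp_all
  then show ?thesis using lam(1) weight by blast
qed

definition partitions_upto :: "nat \<Rightarrow> composition set"
  where "partitions_upto d = {lam \<in> partitions. weight lam \<le> d}"

lemma finite_partitions_upto: "finite (partitions_upto d)"
proof (rule finite_subset [OF _ finite_bounded])
  show "partitions_upto d \<subseteq> bounded_compositions d"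
    using keys_partition by (fastforce simp: partitions_upto_def bounded_compositions_def)
qed

lemma schur_expansion_schur:
  assumes "weight \<gamma> \<le> d"
  shows "schur \<gamma> = (\<Sum>lam\<in>partitions_upto d. of_int (schur_coord lam (schur \<gamma>)) * schur lam)"
proof (cases "schur \<gamma> = 0")
  case True
  have "schur_coord lam 0 = 0" for lam
    using schur_coord_of_int_mult [of lam 0] by simp
  then show ?thesis by (simp add: True)
next
  case False
  then obtain \<mu> c where \<mu>: "\<mu> \<in> partitions" "weight \<mu> = weight \<gamma>" "schur \<gamma> = of_int c * schur \<mu>"
    using schur_straighten by blast
  have "(\<Sum>lam\<in>partitions_upto d. of_int (schur_coord lam (schur \<gamma>)) * schur lam) =
      (\<Sum>lam\<in>partitions_upto d. if lam = \<mu> then of_int c * schur lam else 0)"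
    using \<mu> by (intro sum.cong refl)
      (simp add: schur_coord_of_int_mult schur_coord_schur_partition partitions_upto_def)
  also have "\<dots> = of_int c * schur \<mu>"
    using \<mu> assms finite_partitions_upto by (simp add: partitions_upto_def)
  finally show ?thesis using \<mu> by simp
qed

text \<open>The product rule for alternants at \<alpha> = 0, divided by a_\<delta>. The monomial
  coefficients of f thus serve as coefficients of the s_\<gamma>, with \<gamma> running over
  compositions and not only over partitions.\<close>

lemma schur_expansion_coeff:
  assumes "degree_le f d"
  shows "f = (\<Sum>\<gamma>\<in>bounded_compositions d. of_int (coeff_of f \<gamma>) * schur \<gamma>)"
proof (rule restrict_vars_inject [OF assms])
  let ?A = "bounded_compositions d" and ?F = "restrict_vars d f" and ?\<delta> = "staircase d"
  show "degree_le (\<Sum>\<gamma>\<in>?A. of_int (coeff_of f \<gamma>) * schur \<gamma>) d"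
    by (intro degree_le_linear_combination degree_le_schur) (simp add: bounded_compositions_def)
  have in_F: "\<gamma> \<in> keys ?F \<longleftrightarrow> keys \<gamma> \<subseteq> {..<d} \<and> coeff_of f \<gamma> \<noteq> 0" for \<gamma>
    unfolding in_keys_iff [of \<gamma>] lookup_restrict_vars by simp
  have sub: "keys ?F \<subseteq> ?A" using in_F assms by (auto simp: bounded_compositions_def degree_le_def)
  have "alternant d ?\<delta> * ?F = (\<Sum>\<gamma>\<in>keys ?F. of_int (coeff_of f \<gamma>) * alternant d (?\<delta> + \<gamma>))"
    using keys_staircase by (intro alternant_mult_restrict_vars) simp_all
  also have "\<dots> = (\<Sum>\<gamma>\<in>?A. of_int (coeff_of f \<gamma>) * alternant d (?\<delta> + \<gamma>))"
    using sub in_F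
    by (intro sum.mono_neutral_left finite_bounded) (auto simp: bounded_compositions_def)
  also have "\<dots> = (\<Sum>\<gamma>\<in>?A. of_int (coeff_of f \<gamma>) * (schur_poly d \<gamma> * alternant d ?\<delta>))"
    by (intro sum.cong refl) (simp add: schur_poly_mult_alternant bounded_compositions_def)
  also have "\<dots> = alternant d ?\<delta> * (\<Sum>\<gamma>\<in>?A. of_int (coeff_of f \<gamma>) * schur_poly d \<gamma>)"
    by (simp add: sum_distrib_left mult_ac)
  finally show "?F = restrict_vars d (\<Sum>\<gamma>\<in>?A. of_int (coeff_of f \<gamma>) * schur \<gamma>)"
    using alternant_staircase_nonzero
    by (simp add: restrict_vars_linear_combination restrict_vars_schur)
qed

theorem schur_expansion:
  assumes "degree_le f d"
  shows "f = (\<Sum>lam\<in>partitions_upto d. of_int (schur_coord lam f) * schur lam)"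
proof -
  let ?A = "bounded_compositions d" and ?P = "partitions_upto d"
  note f = schur_expansion_coeff [OF assms]
  have coord: "schur_coord lam f = (\<Sum>\<gamma>\<in>?A. coeff_of f \<gamma> * schur_coord lam (schur \<gamma>))" for lam
    by (subst f) (rule schur_coord_linear_combination)
  have "f = (\<Sum>\<gamma>\<in>?A. of_int (coeff_of f \<gamma>) *
      (\<Sum>lam\<in>?P. of_int (schur_coord lam (schur \<gamma>)) * schur lam))"
    by (rule trans [OF f], intro sum.cong refl arg_cong [where f = "(*) _"] schur_expansion_schur)
      (simp add: bounded_compositions_def)
  also have "\<dots> = (\<Sum>lam\<in>?P. of_int (schur_coord lam f) * schur lam)"
    unfolding sum_distrib_left coord of_int_sum sum_distrib_right
    by (subst sum.swap) (simp add: mult.assoc)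
  finally show ?thesis .
qed

lemma schur_coord_homogeneous:
  assumes "homogeneous f k" "int (weight lam) \<noteq> k"
  shows "schur_coord lam f = 0"
proof -
  have "schur_coord lam (schur 0 * f) =
      (\<Sum>\<gamma>\<in>bounded_compositions (weight lam). coeff_of f \<gamma> * schur_coord lam (schur (0 + \<gamma>)))"
    by (rule schur_coord_mult [OF finite_bounded]) simp
  also have "\<dots> = 0"
  proof (intro sum.neutral ballI)
    fix \<gamma>
    show "coeff_of f \<gamma> * schur_coord lam (schur (0 + \<gamma>)) = 0"
      using assms schur_coord_schur_nonzeroD(2) [of lam \<gamma>] by (auto simp: homogeneous_def)
  qed
  finally show ?thesis by (simp add: schur_zero)
qed

lemma schur_coord_eq_0:
  assumes "degree_le f d" "lam \<in> partitions" "d < weight lam"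
  shows "schur_coord lam f = 0"
proof -
  have "schur_coord lam f = (\<Sum>\<mu>\<in>partitions_upto d. schur_coord \<mu> f * schur_coord lam (schur \<mu>))"
    by (subst schur_expansion [OF assms(1)]) (rule schur_coord_linear_combination)
  also have "\<dots> = 0"
    using assms(2,3)
    by (intro sum.neutral) (auto simp: partitions_upto_def schur_coord_schur_partition)
  finally show ?thesis .
qed

lemma degree_le_mono: "degree_le f d \<Longrightarrow> d \<le> e \<Longrightarrow> degree_le f e"
  by (auto simp: degree_le_def)

lemma degree_le_add:
  assumes "degree_le f d" "degree_le g d"
  shows "degree_le (f + g) d"
  unfolding degree_le_def
proof (intro allI impI)
  fix \<alpha> assume "coeff_of (f + g) \<alpha> \<noteq> 0"
  then have "coeff_of f \<alpha> \<noteq> 0 \<or> coeff_of g \<alpha> \<noteq> 0" by (auto simp: coeff_of_add)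
  then show "weight \<alpha> \<le> d" using assms by (auto simp: degree_le_def)
qed

lemma symfun_eqI_schur_coord:
  assumes "\<And>lam. lam \<in> partitions \<Longrightarrow> schur_coord lam f = schur_coord lam g"
  shows "f = g"
proof -
  obtain d e where "degree_le f d" "degree_le g e" using degree_le_exists by metis
  then have deg: "degree_le f (max d e)" "degree_le g (max d e)"
    using degree_le_mono [of f d "max d e"] degree_le_mono [of g e "max d e"] by simp_all
  have "schur_coord lam f = schur_coord lam g" if "lam \<in> partitions_upto (max d e)" for lam
    using assms that by (simp add: partitions_upto_def)
  then have "(\<Sum>lam\<in>partitions_upto (max d e). of_int (schur_coord lam f) * schur lam) =
      (\<Sum>lam\<in>partitions_upto (max d e). of_int (schur_coord lam g) * schur lam)"
    by (intro sum.cong refl) simp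
  then show ?thesis using schur_expansion [OF deg(1)] schur_expansion [OF deg(2)] by argo
qed

section \<open>The scalar product and skew Schur functions\<close>

text \<open>The candidate for \<open>scalar\<close>. Keeping only the nonzero coordinates of f makes
  the index set finite without mentioning a degree of f.\<close>

definition schur_pairing :: "symfun \<Rightarrow> symfun \<Rightarrow> int"
  where "schur_pairing f g =
    (\<Sum>lam | lam \<in> partitions \<and> schur_coord lam f \<noteq> 0. schur_coord lam f * schur_coord lam g)"

lemma schur_pairing_eq:
  assumes "degree_le f d"
  shows "schur_pairing f g = (\<Sum>lam\<in>partitions_upto d. schur_coord lam f * schur_coord lam g)"
  unfolding schur_pairing_def
proof (rule sum.mono_neutral_left [OF finite_partitions_upto])
  show "{lam \<in> partitions. schur_coord lam f \<noteq> 0} \<subseteq> partitions_upto d"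
    using schur_coord_eq_0 [OF assms] by (auto simp: partitions_upto_def intro: leI)
qed (auto simp: partitions_upto_def)

text \<open>For uniqueness, an additive form is linear over the integers, so expanding both
  arguments in Schur functions reduces it to its prescribed values on pairs of basis
  elements.\<close>

lemma scalar_eq_schur_pairing: "scalar = schur_pairing"
  unfolding scalar_def
proof (rule the_equality, intro conjI allI ballI)
  fix f g h :: symfun
  obtain d e where "degree_le f d" "degree_le g e" using degree_le_exists by metis
  then have *: "degree_le f (max d e)" "degree_le g (max d e)"
    using degree_le_mono [of f d "max d e"] degree_le_mono [of g e "max d e"] by simp_all
  then have "degree_le (f + g) (max d e)"
    by (rule degree_le_add)
  with * show "schur_pairing (f + g) h = schur_pairing f h + schur_pairing g h"
    by (simp add: schur_pairing_eq schur_coord_add distrib_right sum.distrib)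
  show "schur_pairing f (g + h) = schur_pairing f g + schur_pairing f h"
    using * by (simp add: schur_pairing_eq schur_coord_add distrib_left sum.distrib)
next
  fix \<kappa> \<mu> assume *: "\<kappa> \<in> partitions" "\<mu> \<in> partitions"
  have "schur_pairing (schur \<kappa>) (schur \<mu>) =
      (\<Sum>lam\<in>partitions_upto (weight \<kappa>). if lam = \<kappa> then of_bool (\<kappa> = \<mu>) else 0)"
    using * unfolding schur_pairing_eq [OF degree_le_schur [OF order_refl]]
    by (intro sum.cong refl) (auto simp: schur_coord_schur_partition partitions_upto_def)
  also have "\<dots> = (if \<kappa> = \<mu> then 1 else 0)"
    using *(1) finite_partitions_upto by (simp add: partitions_upto_def)
  finally show "schur_pairing (schur \<kappa>) (schur \<mu>) = (if \<kappa> = \<mu> then 1 else 0)" .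
next
  fix b :: "symfun \<Rightarrow> symfun \<Rightarrow> int"
  assume b: "(\<forall>f g h. b (f + g) h = b f h + b g h) \<and> (\<forall>f g h. b f (g + h) = b f g + b f h) \<and>
    (\<forall>\<kappa>\<in>partitions. \<forall>\<mu>\<in>partitions. b (schur \<kappa>) (schur \<mu>) = (if \<kappa> = \<mu> then 1 else 0))"
  show "b = schur_pairing"
  proof (intro ext)
    fix f g
    obtain d where d: "degree_le f d" using degree_le_exists by blast
    obtain e where e: "degree_le g e" using degree_le_exists by blast
    have 1: "b (\<Sum>i\<in>A. of_int (c i) * h i) g = (\<Sum>i\<in>A. c i * b (h i) g)" for A :: "composition set" and c h g
      using additive_linear_combination [of "\<lambda>f. b f g"] b by simp
    have 2: "b f (\<Sum>i\<in>A. of_int (c i) * h i) = (\<Sum>i\<in>A. c i * b f (h i))" for A :: "composition set" and c h f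
      using additive_linear_combination [of "b f"] b by simp
    have "b (schur lam) g = schur_coord lam g" if "lam \<in> partitions" for lam
    proof -
      have "b (schur lam) g = (\<Sum>\<mu>\<in>partitions_upto e. schur_coord \<mu> g * b (schur lam) (schur \<mu>))"
        by (subst schur_expansion [OF e]) (rule 2)
      also have "\<dots> = (\<Sum>\<mu>\<in>partitions_upto e. schur_coord \<mu> g * schur_coord lam (schur \<mu>))"
        using b that by (intro sum.cong refl) (simp add: partitions_upto_def schur_coord_schur_partition)
      also have "\<dots> = schur_coord lam g"
        by (subst (2) schur_expansion [OF e]) (rule schur_coord_linear_combination [symmetric])
      finally show ?thesis .
    qed
    then have "(\<Sum>lam\<in>partitions_upto d. schur_coord lam f * b (schur lam) g) = schur_pairing f g"
      by (simp add: schur_pairing_eq [OF d] partitions_upto_def)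
    moreover have "b f g = (\<Sum>lam\<in>partitions_upto d. schur_coord lam f * b (schur lam) g)"
      by (rule trans [OF arg_cong [OF schur_expansion [OF d], of "\<lambda>f. b f g"] 1])
    ultimately show "b f g = schur_pairing f g" by simp
  qed
qed

lemma scalar_eq:
  assumes "degree_le f d"
  shows "\<langle>f, g\<rangle> = (\<Sum>lam\<in>partitions_upto d. schur_coord lam f * schur_coord lam g)"
  using schur_pairing_eq [OF assms] by (simp add: scalar_eq_schur_pairing)

lemma scalar_schur_right:
  assumes "lam \<in> partitions"
  shows "\<langle>f, schur lam\<rangle> = schur_coord lam f"
proof -
  obtain d where "degree_le f d" using degree_le_exists by blast
  then have d: "degree_le f (max d (weight lam))" by (rule degree_le_mono) simp
  have "\<langle>f, schur lam\<rangle> =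
      (\<Sum>\<mu>\<in>partitions_upto (max d (weight lam)). if \<mu> = lam then schur_coord \<mu> f else 0)"
    using assms unfolding scalar_eq [OF d]
    by (intro sum.cong refl) (simp add: partitions_upto_def schur_coord_schur_partition)
  also have "\<dots> = schur_coord lam f"
    using assms finite_partitions_upto by (simp add: partitions_upto_def)
  finally show ?thesis .
qed

lemma scalar_schur_left:
  assumes "lam \<in> partitions"
  shows "\<langle>schur lam, f\<rangle> = schur_coord lam f"
proof -
  have "\<langle>schur lam, f\<rangle> =
      (\<Sum>\<mu>\<in>partitions_upto (weight lam). if \<mu> = lam then schur_coord \<mu> f else 0)"
    using assms unfolding scalar_eq [OF degree_le_schur [OF order_refl]]
    by (intro sum.cong refl) (auto simp: partitions_upto_def schur_coord_schur_partition)
  also have "\<dots> = schur_coord lam f"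
    using assms finite_partitions_upto by (simp add: partitions_upto_def)
  finally show ?thesis .
qed

lemma eps_eq: "lam \<in> partitions \<Longrightarrow> \<epsilon> \<alpha> lam = schur_coord lam (schur \<alpha>)"
  by (simp add: eps_def scalar_schur_right)

lemma schur_coord_schur_mult_schur_eq_0:
  "weight lam < weight \<rho> \<Longrightarrow> schur_coord lam (schur \<mu> * schur \<rho>) = 0"
  using homogeneous_mult [OF homogeneous_schur homogeneous_schur]
  by (rule schur_coord_homogeneous) simp

text \<open>Pairing with s_\<rho> forces the coordinate at \<rho> to be the coordinate of s_\<mu>
  s_\<rho> at lam. It vanishes when \<rho> is heavier than lam, so the sum is finite.\<close>

lemma skew_schur_eq:
  assumes "lam \<in> partitions"
  shows "skew_schur lam \<mu> =
    (\<Sum>\<rho>\<in>partitions_upto (weight lam). of_int (schur_coord lam (schur \<mu> * schur \<rho>)) * schur \<rho>)"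
    (is "_ = ?g")
  unfolding skew_schur_def
proof (rule the_equality)
  have deg: "degree_le ?g (weight lam)"
    by (intro degree_le_linear_combination degree_le_schur) (simp add: partitions_upto_def)
  have coord: "schur_coord \<rho> ?g = schur_coord lam (schur \<mu> * schur \<rho>)"
    if "\<rho> \<in> partitions_upto (weight lam)" for \<rho>
  proof -
    have "schur_coord \<rho> ?g = (\<Sum>\<sigma>\<in>partitions_upto (weight lam).
        if \<sigma> = \<rho> then schur_coord lam (schur \<mu> * schur \<sigma>) else 0)"
      using that unfolding schur_coord_linear_combination
      by (intro sum.cong refl) (auto simp: partitions_upto_def schur_coord_schur_partition)
    then show ?thesis using that finite_partitions_upto by simp
  qed
  show g: "\<forall>f. \<langle>?g, f\<rangle> = \<langle>schur lam, schur \<mu> * f\<rangle>"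
  proof
    fix f
    obtain d where "degree_le f d" using degree_le_exists by blast
    then have d: "degree_le f (max d (weight lam))" by (rule degree_le_mono) simp
    let ?P = "partitions_upto (max d (weight lam))"
    have "\<langle>schur lam, schur \<mu> * f\<rangle> =
        schur_coord lam (schur \<mu> * (\<Sum>\<rho>\<in>?P. of_int (schur_coord \<rho> f) * schur \<rho>))"
      unfolding scalar_schur_left [OF assms]
      by (rule arg_cong [OF schur_expansion [OF d], of "\<lambda>f. schur_coord lam (schur \<mu> * f)"])
    also have "\<dots> = schur_coord lam (\<Sum>\<rho>\<in>?P. of_int (schur_coord \<rho> f) * (schur \<mu> * schur \<rho>))"
      by (simp add: sum_distrib_left mult.left_commute)
    also have "\<dots> = (\<Sum>\<rho>\<in>?P. schur_coord \<rho> f * schur_coord lam (schur \<mu> * schur \<rho>))"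
      by (rule schur_coord_linear_combination)
    also have "\<dots> = (\<Sum>\<rho>\<in>partitions_upto (weight lam).
        schur_coord \<rho> f * schur_coord lam (schur \<mu> * schur \<rho>))"
      by (rule sum.mono_neutral_right [OF finite_partitions_upto])
        (auto simp: partitions_upto_def schur_coord_schur_mult_schur_eq_0 intro!: leI)
    also have "\<dots> = \<langle>?g, f\<rangle>"
      unfolding scalar_eq [OF deg] by (intro sum.cong refl) (simp add: coord)
    finally show "\<langle>?g, f\<rangle> = \<langle>schur lam, schur \<mu> * f\<rangle>" by simp
  qed
  fix h assume h: "\<forall>f. \<langle>h, f\<rangle> = \<langle>schur lam, schur \<mu> * f\<rangle>"
  show "h = ?g"
  proof (rule symfun_eqI_schur_coord)
    fix \<rho> assume "\<rho> \<in> partitions"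
    moreover have "\<langle>h, schur \<rho>\<rangle> = \<langle>?g, schur \<rho>\<rangle>" using g h by simp
    ultimately show "schur_coord \<rho> h = schur_coord \<rho> ?g" by (simp only: scalar_schur_right)
  qed
qed

lemma schur_coord_skew_schur:
  assumes "lam \<in> partitions" "\<rho> \<in> partitions"
  shows "schur_coord \<rho> (skew_schur lam \<mu>) = schur_coord lam (schur \<mu> * schur \<rho>)"
proof -
  have "schur_coord \<rho> (skew_schur lam \<mu>) = (\<Sum>\<sigma>\<in>partitions_upto (weight lam).
      if \<sigma> = \<rho> then schur_coord lam (schur \<mu> * schur \<sigma>) else 0)"
    using assms unfolding skew_schur_eq [OF assms(1)] schur_coord_linear_combination
    by (intro sum.cong refl) (auto simp: partitions_upto_def schur_coord_schur_partition)
  also have "\<dots> = schur_coord lam (schur \<mu> * schur \<rho>)"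
    using assms(2) finite_partitions_upto
    by (auto simp: partitions_upto_def schur_coord_schur_mult_schur_eq_0 not_le)
  finally show ?thesis .
qed

lemma scalar_skew_schur:
  assumes "lam \<in> partitions" "\<nu> \<in> partitions" "weight lam \<le> d"
  shows "\<langle>skew_schur lam \<kappa>, skew_schur \<nu> \<mu>\<rangle> = (\<Sum>\<rho>\<in>partitions_upto d.
    schur_coord lam (schur \<kappa> * schur \<rho>) * schur_coord \<nu> (schur \<mu> * schur \<rho>))"
proof -
  have "degree_le (skew_schur lam \<kappa>) d"
    unfolding skew_schur_eq [OF assms(1)] using assms(3)
    by (intro degree_le_linear_combination degree_le_schur) (simp add: partitions_upto_def)
  then show ?thesis
    using assms(1,2) by (simp add: scalar_eq partitions_upto_def schur_coord_skew_schur)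
qed

section \<open>Counting matrices\<close>

lemma lookup_row:
  assumes "finite B" "\<And>j. j \<notin> B \<Longrightarrow> lookup M (i, j) = 0"
  shows "lookup (row M) i = (\<Sum>j\<in>B. lookup M (i, j))"
proof -
  have "{j. lookup M (i, j) \<noteq> 0} \<subseteq> B"
    by (rule subsetI, rule ccontr) (simp add: assms(2))
  with assms(1) show ?thesis unfolding row.rep_eq by (rule Sum_any.expand_superset)
qed

lemma lookup_col:
  assumes "finite A" "\<And>i. i \<notin> A \<Longrightarrow> lookup M (i, j) = 0"
  shows "lookup (col M) j = (\<Sum>i\<in>A. lookup M (i, j))"
proof -
  have "{i. lookup M (i, j) \<noteq> 0} \<subseteq> A"
    by (rule subsetI, rule ccontr) (simp add: assms(2))
  with assms(1) show ?thesis unfolding col.rep_eq by (rule Sum_any.expand_superset)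
qed

lemma lookup_eq_0_if_notin_snd_keys: "j \<notin> snd ` keys M \<Longrightarrow> lookup M (i, j) = 0"
  by (force simp: in_keys_iff image_iff)

lemma lookup_eq_0_if_notin_fst_keys: "i \<notin> fst ` keys M \<Longrightarrow> lookup M (i, j) = 0"
  by (force simp: in_keys_iff image_iff)

lemma lookup_le_row: "lookup M (i, j) \<le> lookup (row M) i"
proof -
  have "lookup M (i, j) \<le> (\<Sum>j\<in>insert j (snd ` keys M). lookup M (i, j))"
    by (rule member_le_sum) simp_all
  also have "\<dots> = lookup (row M) i"
    by (rule lookup_row [symmetric]) (auto intro: lookup_eq_0_if_notin_snd_keys)
  finally show ?thesis .
qed

lemma lookup_le_col: "lookup M (i, j) \<le> lookup (col M) j"
proof -
  have "lookup M (i, j) \<le> (\<Sum>i\<in>insert i (fst ` keys M). lookup M (i, j))"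
    by (rule member_le_sum [where f = "\<lambda>i. lookup M (i, j)"]) simp_all
  also have "\<dots> = lookup (col M) j"
    by (rule lookup_col [symmetric]) (auto intro: lookup_eq_0_if_notin_fst_keys)
  finally show ?thesis .
qed

lemma row_add: "row (M + N) = row M + row N"
proof (rule poly_mapping_eqI)
  fix i
  let ?B = "snd ` keys M \<union> snd ` keys N"
  have "lookup M (i, j) = 0" "lookup N (i, j) = 0" "lookup (M + N) (i, j) = 0" if "j \<notin> ?B" for j
    using that lookup_eq_0_if_notin_snd_keys [of j M i] lookup_eq_0_if_notin_snd_keys [of j N i]
    unfolding lookup_add by auto
  note zero = this
  have "lookup (row K) i = (\<Sum>j\<in>?B. lookup K (i, j))" if "\<And>j. j \<notin> ?B \<Longrightarrow> lookup K (i, j) = 0" for K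
    using that by (intro lookup_row) simp_all
  from this [OF zero(1)] this [OF zero(2)] this [OF zero(3)]
  show "lookup (row (M + N)) i = lookup (row M + row N) i"
    by (simp add: lookup_add sum.distrib)
qed

lemma col_add: "col (M + N) = col M + col N"
proof (rule poly_mapping_eqI)
  fix j
  let ?A = "fst ` keys M \<union> fst ` keys N"
  have "lookup M (i, j) = 0" "lookup N (i, j) = 0" "lookup (M + N) (i, j) = 0" if "i \<notin> ?A" for i
    using that lookup_eq_0_if_notin_fst_keys [of i M j] lookup_eq_0_if_notin_fst_keys [of i N j]
    unfolding lookup_add by auto
  note zero = this
  have "lookup (col K) j = (\<Sum>i\<in>?A. lookup K (i, j))" if "\<And>i. i \<notin> ?A \<Longrightarrow> lookup K (i, j) = 0" for K
    using that by (intro lookup_col) simp_all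
  from this [OF zero(1)] this [OF zero(2)] this [OF zero(3)]
  show "lookup (col (M + N)) j = lookup (col M + col N) j"
    by (simp add: lookup_add sum.distrib)
qed

definition matrices :: "bool \<Rightarrow> composition \<Rightarrow> composition \<Rightarrow> matrix set"
  where "matrices b \<gamma> \<delta> = {M. row M = \<gamma> \<and> col M = \<delta> \<and> (\<forall>p. b \<longrightarrow> lookup M p \<le> 1)}"

lemma finite_bounded_matrices:
  assumes "finite A"
  shows "finite {M :: matrix. keys M \<subseteq> A \<and> (\<forall>p. lookup M p \<le> d)}"
proof -
  let ?S = "{M :: matrix. keys M \<subseteq> A \<and> (\<forall>p. lookup M p \<le> d)}"
  let ?F = "{f. \<forall>x. (x \<in> A \<longrightarrow> f x \<in> {..d}) \<and> (x \<notin> A \<longrightarrow> f x = 0)}"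
  have "finite ?F" using assms by (intro finite_set_of_finite_funs) auto
  moreover have "lookup ` ?S \<subseteq> ?F" by (auto simp: in_keys_iff)
  ultimately have "finite (lookup ` ?S)" by (rule finite_subset [rotated])
  then show ?thesis by (rule finite_imageD) (auto intro!: inj_onI poly_mapping_eqI)
qed

lemma finite_matrices: "finite (matrices b \<gamma> \<delta>)"
proof (rule finite_subset)
  show "matrices b \<gamma> \<delta> \<subseteq> {M. keys M \<subseteq> keys \<gamma> \<times> keys \<delta> \<and> (\<forall>p. lookup M p \<le> weight \<gamma>)}"
  proof
    fix M assume M: "M \<in> matrices b \<gamma> \<delta>"
    have "i \<in> keys \<gamma> \<and> j \<in> keys \<delta>" if "(i, j) \<in> keys M" for i j
      using that M lookup_le_row [of M i j] lookup_le_col [of M i j]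
      by (auto simp: matrices_def in_keys_iff)
    moreover have "lookup M (i, j) \<le> weight \<gamma>" for i j
      using le_trans [OF lookup_le_row lookup_le_weight, of M i j] M by (simp add: matrices_def)
    ultimately show "M \<in> {M. keys M \<subseteq> keys \<gamma> \<times> keys \<delta> \<and> (\<forall>p. lookup M p \<le> weight \<gamma>)}"
      by auto
  qed
qed (rule finite_bounded_matrices, simp)

lemma lookup_swap: "lookup (Poly_Mapping.map_key prod.swap M) (i, j) = lookup M (j, i)"
  for M :: matrix
  by (simp add: map_key.rep_eq)

lemma row_swap: "row (Poly_Mapping.map_key prod.swap M) = col M"
  by (rule poly_mapping_eqI) (simp add: row.rep_eq col.rep_eq lookup_swap)

lemma col_swap: "col (Poly_Mapping.map_key prod.swap M) = row M"
  by (rule poly_mapping_eqI) (simp add: row.rep_eq col.rep_eq lookup_swap)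

lemma swap_swap: "Poly_Mapping.map_key prod.swap (Poly_Mapping.map_key prod.swap M) = M"
  for M :: matrix
proof (rule poly_mapping_eqI)
  fix p
  show "lookup (Poly_Mapping.map_key prod.swap (Poly_Mapping.map_key prod.swap M)) p = lookup M p"
    by (cases p) (simp add: lookup_swap)
qed

text \<open>Transposition of matrices. For generating functions it means that the coefficient of
  X^\<delta> in the product of the h_{\<gamma>_i} equals that of X^\<gamma> in the product of the
  h_{\<delta>_j}, and likewise for e.\<close>

lemma card_matrices_commute: "card (matrices b \<gamma> \<delta>) = card (matrices b \<delta> \<gamma>)"
proof (rule bij_betw_same_card)
  have "Poly_Mapping.map_key prod.swap M \<in> matrices b \<delta> \<gamma>" if "M \<in> matrices b \<gamma> \<delta>" for M \<gamma> \<delta>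
    using that unfolding matrices_def mem_Collect_eq row_swap col_swap split_paired_All lookup_swap
    by blast
  then show "bij_betw (Poly_Mapping.map_key prod.swap) (matrices b \<gamma> \<delta>) (matrices b \<delta> \<gamma>)"
    by (intro bij_betw_byWitness [where f' = "Poly_Mapping.map_key prod.swap"])
      (simp_all add: swap_swap image_subset_iff)
qed

section \<open>Splitting off a row; matrices counted by products of h_k or e_k\<close>

lift_definition single_row :: "nat \<Rightarrow> composition \<Rightarrow> matrix"
  is "\<lambda>n \<tau> p. if fst p = n then \<tau> (snd p) else 0"
proof -
  fix n :: nat and \<tau> :: "nat \<Rightarrow> nat" assume fin: "finite {i. \<tau> i \<noteq> 0}"
  have "{p. (if fst p = n then \<tau> (snd p) else 0) \<noteq> 0} \<subseteq> Pair n ` {i. \<tau> i \<noteq> 0}"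
    by (auto simp: image_iff split: if_splits)
  then show "finite {p. (if fst p = n then \<tau> (snd p) else 0) \<noteq> 0}"
    using fin finite_subset by blast
qed

lift_definition delete_row :: "nat \<Rightarrow> matrix \<Rightarrow> matrix"
  is "\<lambda>n M p. if fst p = n then 0 else M p"
  by (rule finite_subset [rotated]) auto

definition row_part :: "nat \<Rightarrow> matrix \<Rightarrow> composition"
  where "row_part n M = Poly_Mapping.map_key (Pair n) M"

lemma lookup_single_row: "lookup (single_row n \<tau>) (i, j) = (if i = n then lookup \<tau> j else 0)"
  by (simp add: single_row.rep_eq)

lemma lookup_delete_row: "lookup (delete_row n M) (i, j) = (if i = n then 0 else lookup M (i, j))"
  by (simp add: delete_row.rep_eq)

lemma lookup_row_part: "lookup (row_part n M) j = lookup M (n, j)"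
  unfolding row_part_def by (simp add: map_key.rep_eq inj_def)

lemma matrix_eqI: "(\<And>i j. lookup M (i, j) = lookup N (i, j)) \<Longrightarrow> M = N" for M N :: matrix
  by (rule poly_mapping_eqI) (metis surj_pair)

lemma delete_row_add_single_row: "delete_row n M + single_row n (row_part n M) = M"
  by (rule matrix_eqI) (simp add: lookup_add lookup_delete_row lookup_single_row lookup_row_part)

lemma row_single_row: "row (single_row n \<tau>) = Poly_Mapping.single n (weight \<tau>)"
  by (rule poly_mapping_eqI)
    (simp add: row.rep_eq lookup_single_row lookup_single weight_def when_def)

lemma col_single_row: "col (single_row n \<tau>) = \<tau>"
proof (rule poly_mapping_eqI)
  fix j
  have "lookup (col (single_row n \<tau>)) j = (\<Sum>i\<in>{n}. lookup (single_row n \<tau>) (i, j))"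
    by (rule lookup_col) (auto simp: lookup_single_row)
  then show "lookup (col (single_row n \<tau>)) j = lookup \<tau> j" by (simp add: lookup_single_row)
qed

lemma lookup_row_delete_row: "lookup (row (delete_row n M)) n = 0"
  by (simp add: row.rep_eq lookup_delete_row)

lemma row_eq_0_iff: "row M = 0 \<longleftrightarrow> M = 0"
proof
  assume "row M = 0"
  then show "M = 0" using lookup_le_row [of M] by (intro matrix_eqI) simp
next
  assume "M = 0"
  then show "row M = 0" by (intro poly_mapping_eqI) (simp add: row.rep_eq)
qed

text \<open>Choosing a monomial in each factor is choosing a matrix row by row: the exponent chosen
  in factor i is row i, of prescribed weight \<gamma>_i, and the product of the chosen monomials
  records the column sums.\<close>

lemma coeff_of_prod_monomial_sum:
  assumes "keys \<gamma> \<subseteq> {..<n}"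
  shows "coeff_of (\<Prod>i<n. monomial_sum b (int (lookup \<gamma> i))) \<delta> = int (card (matrices b \<gamma> \<delta>))"
  using assms
proof (induction n arbitrary: \<gamma> \<delta>)
  case 0
  then have [simp]: "\<gamma> = 0" by simp
  have "col 0 = 0" by (intro poly_mapping_eqI) (simp add: col.rep_eq)
  then have "matrices b \<gamma> \<delta> = (if \<delta> = 0 then {0} else {})"
    unfolding matrices_def by (auto simp: row_eq_0_iff)
  then show ?case by (simp add: one_symfun.rep_eq)
next
  case (Suc n)
  define k where "k = lookup \<gamma> n"
  define \<gamma>' where "\<gamma>' = \<gamma> - Poly_Mapping.single n k"
  have \<gamma>'_n: "lookup \<gamma>' n = 0" by (simp add: \<gamma>'_def lookup_minus k_def)
  have \<gamma>'_i: "lookup \<gamma>' i = lookup \<gamma> i" if "i \<noteq> n" for i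
    using that by (simp add: \<gamma>'_def lookup_minus lookup_single when_def)
  have \<gamma>: "\<gamma> = \<gamma>' + Poly_Mapping.single n k"
  proof (rule poly_mapping_eqI)
    fix i show "lookup \<gamma> i = lookup (\<gamma>' + Poly_Mapping.single n k) i"
      using \<gamma>'_n \<gamma>'_i [of i] by (cases "i = n") (simp_all add: lookup_add lookup_single k_def)
  qed
  have keys: "keys \<gamma>' \<subseteq> {..<n}"
  proof
    fix i assume i: "i \<in> keys \<gamma>'"
    then have "i \<noteq> n" using \<gamma>'_n by (auto simp: in_keys_iff)
    moreover have "i < Suc n"
      using i \<open>i \<noteq> n\<close> \<gamma>'_i [of i] Suc.prems by (auto simp: in_keys_iff subset_iff)
    ultimately show "i \<in> {..<n}" by simp
  qed
  define good where "good \<tau> \<longleftrightarrow> int (weight \<tau>) = int k \<and> (\<forall>i. b \<longrightarrow> lookup \<tau> i \<le> 1)" for \<tau>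
  let ?S = "{p \<in> splittings \<delta>. good (snd p)}"
  have "(\<Prod>i<n. monomial_sum b (int (lookup \<gamma> i))) = (\<Prod>i<n. monomial_sum b (int (lookup \<gamma>' i)))"
    by (rule prod.cong) (simp_all add: \<gamma>'_i)
  then have "coeff_of (\<Prod>i<Suc n. monomial_sum b (int (lookup \<gamma> i))) \<delta> =
      (\<Sum>p\<in>splittings \<delta>. int (card (matrices b \<gamma>' (fst p))) * of_bool (good (snd p)))"
    by (simp add: times_symfun.rep_eq series_mult_def Suc.IH [OF keys] coeff_of_monomial_sum good_def
        case_prod_unfold k_def)
  also have "\<dots> = (\<Sum>p\<in>?S. int (card (matrices b \<gamma>' (fst p))))"
    by (rule sum.mono_neutral_cong_right) auto
  also have "\<dots> = int (card (Sigma ?S (\<lambda>p. matrices b \<gamma>' (fst p))))"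
    by (subst card_SigmaI) (simp_all add: finite_matrices)
  \<comment> \<open>A matrix is split into its row n and the remainder, whose column sums together
    form a splitting of \<delta>.\<close>
  also have "card (Sigma ?S (\<lambda>p. matrices b \<gamma>' (fst p))) = card (matrices b \<gamma> \<delta>)"
  proof (rule bij_betw_same_card, rule bij_betw_byWitness)
    let ?f = "\<lambda>(p, M). M + single_row n (snd p)"
    let ?g = "\<lambda>M. ((col (delete_row n M), row_part n M), delete_row n M)"
    have zero: "lookup M (n, j) = 0" if "M \<in> matrices b \<gamma>' \<beta>" for M \<beta> j
      using that lookup_le_row [of M n j] \<gamma>'_n by (simp add: matrices_def)
    show "\<forall>x\<in>Sigma ?S (\<lambda>p. matrices b \<gamma>' (fst p)). ?g (?f x) = x"
    proof
      fix x assume "x \<in> Sigma ?S (\<lambda>p. matrices b \<gamma>' (fst p))"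
      then obtain \<beta> \<tau> M where x: "x = ((\<beta>, \<tau>), M)" and M: "M \<in> matrices b \<gamma>' \<beta>" by auto
      have "delete_row n (M + single_row n \<tau>) = M"
        by (rule matrix_eqI) (auto simp: lookup_delete_row lookup_add lookup_single_row zero [OF M])
      moreover have "row_part n (M + single_row n \<tau>) = \<tau>"
        by (rule poly_mapping_eqI) (simp add: lookup_row_part lookup_add lookup_single_row zero [OF M])
      ultimately show "?g (?f x) = x" using M by (simp add: x matrices_def)
    qed
    show "\<forall>M\<in>matrices b \<gamma> \<delta>. ?f (?g M) = M" by (simp add: delete_row_add_single_row)
    show "?f ` Sigma ?S (\<lambda>p. matrices b \<gamma>' (fst p)) \<subseteq> matrices b \<gamma> \<delta>"
    proof (rule image_subsetI)
      fix x assume "x \<in> Sigma ?S (\<lambda>p. matrices b \<gamma>' (fst p))"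
      then obtain \<beta> \<tau> M where x: "x = ((\<beta>, \<tau>), M)" and M: "M \<in> matrices b \<gamma>' \<beta>"
          and \<tau>: "good \<tau>" "\<beta> + \<tau> = \<delta>" by (auto simp: splittings_def)
      have "lookup (M + single_row n \<tau>) (i, j) \<le> 1" if b for i j
        using that M \<tau>(1) zero [OF M, of j]
        by (cases "i = n") (simp_all add: lookup_add lookup_single_row matrices_def good_def)
      then show "?f x \<in> matrices b \<gamma> \<delta>"
        using M \<tau> by (simp add: x matrices_def row_add col_add row_single_row col_single_row \<gamma> good_def)
    qed
    show "?g ` matrices b \<gamma> \<delta> \<subseteq> Sigma ?S (\<lambda>p. matrices b \<gamma>' (fst p))"
    proof (rule image_subsetI)
      fix M assume M: "M \<in> matrices b \<gamma> \<delta>"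
      have row: "row (delete_row n M) + Poly_Mapping.single n (weight (row_part n M)) = \<gamma>"
        using M delete_row_add_single_row [of n M] row_single_row row_add
        by (metis (mono_tags, lifting) matrices_def mem_Collect_eq)
      have weight: "weight (row_part n M) = k"
        using arg_cong [OF row, of "\<lambda>\<gamma>. lookup \<gamma> n"]
        by (simp add: lookup_add lookup_row_delete_row k_def)
      then have "row (delete_row n M) = \<gamma>'" using row by (simp add: \<gamma>)
      moreover have "col (delete_row n M) + row_part n M = \<delta>"
        using M delete_row_add_single_row [of n M] col_single_row col_add
        by (metis (mono_tags, lifting) matrices_def mem_Collect_eq)
      moreover have "lookup M p \<le> 1" if b for p using that M unfolding matrices_def by blast
      ultimately show "?g M \<in> Sigma ?S (\<lambda>p. matrices b \<gamma>' (fst p))"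
        using weight
        by (simp add: splittings_def good_def matrices_def lookup_row_part lookup_delete_row)
    qed
  qed
  finally show ?case .
qed

definition monomial_prod :: "bool \<Rightarrow> composition \<Rightarrow> symfun"
  where "monomial_prod b \<gamma> = (\<Prod>i\<in>keys \<gamma>. monomial_sum b (int (lookup \<gamma> i)))"

lemma monomial_prod_eq:
  assumes "keys \<gamma> \<subseteq> {..<n}"
  shows "monomial_prod b \<gamma> = (\<Prod>i<n. monomial_sum b (int (lookup \<gamma> i)))"
  unfolding monomial_prod_def using assms
  by (intro prod.mono_neutral_left) (auto simp: in_keys_iff monomial_sum_0)

lemma coeff_of_monomial_prod: "coeff_of (monomial_prod b \<gamma>) \<delta> = int (card (matrices b \<gamma> \<delta>))"
proof -
  obtain n where "keys \<gamma> \<subseteq> {..<n}" using exists_keys_bound by blast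
  then show ?thesis by (simp add: monomial_prod_eq coeff_of_prod_monomial_sum)
qed

section \<open>Cauchy identities\<close>

text \<open>With \<eta>_i = lam_i - i + \<sigma> i, the left side is the coefficient of X^\<eta> in
  the product of the h_{\<gamma>_i}, hence by transposing matrices the coefficient of X^\<gamma> in
  the product of the h_{\<eta>_i}. If some \<eta>_i is negative, both sides vanish. The same holds
  for e.\<close>

lemma jacobi_trudi_term:
  assumes \<sigma>: "\<sigma> permutes {..<n}" and keys: "keys lam \<subseteq> {..<n}"
  shows "lookup (Poly_Mapping.single (Poly_Mapping.map_key \<sigma> (staircase n)) 1 *
      restrict_vars n (monomial_prod b \<gamma>)) (staircase n + lam) =
    coeff_of (\<Prod>i<n. monomial_sum b (int (lookup lam i) - int i + int (\<sigma> i))) \<gamma>"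
proof -
  let ?\<delta> = "staircase n"
  let ?m = "Poly_Mapping.map_key \<sigma> ?\<delta>"
  have m: "lookup ?m i = n - Suc (\<sigma> i)" for i
    using permutes_inj [OF \<sigma>] by (simp add: lookup_permute lookup_staircase)
  have \<sigma>_less: "\<sigma> i < n \<longleftrightarrow> i < n" for i
    using permutes_in_image [OF \<sigma>, of i] by simp
  show ?thesis
  proof (cases "\<forall>i<n. i \<le> lookup lam i + \<sigma> i")
    case True
    define \<eta> where "\<eta> = ?\<delta> + lam - ?m"
    have \<eta>: "lookup \<eta> i = lookup lam i + \<sigma> i - i" if "i < n" for i
      using that True \<sigma>_less [of i] by (simp add: \<eta>_def lookup_minus lookup_add m lookup_staircase)
    have \<eta>_0: "lookup \<eta> i = 0" if "\<not> i < n" for i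
    proof -
      have "lookup lam i = 0" using that keys by (auto simp: in_keys_iff)
      then show ?thesis using that by (simp add: \<eta>_def lookup_minus lookup_add lookup_staircase)
    qed
    have eq: "?\<delta> + lam = ?m + \<eta>"
    proof (rule poly_mapping_eqI)
      fix i
      show "lookup (?\<delta> + lam) i = lookup (?m + \<eta>) i"
      proof (cases "i < n")
        case i: True
        then have "i \<le> lookup lam i + \<sigma> i" "\<sigma> i < n" using True \<sigma>_less by auto
        then show ?thesis using i by (simp add: lookup_add lookup_staircase m \<eta>)
      next
        case False
        then have "lookup lam i = 0" using keys by (auto simp: in_keys_iff)
        then show ?thesis
          using False \<sigma>_less [of i] by (simp add: lookup_add lookup_staircase m \<eta>_0)
      qed
    qed
    have keys_\<eta>: "keys \<eta> \<subseteq> {..<n}" using \<eta>_0 by (auto simp: in_keys_iff)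
    have "lookup (Poly_Mapping.single ?m 1 * restrict_vars n (monomial_prod b \<gamma>)) (?\<delta> + lam) =
        int (card (matrices b \<gamma> \<eta>))"
      unfolding eq lookup_monomial_mult
      by (simp add: lookup_restrict_vars keys_\<eta> coeff_of_monomial_prod)
    also have "\<dots> = coeff_of (\<Prod>i<n. monomial_sum b (int (lookup \<eta> i))) \<gamma>"
      by (simp add: coeff_of_prod_monomial_sum [OF keys_\<eta>] card_matrices_commute)
    also have "(\<Prod>i<n. monomial_sum b (int (lookup \<eta> i))) =
        (\<Prod>i<n. monomial_sum b (int (lookup lam i) - int i + int (\<sigma> i)))"
      using True by (intro prod.cong refl arg_cong [where f = "monomial_sum b"]) (simp add: \<eta> of_nat_diff)
    finally show ?thesis .
  next
    case False
    then obtain i where i: "i < n" "lookup lam i + \<sigma> i < i" by (auto simp: not_le)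
    have "?\<delta> + lam \<noteq> ?m + \<eta>" for \<eta>
    proof
      assume "?\<delta> + lam = ?m + \<eta>"
      from arg_cong [OF this, of "\<lambda>\<gamma>. lookup \<gamma> i"] i show False
        by (simp add: lookup_add lookup_staircase m)
    qed
    then have "lookup (Poly_Mapping.single ?m 1 * restrict_vars n (monomial_prod b \<gamma>)) (?\<delta> + lam) = 0"
      by (rule lookup_monomial_mult_eq_0)
    moreover have "monomial_sum b (int (lookup lam i) - int i + int (\<sigma> i)) = 0"
      using i by (intro monomial_sum_neg) simp
    then have "(\<Prod>i<n. monomial_sum b (int (lookup lam i) - int i + int (\<sigma> i))) = 0"
      using i(1) by (intro prod_zero) auto
    ultimately show ?thesis by (simp add: zero_symfun.rep_eq)
  qed
qed

text \<open>Expanding a_\<delta> over permutations turns the coordinate into the determinant term by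
  term. For \<open>b = False\<close> both sides are the Kostka number of lam and \<gamma>.\<close>

lemma schur_coord_monomial_prod:
  assumes "lam \<in> partitions"
  shows "schur_coord lam (monomial_prod b \<gamma>) = coeff_of (jacobi_trudi b (weight lam) lam) \<gamma>"
  unfolding schur_coord_def jacobi_trudi_def coeff_of_sum coeff_of_of_int_mult
    alternant_eq [OF keys_staircase] sum_distrib_right lookup_sum mult.assoc lookup_of_int_mult
  by (intro sum.cong refl) (simp add: jacobi_trudi_term keys_partition [OF assms])

text \<open>The coefficient of \<open>X\<^sup>\<gamma> Y\<^sup>\<delta>\<close> in the Cauchy identities for
  \<open>\<Prod> (1 - X\<^sub>i Y\<^sub>j)\<^sup>-\<^sup>1\<close> and \<open>\<Prod> (1 + X\<^sub>i Y\<^sub>j)\<close>. For \<open>b = True\<close> the Jacobi-Trudi determinant in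
  elementary symmetric functions is the Schur function of the conjugate partition.\<close>

theorem cauchy_identity:
  assumes "weight \<gamma> \<le> d"
  shows "int (card (matrices b \<gamma> \<delta>)) =
    (\<Sum>lam\<in>partitions_upto d. coeff_of (jacobi_trudi b (weight lam) lam) \<gamma> * coeff_of (schur lam) \<delta>)"
proof -
  have "homogeneous (monomial_prod b \<gamma>) (\<Sum>i\<in>keys \<gamma>. int (lookup \<gamma> i))"
    unfolding monomial_prod_def
    by (rule homogeneous_prod) (auto simp: homogeneous_def coeff_of_monomial_sum)
  moreover have "(\<Sum>i\<in>keys \<gamma>. int (lookup \<gamma> i)) = int (weight \<gamma>)"
    by (subst weight_eq_sum [of "keys \<gamma>"]) simp_all
  ultimately have "degree_le (monomial_prod b \<gamma>) d"
    using assms by (intro degree_le_if_homogeneous [of _ "int (weight \<gamma>)"]) simp_all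
  \<comment> \<open>The product of the h_{\<gamma>_i} or e_{\<gamma>_i} is expanded in Schur
    functions and coefficients of X^\<delta> are compared; those of the product count
    matrices.\<close>
  from arg_cong [OF schur_expansion [OF this], of "\<lambda>f. coeff_of f \<delta>"] show ?thesis
    by (simp add: coeff_of_monomial_prod coeff_of_sum coeff_of_of_int_mult schur_coord_monomial_prod
        partitions_upto_def)
qed

section \<open>Pieri rules\<close>

text \<open>Exchanging the entries \<open>\<beta>\<^sub>i\<close> and \<open>\<beta>\<^bsub>i+1\<^esub>\<close> for the last \<open>i\<close> with \<open>l\<^sub>i \<le> \<beta>\<^bsub>i+1\<^esub>\<close> is an
  involution that negates the alternant; for \<open>l = \<delta> + \<mu>\<close>, only the horizontal strips on \<open>\<mu>\<close> survive.\<close>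

lemma sum_alternants_cancel:
  assumes "finite X" and l: "\<And>i. lookup l (Suc i) \<le> lookup l i"
    and X: "X = {\<beta>. keys \<beta> \<subseteq> {..<n} \<and> (\<forall>i. lookup l i \<le> lookup \<beta> i) \<and> weight \<beta> = w \<and>
      (\<exists>i. Suc i < n \<and> lookup l i \<le> lookup \<beta> (Suc i))}"
  shows "(\<Sum>\<beta>\<in>X. alternant n \<beta>) = 0"
proof -
  define bad where "bad \<beta> = {i. Suc i < n \<and> lookup l i \<le> lookup \<beta> (Suc i)}" for \<beta>
  define sw where "sw \<beta> = Poly_Mapping.map_key (transpose (Max (bad \<beta>)) (Suc (Max (bad \<beta>)))) \<beta>"
    for \<beta> :: composition
  have fin: "finite (bad \<beta>)" for \<beta>
    by (rule finite_subset [of _ "{..<n}"]) (auto simp: bad_def)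
  have lookup_sw: "lookup (sw \<beta>) j = lookup \<beta> (transpose (Max (bad \<beta>)) (Suc (Max (bad \<beta>))) j)" for \<beta> j
    by (simp add: sw_def lookup_permute)
  have *: "sw \<beta> \<in> X \<and> Max (bad (sw \<beta>)) = Max (bad \<beta>) \<and> alternant n (sw \<beta>) = - alternant n \<beta>"
    if "\<beta> \<in> X" for \<beta>
  proof -
    define i where "i = Max (bad \<beta>)"
    have "bad \<beta> \<noteq> {}" using that by (auto simp: X bad_def)
    then have "i \<in> bad \<beta>" unfolding i_def by (intro Max_in fin)
    then have i: "Suc i < n" "lookup l i \<le> lookup \<beta> (Suc i)" by (auto simp: bad_def)
    have \<beta>: "keys \<beta> \<subseteq> {..<n}" "lookup l j \<le> lookup \<beta> j" "weight \<beta> = w" for j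
      using that by (auto simp: X)
    have perm: "transpose i (Suc i) permutes {..<n}" using i by (intro permutes_swap_id) auto
    have sw_i: "lookup (sw \<beta>) i = lookup \<beta> (Suc i)" "lookup (sw \<beta>) (Suc i) = lookup \<beta> i"
      unfolding lookup_sw by (simp_all flip: i_def)
    have sw_j: "lookup (sw \<beta>) j = lookup \<beta> j" if "j \<noteq> i" "j \<noteq> Suc i" for j
      using that unfolding lookup_sw by (simp flip: i_def)
    \<comment> \<open>The entry \<beta>_i moved to place i + 1 is still at least l_i, so i stays
      bad, and badness of later indices depends only on entries beyond i + 1, which are unchanged.
      So the same i is found again and the swap undoes itself.\<close>
    have "i \<in> bad (sw \<beta>)" using i(1) \<beta>(2) [of i] by (simp add: bad_def sw_i)
    moreover have "j \<le> i" if "j \<in> bad (sw \<beta>)" for j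
    proof (rule ccontr)
      assume "\<not> j \<le> i"
      then have "j \<in> bad \<beta>" using that by (simp add: bad_def sw_j)
      then have "j \<le> i" unfolding i_def by (intro Max_ge fin)
      with \<open>\<not> j \<le> i\<close> show False by simp
    qed
    ultimately have "Max (bad (sw \<beta>)) = i" by (intro Max_eqI fin)
    moreover have "alternant n (sw \<beta>) = - alternant n \<beta>"
      unfolding sw_def using i \<beta>(1) by (intro alternant_swap) (simp_all flip: i_def)
    moreover have "lookup l j \<le> lookup (sw \<beta>) j" for j
    proof -
      consider "j = i" | "j = Suc i" | "j \<noteq> i" "j \<noteq> Suc i" by blast
      then show ?thesis
      proof cases
        case 2
        then show ?thesis using l [of i] \<beta>(2) [of i] by (simp add: sw_i)
      qed (use i(2) \<beta>(2) in \<open>simp_all add: sw_i sw_j\<close>)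
    qed
    moreover have "keys (sw \<beta>) \<subseteq> {..<n}"
      unfolding sw_def i_def [symmetric] keys_permute [OF perm] by (rule \<beta>(1))
    moreover have "weight (sw \<beta>) = w"
      unfolding sw_def i_def [symmetric] weight_permute [OF permutes_bij [OF perm]] by (rule \<beta>(3))
    moreover have "Suc i < n \<and> lookup l i \<le> lookup (sw \<beta>) (Suc i)"
      using \<open>i \<in> bad (sw \<beta>)\<close> by (simp add: bad_def)
    ultimately show ?thesis unfolding X i_def by blast
  qed
  have sw_sw: "sw (sw \<beta>) = \<beta>" if "\<beta> \<in> X" for \<beta>
    using * [OF that] by (intro poly_mapping_eqI) (simp add: lookup_sw)
  have "(\<Sum>\<beta>\<in>X. alternant n \<beta>) = (\<Sum>\<beta>\<in>X. - alternant n \<beta>)"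
    by (rule sum.reindex_bij_witness [where i = sw and j = sw]) (use * sw_sw in auto)
  then have "2 * (\<Sum>\<beta>\<in>X. alternant n \<beta>) = 0"
    by (simp only: sum_negf eq_neg_iff_add_eq_0 mult_2)
  then show ?thesis by simp
qed

text \<open>The exponents of h_k or e_k in n variables; \<open>lookup \<gamma> i\<close> is the
  number of boxes to be added in row i.\<close>

definition strip_contents :: "bool \<Rightarrow> nat \<Rightarrow> nat \<Rightarrow> composition set"
  where "strip_contents b n k =
    {\<gamma>. keys \<gamma> \<subseteq> {..<n} \<and> weight \<gamma> = k \<and> (\<forall>i. b \<longrightarrow> lookup \<gamma> i \<le> 1)}"

lemma finite_strip_contents: "finite (strip_contents b n k)"
proof (rule finite_subset)
  show "strip_contents b n k \<subseteq> {\<gamma>. keys \<gamma> \<subseteq> {..<n} \<and> (\<forall>i. lookup \<gamma> i \<le> k)}"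
    using lookup_le_weight by (auto simp: strip_contents_def)
qed (rule finite_bounded_compositions, simp)

lemma schur_coord_mult_monomial_sum:
  "schur_coord lam (schur \<mu> * monomial_sum b (int k)) =
    (\<Sum>\<gamma>\<in>strip_contents b (weight lam) k. schur_coord lam (schur (\<mu> + \<gamma>)))"
proof -
  let ?G = "strip_contents b (weight lam) k" and ?A = "bounded_compositions (weight lam)"
  have "schur_coord lam (schur \<mu> * monomial_sum b (int k)) =
      (\<Sum>\<gamma>\<in>?A \<union> ?G. coeff_of (monomial_sum b (int k)) \<gamma> * schur_coord lam (schur (\<mu> + \<gamma>)))"
    by (rule schur_coord_mult) (simp_all add: finite_bounded finite_strip_contents)
  also have "\<dots> = (\<Sum>\<gamma>\<in>?G. schur_coord lam (schur (\<mu> + \<gamma>)))"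
  proof (rule sum.mono_neutral_cong_right)
    show "finite (?A \<union> ?G)" by (simp add: finite_bounded finite_strip_contents)
  qed (auto simp: strip_contents_def bounded_compositions_def coeff_of_monomial_sum)
  finally show ?thesis .
qed

lemma sum_of_bool_unique:
  fixes lam \<mu> :: composition
  assumes "finite G"
  shows "(\<Sum>\<gamma>\<in>G. of_bool (lam = \<mu> + \<gamma>)) = (of_bool (\<exists>\<gamma>\<in>G. lam = \<mu> + \<gamma>) :: int)"
proof (cases "\<exists>\<gamma>\<in>G. lam = \<mu> + \<gamma>")
  case True
  then obtain \<gamma> where \<gamma>: "\<gamma> \<in> G" "lam = \<mu> + \<gamma>" by blast
  then have "(\<Sum>\<gamma>\<in>G. of_bool (lam = \<mu> + \<gamma>)) = (\<Sum>\<gamma>'\<in>G. if \<gamma>' = \<gamma> then 1 else 0 :: int)"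
    by (intro sum.cong) auto
  then show ?thesis using \<gamma> True assms by simp
qed auto

definition horizontal_strip :: "composition \<Rightarrow> composition \<Rightarrow> bool"
  where "horizontal_strip \<mu> lam \<longleftrightarrow>
    (\<forall>i. lookup \<mu> i \<le> lookup lam i \<and> lookup lam (Suc i) \<le> lookup \<mu> i)"

definition vertical_strip :: "composition \<Rightarrow> composition \<Rightarrow> bool"
  where "vertical_strip \<mu> lam \<longleftrightarrow>
    (\<forall>i. lookup \<mu> i \<le> lookup lam i \<and> lookup lam i \<le> Suc (lookup \<mu> i))"

lemma minus_strip:
  assumes "\<And>i. lookup \<mu> i \<le> lookup lam i" "lam \<in> partitions"
  shows "lam = \<mu> + (lam - \<mu>)" "keys (lam - \<mu>) \<subseteq> {..<weight lam}"
proof -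
  show eq: "lam = \<mu> + (lam - \<mu>)"
    using assms(1) by (intro poly_mapping_eqI) (simp add: lookup_add lookup_minus)
  have "keys (lam - \<mu>) \<subseteq> keys lam"
    by (subst (2) eq) (simp add: keys_plus_composition)
  then show "keys (lam - \<mu>) \<subseteq> {..<weight lam}" using keys_partition [OF assms(2)] by simp
qed

lemma partitions_Suc_le: "lam \<in> partitions \<Longrightarrow> lookup lam (Suc i) \<le> lookup lam i"
  by (simp add: partitions_def antimono_iff_le_Suc)

text \<open>Adding at most one box to each row of a partition gives a partition or makes some row
  exactly one longer than the row above it. In the latter case \<delta> + \<mu> + \<gamma> has two
  equal entries, so the term is zero and no cancellation between terms occurs.\<close>

lemma pieri_vertical:
  assumes "lam \<in> partitions" "\<mu> \<in> partitions"
  shows "schur_coord lam (schur \<mu> * monomial_sum True (int k)) =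
    of_bool (vertical_strip \<mu> lam \<and> weight lam = weight \<mu> + k)"
proof -
  let ?n = "weight lam"
  let ?G = "strip_contents True ?n k" and ?\<delta> = "staircase ?n"
  have "schur_coord lam (schur (\<mu> + \<gamma>)) = of_bool (lam = \<mu> + \<gamma>)" if "\<gamma> \<in> ?G" for \<gamma>
  proof (cases "\<mu> + \<gamma> \<in> partitions")
    case True
    then show ?thesis using assms by (simp add: schur_coord_schur_partition)
  next
    case False
    then obtain i where i: "lookup (\<mu> + \<gamma>) i < lookup (\<mu> + \<gamma>) (Suc i)"
      by (auto simp: partitions_def antimono_iff_le_Suc not_le)
    have "lookup \<gamma> (Suc i) \<le> 1" using that by (simp add: strip_contents_def)
    then have eq: "lookup (\<mu> + \<gamma>) (Suc i) = Suc (lookup (\<mu> + \<gamma>) i)"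
      using i partitions_Suc_le [OF assms(2), of i] by (simp add: lookup_add)
    have "schur_coord lam (schur (\<mu> + \<gamma>)) = 0"
    proof (cases "keys (\<mu> + \<gamma>) \<subseteq> {..<?n}")
      case True
      have "Suc i \<in> keys (\<mu> + \<gamma>)" using i by (simp add: in_keys_iff)
      then have "Suc i < ?n" using True by auto
      then have "alternant ?n (?\<delta> + (\<mu> + \<gamma>)) = 0"
        using eq by (intro alternant_eq_0 [OF keys_staircase_add [OF True], of i "Suc i"])
          (simp_all add: lookup_add [of "?\<delta>"] lookup_staircase)
      then show ?thesis by (simp add: schur_coord_schur)
    qed (simp add: schur_coord_schur)
    then show ?thesis using False assms by auto
  qed
  then have "schur_coord lam (schur \<mu> * monomial_sum True (int k)) = (\<Sum>\<gamma>\<in>?G. of_bool (lam = \<mu> + \<gamma>))"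
    unfolding schur_coord_mult_monomial_sum by (rule sum.cong [OF refl])
  also have "\<dots> = of_bool (\<exists>\<gamma>\<in>?G. lam = \<mu> + \<gamma>)"
    by (rule sum_of_bool_unique [OF finite_strip_contents])
  also have "(\<exists>\<gamma>\<in>?G. lam = \<mu> + \<gamma>) \<longleftrightarrow> vertical_strip \<mu> lam \<and> ?n = weight \<mu> + k"
  proof
    assume "\<exists>\<gamma>\<in>?G. lam = \<mu> + \<gamma>"
    then show "vertical_strip \<mu> lam \<and> ?n = weight \<mu> + k"
      by (auto simp: strip_contents_def vertical_strip_def lookup_add weight_add)
  next
    assume *: "vertical_strip \<mu> lam \<and> ?n = weight \<mu> + k"
    then have le: "lookup \<mu> i \<le> lookup lam i" "lookup lam i \<le> Suc (lookup \<mu> i)" for i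
      by (auto simp: vertical_strip_def)
    note \<gamma> = minus_strip [OF le(1) assms(1)]
    have "weight (lam - \<mu>) = k"
      using * arg_cong [OF \<gamma>(1), of weight] by (simp add: weight_add)
    moreover have "lookup (lam - \<mu>) i \<le> 1" for i
      using le(2) [of i] by (simp add: lookup_minus)
    ultimately have "lam - \<mu> \<in> ?G" using \<gamma>(2) by (simp add: strip_contents_def)
    then show "\<exists>\<gamma>\<in>?G. lam = \<mu> + \<gamma>" using \<gamma>(1) by blast
  qed
  finally show ?thesis .
qed

text \<open>The terms for which \<mu> + \<gamma> does not interlace with \<mu> cancel under a
  sign-reversing exchange; in the others \<mu> + \<gamma> is itself a partition, so each is 1 or
  0.\<close>

lemma pieri_horizontal:
  assumes "lam \<in> partitions" "\<mu> \<in> partitions"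
  shows "schur_coord lam (schur \<mu> * monomial_sum False (int k)) =
    of_bool (horizontal_strip \<mu> lam \<and> weight lam = weight \<mu> + k)"
proof (cases "keys \<mu> \<subseteq> {..<weight lam}")
  case False
  have "\<not> horizontal_strip \<mu> lam"
  proof
    assume "horizontal_strip \<mu> lam"
    then have "keys \<mu> \<subseteq> keys lam" unfolding horizontal_strip_def
      by (metis in_keys_iff le_zero_eq subsetI)
    then show False using False keys_partition [OF assms(1)] by blast
  qed
  moreover have "schur_coord lam (schur (\<mu> + \<gamma>)) = 0" for \<gamma>
    using False by (simp add: schur_coord_schur keys_plus_composition)
  ultimately show ?thesis by (simp add: schur_coord_mult_monomial_sum)
next
  case True
  let ?n = "weight lam"
  let ?G = "strip_contents False ?n k"
  define l where "l = staircase ?n + \<mu>"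
  define bad where "bad \<gamma> \<longleftrightarrow> (\<exists>i. Suc i < ?n \<and> lookup l i \<le> lookup (l + \<gamma>) (Suc i))" for \<gamma>
  let ?X = "{\<beta>. keys \<beta> \<subseteq> {..<?n} \<and> (\<forall>i. lookup l i \<le> lookup \<beta> i) \<and> weight \<beta> = weight l + k \<and>
      (\<exists>i. Suc i < ?n \<and> lookup l i \<le> lookup \<beta> (Suc i))}"
  have keys_l: "keys l \<subseteq> {..<?n}" unfolding l_def by (rule keys_staircase_add [OF True])
  have coord: "schur_coord lam (schur (\<mu> + \<gamma>)) = lookup (alternant ?n (l + \<gamma>)) (staircase ?n + lam)"
    if "\<gamma> \<in> ?G" for \<gamma>
    using that True
    by (simp add: schur_coord_schur keys_plus_composition strip_contents_def l_def add.assoc)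
  \<comment> \<open>Translation by l turns the non-interlacing \<gamma> into the exponents subject
    to the cancellation: those dominating l entrywise, with the weight of l plus k.\<close>
  have image: "(+) l ` {\<gamma> \<in> ?G. bad \<gamma>} = ?X"
  proof
    show "(+) l ` {\<gamma> \<in> ?G. bad \<gamma>} \<subseteq> ?X"
      using keys_l by (auto simp: strip_contents_def bad_def keys_plus_composition weight_add lookup_add)
    show "?X \<subseteq> (+) l ` {\<gamma> \<in> ?G. bad \<gamma>}"
    proof
      fix \<beta> assume \<beta>: "\<beta> \<in> ?X"
      have eq: "\<beta> = l + (\<beta> - l)"
        using \<beta> by (intro poly_mapping_eqI) (simp add: lookup_add lookup_minus)
      have "weight \<beta> = weight l + weight (\<beta> - l)" by (subst eq) (rule weight_add)
      moreover have "keys (\<beta> - l) \<subseteq> keys \<beta>" by (subst (2) eq) (simp add: keys_plus_composition)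
      ultimately have "\<beta> - l \<in> {\<gamma> \<in> ?G. bad \<gamma>}"
        using \<beta> eq by (auto simp: strip_contents_def bad_def)
      then show "\<beta> \<in> (+) l ` {\<gamma> \<in> ?G. bad \<gamma>}" using eq by blast
    qed
  qed
  have "(\<Sum>\<gamma> | \<gamma> \<in> ?G \<and> bad \<gamma>. schur_coord lam (schur (\<mu> + \<gamma>))) =
      lookup (\<Sum>\<gamma> | \<gamma> \<in> ?G \<and> bad \<gamma>. alternant ?n (l + \<gamma>)) (staircase ?n + lam)"
    unfolding lookup_sum by (intro sum.cong) (auto simp: coord)
  also have "(\<Sum>\<gamma> | \<gamma> \<in> ?G \<and> bad \<gamma>. alternant ?n (l + \<gamma>)) = (\<Sum>\<beta>\<in>?X. alternant ?n \<beta>)"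
    unfolding image [symmetric] by (subst sum.reindex) simp_all
  also have "\<dots> = 0"
  proof (rule sum_alternants_cancel [OF _ _ refl])
    show "finite ?X" unfolding image [symmetric] by (simp add: finite_strip_contents)
    show "lookup l (Suc i) \<le> lookup l i" for i
      using partitions_Suc_le [OF assms(2), of i] by (simp add: l_def lookup_add lookup_staircase)
  qed
  finally have bad: "(\<Sum>\<gamma> | \<gamma> \<in> ?G \<and> bad \<gamma>. schur_coord lam (schur (\<mu> + \<gamma>))) = 0" by simp
  have good_iff: "\<not> bad \<gamma> \<longleftrightarrow> (\<forall>i. lookup (\<mu> + \<gamma>) (Suc i) \<le> lookup \<mu> i)" if "\<gamma> \<in> ?G" for \<gamma>
  proof -
    \<comment> \<open>The staircase drops by one from i to i + 1, so the weak inequality for l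
      becomes a strict one for \<mu>.\<close>
    have "lookup l i \<le> lookup (l + \<gamma>) (Suc i) \<longleftrightarrow> \<not> lookup (\<mu> + \<gamma>) (Suc i) \<le> lookup \<mu> i"
      if "Suc i < ?n" for i
      using that by (auto simp: l_def lookup_add lookup_staircase)
    moreover have "lookup (\<mu> + \<gamma>) (Suc i) = 0" if "\<not> Suc i < ?n" for i
    proof -
      have "keys (\<mu> + \<gamma>) \<subseteq> {..<?n}"
        using True \<open>\<gamma> \<in> ?G\<close> by (simp add: keys_plus_composition strip_contents_def)
      then show ?thesis using that by (auto simp: in_keys_iff)
    qed
    ultimately show ?thesis unfolding bad_def by (metis le0)
  qed
  have good: "schur_coord lam (schur (\<mu> + \<gamma>)) = of_bool (lam = \<mu> + \<gamma>)" if "\<gamma> \<in> ?G" "\<not> bad \<gamma>" for \<gamma>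
  proof -
    have "lookup (\<mu> + \<gamma>) (Suc i) \<le> lookup (\<mu> + \<gamma>) i" for i
      using that good_iff [OF that(1)] le_trans [of _ "lookup \<mu> i"] by (simp add: lookup_add trans_le_add1)
    then have "\<mu> + \<gamma> \<in> partitions" by (simp add: partitions_def antimono_iff_le_Suc)
    then show ?thesis using assms by (simp add: schur_coord_schur_partition)
  qed
  have "schur_coord lam (schur \<mu> * monomial_sum False (int k)) =
      (\<Sum>\<gamma> | \<gamma> \<in> ?G \<and> bad \<gamma>. schur_coord lam (schur (\<mu> + \<gamma>))) +
      (\<Sum>\<gamma> | \<gamma> \<in> ?G \<and> \<not> bad \<gamma>. schur_coord lam (schur (\<mu> + \<gamma>)))"
    unfolding schur_coord_mult_monomial_sum
    by (subst sum.union_disjoint [symmetric]) (auto simp: finite_strip_contents intro!: sum.cong)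
  also have "\<dots> = (\<Sum>\<gamma> | \<gamma> \<in> ?G \<and> \<not> bad \<gamma>. of_bool (lam = \<mu> + \<gamma>))"
    unfolding bad by (auto simp: good intro!: sum.cong)
  also have "\<dots> = of_bool (\<exists>\<gamma>\<in>{\<gamma> \<in> ?G. \<not> bad \<gamma>}. lam = \<mu> + \<gamma>)"
    by (rule sum_of_bool_unique) (simp add: finite_strip_contents)
  also have "(\<exists>\<gamma>\<in>{\<gamma> \<in> ?G. \<not> bad \<gamma>}. lam = \<mu> + \<gamma>) \<longleftrightarrow> horizontal_strip \<mu> lam \<and> ?n = weight \<mu> + k"
  proof
    assume "\<exists>\<gamma>\<in>{\<gamma> \<in> ?G. \<not> bad \<gamma>}. lam = \<mu> + \<gamma>"
    then obtain \<gamma> where \<gamma>: "\<gamma> \<in> ?G" "\<not> bad \<gamma>" "lam = \<mu> + \<gamma>" by blast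
    then have "\<forall>i. lookup lam (Suc i) \<le> lookup \<mu> i" using good_iff by simp
    moreover have "lookup \<mu> i \<le> lookup lam i" for i using \<gamma>(3) by (simp add: lookup_add)
    moreover have "?n = weight \<mu> + k"
      using \<gamma>(1) arg_cong [OF \<gamma>(3), of weight] by (simp add: weight_add strip_contents_def)
    ultimately show "horizontal_strip \<mu> lam \<and> ?n = weight \<mu> + k"
      by (simp add: horizontal_strip_def)
  next
    assume *: "horizontal_strip \<mu> lam \<and> ?n = weight \<mu> + k"
    then have le: "lookup \<mu> i \<le> lookup lam i" "lookup lam (Suc i) \<le> lookup \<mu> i" for i
      by (auto simp: horizontal_strip_def)
    note \<gamma> = minus_strip [OF le(1) assms(1)]
    have "weight (lam - \<mu>) = k"
      using * arg_cong [OF \<gamma>(1), of weight] by (simp add: weight_add)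
    then have "lam - \<mu> \<in> ?G" using \<gamma>(2) by (simp add: strip_contents_def)
    moreover from this have "\<not> bad (lam - \<mu>)"
      using le(2) by (simp add: good_iff \<gamma>(1) [symmetric])
    ultimately show "\<exists>\<gamma>\<in>{\<gamma> \<in> ?G. \<not> bad \<gamma>}. lam = \<mu> + \<gamma>" using \<gamma>(1) by blast
  qed
  finally show ?thesis .
qed

section \<open>Conjugation\<close>

text \<open>The rows longer than j form an initial segment, because lam is weakly decreasing, so
  their number exceeds i exactly when row i is among them.\<close>

lemma less_lookup_conjugate_iff:
  assumes "lam \<in> partitions"
  shows "i < lookup (conjugate lam) j \<longleftrightarrow> j < lookup lam i"
proof -
  let ?S = "{i. j < lookup lam i}"
  have "?S \<subseteq> keys lam" by (auto simp: in_keys_iff)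
  then have fin: "finite ?S" by (rule finite_subset) simp
  have down: "i' \<in> ?S" if "i \<in> ?S" "i' \<le> i" for i i'
    using that assms by (auto simp: partitions_def monotone_def intro: less_le_trans)
  have eq: "lookup (conjugate lam) j = card ?S" by (simp add: conjugate.rep_eq)
  show ?thesis
  proof
    assume "j < lookup lam i"
    then have "{..i} \<subseteq> ?S" using down [of i] by auto
    then have "card {..i} \<le> card ?S" by (rule card_mono [OF fin])
    then show "i < lookup (conjugate lam) j" by (simp add: eq)
  next
    assume i: "i < lookup (conjugate lam) j"
    show "j < lookup lam i"
    proof (rule ccontr)
      assume "\<not> j < lookup lam i"
      then have "?S \<subseteq> {..<i}" using down by (auto simp: not_less [symmetric])
      then have "card ?S \<le> card {..<i}" by (intro card_mono) simp_all
      then show False using i by (simp add: eq)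
    qed
  qed
qed

lemma conjugate_in_partitions:
  assumes "lam \<in> partitions"
  shows "conjugate lam \<in> partitions"
proof -
  have "lookup (conjugate lam) (Suc j) \<le> lookup (conjugate lam) j" for j
  proof (rule ccontr)
    assume "\<not> lookup (conjugate lam) (Suc j) \<le> lookup (conjugate lam) j"
    then have "lookup (conjugate lam) j < lookup (conjugate lam) (Suc j)" by simp
    then have "Suc j < lookup lam (lookup (conjugate lam) j)"
      using less_lookup_conjugate_iff [OF assms] by blast
    moreover have "\<not> j < lookup lam (lookup (conjugate lam) j)"
      using less_lookup_conjugate_iff [OF assms, of "lookup (conjugate lam) j" j] by simp
    ultimately show False by simp
  qed
  then show ?thesis by (simp add: partitions_def antimono_iff_le_Suc)
qed

lemma le_iff_less_imp_less: "(\<forall>k. k < a \<longrightarrow> k < b) \<longleftrightarrow> a \<le> b" for a b :: nat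
  by (metis less_le_trans not_le less_irrefl)

lemma conjugate_conjugate:
  assumes "lam \<in> partitions"
  shows "conjugate (conjugate lam) = lam"
proof (rule poly_mapping_eqI)
  fix i
  have "k < lookup (conjugate (conjugate lam)) i \<longleftrightarrow> k < lookup lam i" for k
    using less_lookup_conjugate_iff [OF conjugate_in_partitions [OF assms], of k i]
      less_lookup_conjugate_iff [OF assms, of i k] by simp
  then show "lookup (conjugate (conjugate lam)) i = lookup lam i"
    using le_iff_less_imp_less by (intro order_antisym) blast+
qed

lemma conjugate_inject:
  "lam \<in> partitions \<Longrightarrow> \<mu> \<in> partitions \<Longrightarrow> conjugate lam = conjugate \<mu> \<longleftrightarrow> lam = \<mu>"
  using conjugate_conjugate by metis

lemma conjugate_zero: "conjugate 0 = 0"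
  by (rule poly_mapping_eqI) (simp add: conjugate.rep_eq)

lemma weight_conjugate:
  assumes "lam \<in> partitions"
  shows "weight (conjugate lam) = weight lam"
proof -
  obtain m where "keys lam \<subseteq> {..<m}" using exists_keys_bound by blast
  moreover obtain m' where "keys (conjugate lam) \<subseteq> {..<m'}" using exists_keys_bound by blast
  \<comment> \<open>The side of a square containing the diagram in both directions, whose boxes are
    counted by rows and by columns.\<close>
  moreover define n where "n = m + m'"
  ultimately have keys: "keys lam \<subseteq> {..<n}" "keys (conjugate lam) \<subseteq> {..<n}" by force+
  let ?c = "\<lambda>i j. of_bool (j < lookup lam i) :: nat"
  have "lookup lam i \<le> n" if "i < n" for i
  proof (rule ccontr)
    assume "\<not> lookup lam i \<le> n"
    then have "i < lookup (conjugate lam) n" using less_lookup_conjugate_iff [OF assms] by simp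
    then have "n \<in> keys (conjugate lam)" by (simp add: in_keys_iff)
    then show False using keys(2) by auto
  qed
  then have "lookup lam i = (\<Sum>j<n. ?c i j)" if "i < n" for i
  proof -
    have "{j. j < n \<and> j < lookup lam i} = {..<lookup lam i}"
      using that \<open>\<And>i. i < n \<Longrightarrow> lookup lam i \<le> n\<close> [of i] by auto
    then show ?thesis by (simp add: of_bool_def sum.If_cases Int_def)
  qed
  then have "weight lam = (\<Sum>i<n. \<Sum>j<n. ?c i j)"
    by (simp add: weight_eq_sum [OF _ keys(1)])
  also have "\<dots> = (\<Sum>j<n. \<Sum>i<n. ?c i j)" by (rule sum.swap)
  also have "\<dots> = (\<Sum>j<n. lookup (conjugate lam) j)"
  proof (rule sum.cong [OF refl])
    fix j assume "j \<in> {..<n}"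
    have "{i. i < n \<and> j < lookup lam i} = {i. j < lookup lam i}"
      using keys(1) by (auto simp: in_keys_iff subset_iff)
    then show "(\<Sum>i<n. ?c i j) = lookup (conjugate lam) j"
      by (simp add: of_bool_def sum.If_cases Int_def conjugate.rep_eq)
  qed
  also have "\<dots> = weight (conjugate lam)" by (simp add: weight_eq_sum [OF _ keys(2)])
  finally show ?thesis by simp
qed

lemma vertical_strip_conjugate:
  assumes "lam \<in> partitions" "\<mu> \<in> partitions"
  shows "vertical_strip (conjugate \<mu>) (conjugate lam) \<longleftrightarrow> horizontal_strip \<mu> lam"
proof -
  have "(\<forall>j. lookup (conjugate \<mu>) j \<le> lookup (conjugate lam) j) \<longleftrightarrow>
      (\<forall>j i. j < lookup \<mu> i \<longrightarrow> j < lookup lam i)"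
    by (simp add: le_iff_less_imp_less [symmetric] less_lookup_conjugate_iff assms)
  also have "\<dots> \<longleftrightarrow> (\<forall>i. lookup \<mu> i \<le> lookup lam i)"
    unfolding le_iff_less_imp_less [symmetric] by blast
  finally have 1: "(\<forall>j. lookup (conjugate \<mu>) j \<le> lookup (conjugate lam) j) \<longleftrightarrow>
      (\<forall>i. lookup \<mu> i \<le> lookup lam i)" .
  \<comment> \<open>The box allowed by the successor becomes a shift by one in k. Here k indexes
    rows of lam and \<mu>, so after transposition this is the shift from i to i + 1 in the
    interlacing condition.\<close>
  have "a \<le> Suc b \<longleftrightarrow> (\<forall>k. Suc k < a \<longrightarrow> k < b)" for a b
    by (cases a) (simp_all add: le_iff_less_imp_less)
  then have "(\<forall>j. lookup (conjugate lam) j \<le> Suc (lookup (conjugate \<mu>) j)) \<longleftrightarrow>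
      (\<forall>j i. j < lookup lam (Suc i) \<longrightarrow> j < lookup \<mu> i)"
    by (simp add: less_lookup_conjugate_iff assms)
  also have "\<dots> \<longleftrightarrow> (\<forall>i. lookup lam (Suc i) \<le> lookup \<mu> i)"
    unfolding le_iff_less_imp_less [symmetric] by blast
  finally show ?thesis using 1 by (simp add: vertical_strip_def horizontal_strip_def all_conj_distrib)
qed

text \<open>\<open>conjugate_pair f g\<close> says that \<open>g\<close> is the image of \<open>f\<close> under the involution that maps
  \<open>s\<^bsub>\<lambda>\<^esub>\<close> to \<open>s\<^bsub>\<lambda>\<^sup>t\<^esub>\<close>.\<close>

definition conjugate_pair :: "symfun \<Rightarrow> symfun \<Rightarrow> bool"
  where "conjugate_pair f g \<longleftrightarrow>
    (\<forall>lam\<in>partitions. schur_coord (conjugate lam) g = schur_coord lam f)"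

lemma conjugate_pair_unique:
  assumes "conjugate_pair f g" "conjugate_pair f g'"
  shows "g = g'"
proof (rule symfun_eqI_schur_coord)
  fix lam assume lam: "lam \<in> partitions"
  then have "schur_coord (conjugate (conjugate lam)) g = schur_coord (conjugate (conjugate lam)) g'"
    using assms conjugate_in_partitions [OF lam] by (simp only: conjugate_pair_def)
  then show "schur_coord lam g = schur_coord lam g'" by (simp add: conjugate_conjugate lam)
qed

lemma conjugate_pair_linear_combination:
  assumes "\<And>i. i \<in> A \<Longrightarrow> conjugate_pair (f i) (g i)"
  shows "conjugate_pair (\<Sum>i\<in>A. of_int (c i) * f i) (\<Sum>i\<in>A. of_int (c i) * g i)"
  using assms by (simp add: conjugate_pair_def schur_coord_linear_combination)

lemma conjugate_pair_schur:
  "\<mu> \<in> partitions \<Longrightarrow> conjugate_pair (schur \<mu>) (schur (conjugate \<mu>))"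
  by (simp add: conjugate_pair_def schur_coord_schur_partition conjugate_in_partitions conjugate_inject)

text \<open>By linearity it suffices to take f = s_\<mu>, where both Pieri rules apply and
  transposition exchanges horizontal and vertical strips. For negative k both products are
  zero.\<close>

lemma conjugate_pair_mult_monomial_sum:
  assumes "conjugate_pair f g"
  shows "conjugate_pair (f * monomial_sum False k) (g * monomial_sum True k)"
proof (cases "k < 0")
  case True
  have "schur_coord lam 0 = 0" for lam using schur_coord_of_int_mult [of lam 0] by simp
  then show ?thesis using True by (simp add: monomial_sum_neg conjugate_pair_def)
next
  case False
  then obtain m where k: "k = int m" by (metis not_less zero_le_imp_eq_int)
  obtain d where "degree_le f d" using degree_le_exists by blast
  note f = schur_expansion [OF this]
  let ?P = "partitions_upto d"
  have "conjugate_pair f (\<Sum>\<mu>\<in>?P. of_int (schur_coord \<mu> f) * schur (conjugate \<mu>))"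
    by (subst f, rule conjugate_pair_linear_combination)
      (simp add: partitions_upto_def conjugate_pair_schur)
  with assms have g: "g = (\<Sum>\<mu>\<in>?P. of_int (schur_coord \<mu> f) * schur (conjugate \<mu>))"
    by (rule conjugate_pair_unique)
  have base: "conjugate_pair (schur \<mu> * monomial_sum False k) (schur (conjugate \<mu>) * monomial_sum True k)"
    if "\<mu> \<in> partitions" for \<mu>
    using that unfolding conjugate_pair_def k
    by (simp add: pieri_horizontal pieri_vertical conjugate_in_partitions weight_conjugate
        vertical_strip_conjugate)
  have "f * monomial_sum False k =
      (\<Sum>\<mu>\<in>?P. of_int (schur_coord \<mu> f) * (schur \<mu> * monomial_sum False k))"
    by (subst f) (simp only: sum_distrib_right mult.assoc)
  moreover have "g * monomial_sum True k =
      (\<Sum>\<mu>\<in>?P. of_int (schur_coord \<mu> f) * (schur (conjugate \<mu>) * monomial_sum True k))"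
    by (subst g) (simp only: sum_distrib_right mult.assoc)
  moreover have "conjugate_pair
      (\<Sum>\<mu>\<in>?P. of_int (schur_coord \<mu> f) * (schur \<mu> * monomial_sum False k))
      (\<Sum>\<mu>\<in>?P. of_int (schur_coord \<mu> f) * (schur (conjugate \<mu>) * monomial_sum True k))"
    by (intro conjugate_pair_linear_combination base) (simp add: partitions_upto_def)
  ultimately show ?thesis by (simp only:)
qed

lemma conjugate_pair_mult_prod:
  assumes "conjugate_pair f g" "finite A"
  shows "conjugate_pair (f * (\<Prod>i\<in>A. monomial_sum False (k i))) (g * (\<Prod>i\<in>A. monomial_sum True (k i)))"
  using assms(2)
proof (induction A rule: finite_induct)
  case empty
  show ?case using assms(1) by simp
next
  case (insert a A)
  then show ?case
    using conjugate_pair_mult_monomial_sum [OF insert.IH, of "k a"] by (simp add: mult_ac)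
qed

text \<open>A determinant in the h_k is a signed sum of products of them. Since every Schur function
  is such a determinant, this provides all the multiplicativity of the involution that is
  used.\<close>

lemma conjugate_pair_mult_jacobi_trudi:
  assumes "conjugate_pair f g"
  shows "conjugate_pair (f * jacobi_trudi False n \<alpha>) (g * jacobi_trudi True n \<alpha>)"
  unfolding jacobi_trudi_def sum_distrib_left mult.left_commute [of f] mult.left_commute [of g]
  by (intro conjugate_pair_linear_combination conjugate_pair_mult_prod assms finite_lessThan)

text \<open>The involution fixes 1, the Schur function of the empty partition, so it sends the
  determinant in the h_k to the one in the e_k.\<close>

theorem schur_conjugate_eq_jacobi_trudi:
  assumes "lam \<in> partitions"
  shows "schur (conjugate lam) = jacobi_trudi True (weight lam) lam"
proof -
  have "conjugate_pair 1 1"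
    using conjugate_pair_schur [OF zero_in_partitions] by (simp add: schur_zero conjugate_zero)
  from conjugate_pair_mult_jacobi_trudi [OF this, of "weight lam" lam]
  have "conjugate_pair (schur lam) (jacobi_trudi True (weight lam) lam)"
    by (simp add: schur_eq_jacobi_trudi [OF keys_partition [OF assms]])
  with conjugate_pair_schur [OF assms] show ?thesis by (rule conjugate_pair_unique)
qed

text \<open>The invariance of Littlewood-Richardson coefficients under transposing all three
  partitions, a consequence of the involution respecting products.\<close>

lemma schur_coord_mult_conjugate:
  assumes "lam \<in> partitions" "\<kappa> \<in> partitions" "\<rho> \<in> partitions"
  shows "schur_coord (conjugate lam) (schur (conjugate \<kappa>) * schur (conjugate \<rho>)) =
    schur_coord lam (schur \<kappa> * schur \<rho>)"
  using conjugate_pair_mult_jacobi_trudi [OF conjugate_pair_schur [OF assms(2)], of "weight \<rho>" \<rho>] assms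
  by (simp add: conjugate_pair_def schur_conjugate_eq_jacobi_trudi [OF assms(3)]
      schur_eq_jacobi_trudi [OF keys_partition [OF assms(3)]])

section \<open>Scalar products of skew Schur functions\<close>

text \<open>Matrices are grouped by row and column sums: finitely many pairs of sums contribute,
  each with finitely many matrices. Finiteness matters for the value as well, since
  \<open>sum'\<close> is 0 on infinite support.\<close>

lemma sum_over_matrices:
  fixes u v :: "composition \<Rightarrow> int"
  assumes "finite A" "finite B" "\<And>\<gamma>. u \<gamma> \<noteq> 0 \<Longrightarrow> \<gamma> \<in> A" "\<And>\<delta>. v \<delta> \<noteq> 0 \<Longrightarrow> \<delta> \<in> B"
    and S: "S = {M. \<forall>p. b \<longrightarrow> lookup M p \<le> 1}"
  shows "finite {M \<in> S. u (row M) * v (col M) \<noteq> 0}"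
    and "sum' (\<lambda>M. u (row M) * v (col M)) S =
      (\<Sum>\<gamma>\<in>A. \<Sum>\<delta>\<in>B. u \<gamma> * v \<delta> * int (card (matrices b \<gamma> \<delta>)))"
proof -
  let ?f = "\<lambda>M. u (row M) * v (col M)"
  define T where "T = (\<Union>p\<in>A \<times> B. matrices b (fst p) (snd p))"
  have T: "finite T" unfolding T_def using assms(1,2) by (auto simp: finite_matrices)
  have sub: "{M \<in> S. ?f M \<noteq> 0} \<subseteq> T"
    using assms(3,4) by (auto simp: T_def S matrices_def)
  then show fin: "finite {M \<in> S. ?f M \<noteq> 0}" using T by (rule finite_subset)
  have "sum' ?f S = sum ?f {M \<in> S. ?f M \<noteq> 0}" using fin by (simp add: sum.G_def)
  also have "\<dots> = sum ?f T"
    using sub by (intro sum.mono_neutral_left [OF T]) (auto simp: T_def S matrices_def)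
  also have "\<dots> = (\<Sum>p\<in>A \<times> B. sum ?f (matrices b (fst p) (snd p)))"
    unfolding T_def using assms(1,2)
    by (intro sum.UNION_disjoint) (auto simp: finite_matrices, auto simp: matrices_def)
  also have "\<dots> = (\<Sum>p\<in>A \<times> B. u (fst p) * v (snd p) * int (card (matrices b (fst p) (snd p))))"
  proof (rule sum.cong [OF refl])
    fix p
    have "sum ?f (matrices b (fst p) (snd p)) = (\<Sum>M\<in>matrices b (fst p) (snd p). u (fst p) * v (snd p))"
      by (rule sum.cong) (auto simp: matrices_def)
    then show "sum ?f (matrices b (fst p) (snd p)) =
        u (fst p) * v (snd p) * int (card (matrices b (fst p) (snd p)))" by simp
  qed
  also have "\<dots> = (\<Sum>\<gamma>\<in>A. \<Sum>\<delta>\<in>B. u \<gamma> * v \<delta> * int (card (matrices b \<gamma> \<delta>)))"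
    by (simp add: sum.cartesian_product case_prod_unfold)
  finally show "sum' ?f S = (\<Sum>\<gamma>\<in>A. \<Sum>\<delta>\<in>B. u \<gamma> * v \<delta> * int (card (matrices b \<gamma> \<delta>)))" .
qed

text \<open>The common form of both identities: \<open>s \<rho>\<close> is either \<open>schur \<rho>\<close> or \<open>schur (conjugate \<rho>)\<close>.\<close>

lemma sum_schur_coord_mult:
  assumes "lam \<in> partitions" "\<nu> \<in> partitions" "weight lam \<le> d"
    and s: "\<And>\<rho>. \<rho> \<in> partitions \<Longrightarrow> s \<rho> = jacobi_trudi b (weight \<rho>) \<rho>"
    and S: "S = {M. \<forall>p. b \<longrightarrow> lookup M p \<le> 1}"
  shows "finite {M \<in> S. \<epsilon> (\<kappa> + row M) lam * \<epsilon> (\<mu> + col M) \<nu> \<noteq> 0} \<and>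
    (\<Sum>\<rho>\<in>partitions_upto d. schur_coord lam (schur \<kappa> * s \<rho>) * schur_coord \<nu> (schur \<mu> * schur \<rho>)) =
      sum' (\<lambda>M. \<epsilon> (\<kappa> + row M) lam * \<epsilon> (\<mu> + col M) \<nu>) S"
proof -
  let ?A = "bounded_compositions (weight lam)" and ?B = "bounded_compositions (weight \<nu>)"
  let ?u = "\<lambda>\<gamma>. \<epsilon> (\<kappa> + \<gamma>) lam" and ?v = "\<lambda>\<delta>. \<epsilon> (\<mu> + \<delta>) \<nu>"
  have support: "\<gamma> \<in> bounded_compositions (weight \<tau>)"
    if "\<epsilon> (\<alpha> + \<gamma>) \<tau> \<noteq> 0" "\<tau> \<in> partitions" for \<alpha> \<gamma> \<tau>
    using that schur_coord_schur_nonzeroD [of \<tau> "\<alpha> + \<gamma>"]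
    by (simp add: eps_eq bounded_compositions_def keys_plus_composition weight_add)
  have "(\<Sum>\<rho>\<in>partitions_upto d. schur_coord lam (schur \<kappa> * s \<rho>) * schur_coord \<nu> (schur \<mu> * schur \<rho>)) =
      (\<Sum>\<rho>\<in>partitions_upto d. (\<Sum>\<gamma>\<in>?A. coeff_of (s \<rho>) \<gamma> * ?u \<gamma>) *
        (\<Sum>\<delta>\<in>?B. coeff_of (schur \<rho>) \<delta> * ?v \<delta>))"
    using assms(1,2) by (simp add: schur_coord_mult [OF finite_bounded order_refl] eps_eq)
  also have "\<dots> = (\<Sum>\<rho>\<in>partitions_upto d. \<Sum>\<gamma>\<in>?A. \<Sum>\<delta>\<in>?B.
      ?u \<gamma> * ?v \<delta> * (coeff_of (s \<rho>) \<gamma> * coeff_of (schur \<rho>) \<delta>))"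
    unfolding sum_product by (simp only: mult_ac)
  also have "\<dots> = (\<Sum>\<gamma>\<in>?A. \<Sum>\<delta>\<in>?B. \<Sum>\<rho>\<in>partitions_upto d.
      ?u \<gamma> * ?v \<delta> * (coeff_of (s \<rho>) \<gamma> * coeff_of (schur \<rho>) \<delta>))"
    by (subst sum.swap, intro sum.cong refl sum.swap)
  \<comment> \<open>With the sum over \<rho> innermost, the Cauchy identity collapses it to a number
    of matrices; its bound holds because \<gamma> weighs at most as much as lam.\<close>
  also have "\<dots> = (\<Sum>\<gamma>\<in>?A. \<Sum>\<delta>\<in>?B. ?u \<gamma> * ?v \<delta> * int (card (matrices b \<gamma> \<delta>)))"
  proof (intro sum.cong refl)
    fix \<gamma> \<delta> assume "\<gamma> \<in> ?A"
    then have "weight \<gamma> \<le> d" using assms(3) by (simp add: bounded_compositions_def)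
    from cauchy_identity [OF this, of b \<delta>]
    have "int (card (matrices b \<gamma> \<delta>)) =
        (\<Sum>\<rho>\<in>partitions_upto d. coeff_of (s \<rho>) \<gamma> * coeff_of (schur \<rho>) \<delta>)"
      by (simp add: partitions_upto_def s)
    then show "(\<Sum>\<rho>\<in>partitions_upto d. ?u \<gamma> * ?v \<delta> * (coeff_of (s \<rho>) \<gamma> * coeff_of (schur \<rho>) \<delta>)) =
        ?u \<gamma> * ?v \<delta> * int (card (matrices b \<gamma> \<delta>))"
      by (simp add: sum_distrib_left)
  qed
  also have "\<dots> = sum' (\<lambda>M. ?u (row M) * ?v (col M)) S"
    by (rule sum_over_matrices(2) [OF finite_bounded finite_bounded _ _ S, symmetric])
      (auto intro: support assms(1,2))
  finally have "(\<Sum>\<rho>\<in>partitions_upto d.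
      schur_coord lam (schur \<kappa> * s \<rho>) * schur_coord \<nu> (schur \<mu> * schur \<rho>)) =
    sum' (\<lambda>M. ?u (row M) * ?v (col M)) S" .
  moreover have "finite {M \<in> S. ?u (row M) * ?v (col M) \<noteq> 0}"
    by (rule sum_over_matrices(1) [OF finite_bounded finite_bounded _ _ S])
      (auto intro: support assms(1,2))
  ultimately show ?thesis by blast
qed

text \<open>Finiteness accompanies each identity because \<open>sum'\<close> alone would not
  distinguish a vanishing sum from one with infinite support.\<close>

theorem mainTheorem7:
  fixes \<kappa> lam \<mu> \<nu> :: composition
  assumes "\<kappa> \<in> partitions" "lam \<in> partitions" "\<mu> \<in> partitions" "\<nu> \<in> partitions"
  shows "finite {M :: matrix. \<epsilon> (\<kappa> + row M) lam * \<epsilon> (\<mu> + col M) \<nu> \<noteq> 0} \<and>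
    \<langle>skew_schur lam \<kappa>, skew_schur \<nu> \<mu>\<rangle> =
      sum' (\<lambda>M. \<epsilon> (\<kappa> + row M) lam * \<epsilon> (\<mu> + col M) \<nu>) UNIV \<and>
    finite {M \<in> binary_matrices.
      \<epsilon> (conjugate \<kappa> + col M) (conjugate lam) * \<epsilon> (\<mu> + row M) \<nu> \<noteq> 0} \<and>
    \<langle>skew_schur lam \<kappa>, skew_schur \<nu> \<mu>\<rangle> =
      sum' (\<lambda>M. \<epsilon> (conjugate \<kappa> + col M) (conjugate lam) * \<epsilon> (\<mu> + row M) \<nu>) binary_matrices"
proof -
  \<comment> \<open>The bound must cover the partition paired with the row sums, which is lam in the
    first identity and \<nu> in the second.\<close>
  let ?d = "max (weight lam) (weight \<nu>)"
  have scalar: "\<langle>skew_schur lam \<kappa>, skew_schur \<nu> \<mu>\<rangle> = (\<Sum>\<rho>\<in>partitions_upto ?d.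
      schur_coord lam (schur \<kappa> * schur \<rho>) * schur_coord \<nu> (schur \<mu> * schur \<rho>))"
    using assms by (intro scalar_skew_schur) simp_all
  \<comment> \<open>The index \<rho> is replaced by its conjugate and the coordinate at lam is
    transposed. The factors are exchanged so that the conjugated Schur function, a determinant in
    the e_k, stands in the factor that receives the row sums.\<close>
  also have "\<dots> = (\<Sum>\<rho>\<in>partitions_upto ?d. schur_coord \<nu> (schur \<mu> * schur (conjugate \<rho>)) *
      schur_coord (conjugate lam) (schur (conjugate \<kappa>) * schur \<rho>))"
    by (rule sum.reindex_bij_witness [where i = conjugate and j = conjugate])
      (simp_all add: partitions_upto_def conjugate_in_partitions conjugate_conjugate weight_conjugate
        schur_coord_mult_conjugate assms)
  finally have scalar_conj: "\<langle>skew_schur lam \<kappa>, skew_schur \<nu> \<mu>\<rangle> = \<dots>" .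
  have binary: "binary_matrices = {M. \<forall>p. True \<longrightarrow> lookup M p \<le> 1}"
    by (auto simp: binary_matrices_def le_Suc_eq)
  have "finite {M \<in> UNIV. \<epsilon> (\<kappa> + row M) lam * \<epsilon> (\<mu> + col M) \<nu> \<noteq> 0} \<and>
      \<langle>skew_schur lam \<kappa>, skew_schur \<nu> \<mu>\<rangle> =
        sum' (\<lambda>M. \<epsilon> (\<kappa> + row M) lam * \<epsilon> (\<mu> + col M) \<nu>) UNIV"
    unfolding scalar
    by (rule sum_schur_coord_mult [where b = False])
      (simp_all add: assms schur_eq_jacobi_trudi keys_partition)
  moreover have "finite {M \<in> binary_matrices. \<epsilon> (\<mu> + row M) \<nu> * \<epsilon> (conjugate \<kappa> + col M) (conjugate lam) \<noteq> 0} \<and>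
      \<langle>skew_schur lam \<kappa>, skew_schur \<nu> \<mu>\<rangle> =
        sum' (\<lambda>M. \<epsilon> (\<mu> + row M) \<nu> * \<epsilon> (conjugate \<kappa> + col M) (conjugate lam)) binary_matrices"
    unfolding scalar_conj
    by (rule sum_schur_coord_mult [where b = True])
      (simp_all add: assms conjugate_in_partitions schur_conjugate_eq_jacobi_trudi binary)
  ultimately show ?thesis
    by (simp add: mult.commute [of "\<epsilon> (conjugate \<kappa> + _) (conjugate lam)"])
qed

end
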